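(* Let $\Omega>0$, $\varepsilon\in(0,\Omega)$, and let $\mathcal K,\widehat{\mathcal K},\mathcal X_L,\mathcal X_H,\mathcal M_L,\mathcal M_H$ and the frequency representations be as defined in the context. Let $\mathcal A\in\{\mathcal X_L,\mathcal M_L\}$, $\mathcal B\in\{\mathcal X_H,\mathcal M_H\}$ and $k\in\mathcal K$. For $x=x_L+x_H$ with $x_L\in\mathcal A$, $x_H\in\mathcal B$, put $$y(t)=\int_t^{+\infty}k(t-s)x(s)\,ds,$$ and, for $\widehat k_L,\widehat k_H\in\widehat{\mathcal K}$, $$\widehat y(t)=\widehat y_L(t)+\widehat y_H(t),\quad \widehat y_L(t)=\int_{-\infty}^t\widehat k_L(t-s)x_L(s)\,ds,\quad \widehat y_H(t)=\int_{-\infty}^t\widehat k_H(t-s)x_H(s)\,ds .$$ Then $y$ can be approximately predicted by such $\widehat y$, in the following sense: (a) For every $\eta>0$ there exist $\widehat k_L,\widehat k_H\in\widehat{\mathcal K}$ (not depending on $x_L,x_H$) such that $\|y-\widehat y\|_{L_\infty(\mathbf R)}\le\eta\,(\|\mathcal F x_L\|_{\mathcal A}+\|\mathcal F x_H\|_{\mathcal B})$ for all $x_L\in\mathcal A$, $x_H\in\mathcal B$, where $\|\cdot\|_{\mathcal X_L}=\|\cdot\|_{\mathcal X_H}=\|\cdot\|_{L_2(\mathbf R)}$ and $\|\cdot\|_{\mathcal M_L}=\|\cdot\|_{\mathcal M_H}=\|\cdot\|_{C(\mathbf R)^*}$. (b) If $\mathcal A=\mathcal X_L$ and $\mathcal B=\mathcal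 X_H$, there exist sequences $\{\widehat k_{L,m}\}_{m=1}^\infty,\{\widehat k_{H,m}\}_{m=1}^\infty\subset\widehat{\mathcal K}$ (not depending on $x_L,x_H$) such that, with $\widehat y_m$ denoting $\widehat y$ for the kernels $\widehat k_L=\widehat k_{L,m}$, $\widehat k_H=\widehat k_{H,m}$, one has $\|y-\widehat y_m\|_{L_2(\mathbf R)}\to0$ as $m\to\infty$ for all $x_L\in\mathcal X_L$, $x_H\in\mathcal X_H$. (c) If $\mathcal A=\mathcal X_L$ and $\mathcal B=\mathcal X_H$, then for every $q>2$ and $\eta>0$ there exist $\widehat k_L,\widehat k_H\in\widehat{\mathcal K}$ (not depending on $x_L,x_H$) such that $\|y-\widehat y\|_{L_2(\mathbf R)}\le\eta\,(\|\mathcal F x_L\|_{L_q(\mathbf R)}+\|\mathcal F x_H\|_{L_q(\mathbf R)})$ for all $x_L\in\mathcal X_L$, $x_H\in\mathcal X_H$ (trivially satisfied when the right-hand side is infinite).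
   Context: Notation. $i=\sqrt{-1}$ and $\mathbf C^+=\{z\in\mathbf C:\ \mathrm{Re}\, z>0\}$. For a complex-valued $x\in L_1(\mathbf R)$ or $x\in L_2(\mathbf R)$, $X=\mathcal F x$ denotes the Fourier transform $X(i\omega)=\int_{-\infty}^{\infty}e^{-i\omega t}x(t)\,dt$, $\omega\in\mathbf R$ (an element of $L_2(\mathbf R)$ when $x\in L_2(\mathbf R)$), regarded as a function of $\omega\in\mathbf R$ and also written $X(\omega)$. For $v\in L_2(\mathbf R)$ with $v(t)=0$ for $t<0$, $(\mathcal L v)(p)=\int_0^\infty e^{-pt}v(t)\,dt$, $p\in\mathbf C^+$. For $r\in[1,+\infty]$, $H^r$ is the Hardy space of functions $h$ holomorphic on $\mathbf C^+$ with finite norm $\|h\|_{H^r}=\sup_{s>0}\|h(s+i\,\cdot)\|_{L_r(\mathbf R)}$. Kernels. $\mathcal K$ is the class of functions $k:\mathbf R\to\mathbf R$ such that $k(t)=0$ for $t>0$ and such that $K=\mathcal F k$ has the form $K(i\omega)=d(i\omega)/\delta(i\omega)$, where $d$ and $\delta$ are polynomials with $\deg d<\deg\delta$, and such that if $\delta(p)=0$ for $p\in\mathbf C$, then $\mathrm{Re}\,p>0$ and $|\mathrm{Im}\,p|<\Omega$. $\widehat{\mathcal K}$ is the class of functions $\widehat k:\mathbf R\to\mathbf R$ such that $\widehat k(t)=0$ for $t<0$ and $\mathcal L\widehat k\in H^2\cap H^\infty$. $L_2$ classes. $\mathcal X_L=\{x\in L_2(\mathbf R):\ X(\omega)=0\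 \text{if}\ |\omega|>\Omega,\ X=\mathcal F x\}$, $\mathcal X_H=\{x\in L_2(\mathbf R):\ X(\omega)=0\ \text{if}\ |\omega|<\Omega,\ X=\mathcal F x\}$ (complex-valued functions; vanishing for almost every such $\omega$). Bounded classes. $C(\mathbf R)$ is the Banach space of bounded continuous $f:\mathbf R\to\mathbf C$ (sup norm), $C(\mathbf R)^*$ its dual. $\mathcal M_\infty$ is the class of all $x:\mathbf R\to\mathbf C$ for which there exist $X_c\in L_1(\mathbf R)$ (complex-valued), $\{\omega_k\}_{k=1}^\infty\subset\mathbf R$ and $\{c_k\}_{k=1}^\infty\subset\mathbf C$ with $\sum_k|c_k|<+\infty$ such that $$x(t)=\frac1{2\pi}\sum_{k=1}^\infty c_ke^{i\omega_kt}+\frac1{2\pi}\int_{-\infty}^{+\infty}e^{i\omega t}X_c(\omega)\,d\omega .$$ For $x\in\mathcal M_\infty$, when $x$ is considered as an element of $\mathcal M_L$ or $\mathcal M_H$, $X=\mathcal F x$ denotes the (uniquely determined) functional $X\in C(\mathbf R)^*$, $\langle f,X\rangle=\sum_kc_kf(\omega_k)+\int_{-\infty}^{+\infty}f(\omega)X_c(\omega)\,d\omega$, $f\in C(\mathbf R)$. $\mathcal M_L$ is the set of $x\in\mathcal M_\infty$ such that $|\omega_k|\le\Omega-\varepsilon$ for all $k$ and $\mathrm{supp}\,X_c\subseteq[-\Omega+\varepsilon,\Omega-\varepsilon]$; $\mathcal M_H$ is the set of $x\in\mathcal M_\infty$ such that $|\omega_k|\ge\Omega+\varepsilon$ for all $k$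 and $\mathrm{supp}\,X_c\subseteq(-\infty,-\Omega-\varepsilon]\cup[\Omega+\varepsilon,+\infty)$. *)

theory Defs
  imports
    "HOL-Analysis.Analysis"
    "HOL-Probability.Essential_Supremum"
    "HOL-Computational_Algebra.Polynomial"
begin

text \<open>Elements of the Lebesgue spaces are represented by Borel functions; all conditions on
  them other than pointwise ones stated for kernels are invariant under almost everywhere
  equality. The norm below takes values in the extended non-negative reals, with an extended
  exponent, and is infinite on non-measurable functions.\<close>

definition Lnorm :: "ennreal \<Rightarrow> (real \<Rightarrow> complex) \<Rightarrow> ennreal" where
  "Lnorm r f =
    (if f \<notin> borel_measurable lborel then \<infinity>
     else if r = \<infinity> then esssup lborel (\<lambda>t. ennreal (norm (f t)))
     else (let I = (\<integral>\<^sup>+ t. ennreal (norm (f t) powr enn2real r) \<partial>lborel)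
           in if I = \<infinity> then \<infinity> else ennreal (enn2real I powr (1 / enn2real r))))"

definition Lspace :: "ennreal \<Rightarrow> (real \<Rightarrow> complex) set" where
  "Lspace r = {f \<in> borel_measurable lborel. Lnorm r f < \<infinity>}"


definition L1_fourier :: "(real \<Rightarrow> complex) \<Rightarrow> real \<Rightarrow> complex" where
  "L1_fourier x \<omega> = (\<integral>t. exp (- (\<i> * of_real \<omega> * of_real t)) * x t \<partial>lborel)"

text \<open>On square integrable functions the Fourier transform is the mean-square limit of the
  transforms of the truncations. It is determined only up to null sets, hence the relational
  form; the functional form picks a representative.\<close>

definition has_L2_fourier :: "(real \<Rightarrow> complex) \<Rightarrow> (real \<Rightarrow> complex) \<Rightarrow> bool" where
  "has_L2_fourier x X \<longleftrightarrow>
     x \<in> Lspace 2 \<and> X \<in> Lspace 2 \<and>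
     (\<lambda>n. Lnorm 2 (\<lambda>\<omega>. X \<omega> - L1_fourier (\<lambda>t. indicator {- real n..real n} t * x t) \<omega>))
        \<longlonglongrightarrow> 0"

definition L2_fourier :: "(real \<Rightarrow> complex) \<Rightarrow> real \<Rightarrow> complex" where
  "L2_fourier x = (SOME X. has_L2_fourier x X)"

definition has_fourier :: "(real \<Rightarrow> complex) \<Rightarrow> (real \<Rightarrow> complex) \<Rightarrow> bool" where
  "has_fourier x X \<longleftrightarrow>
     (x \<in> Lspace 1 \<and> (\<forall>\<omega>. X \<omega> = L1_fourier x \<omega>)) \<or> has_L2_fourier x X"


definition right_half_plane :: "complex set" where
  "right_half_plane = {z. Re z > 0}"

definition laplace :: "(real \<Rightarrow> complex) \<Rightarrow> complex \<Rightarrow> complex" where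
  "laplace v p = (\<integral>t\<in>{0..}. exp (- (p * of_real t)) * v t \<partial>lborel)"

definition Hardy_norm :: "ennreal \<Rightarrow> (complex \<Rightarrow> complex) \<Rightarrow> ennreal" where
  "Hardy_norm r h = (SUP s\<in>{0<..}. Lnorm r (\<lambda>\<omega>. h (Complex s \<omega>)))"

definition Hardy :: "ennreal \<Rightarrow> (complex \<Rightarrow> complex) set" where
  "Hardy r = {h. h holomorphic_on right_half_plane \<and> Hardy_norm r h < \<infinity>}"


definition anticausal_kernels :: "real \<Rightarrow> (real \<Rightarrow> real) set" where
  "anticausal_kernels \<Omega> =
     {k. (\<forall>t>0. k t = 0) \<and>
         (\<exists>d \<delta> :: complex poly.
            degree d < degree \<delta> \<and>
            has_fourier (\<lambda>t. of_real (k t))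
              (\<lambda>\<omega>. poly d (\<i> * of_real \<omega>) / poly \<delta> (\<i> * of_real \<omega>)) \<and>
            (\<forall>p. poly \<delta> p = 0 \<longrightarrow> Re p > 0 \<and> \<bar>Im p\<bar> < \<Omega>))}"

definition causal_kernels :: "(real \<Rightarrow> real) set" where
  "causal_kernels =
     {k. (\<forall>t<0. k t = 0) \<and> (\<lambda>t. of_real (k t)) \<in> Lspace 2 \<and>
         laplace (\<lambda>t. of_real (k t)) \<in> Hardy 2 \<inter> Hardy \<infinity>}"

definition anticausal_conv :: "(real \<Rightarrow> real) \<Rightarrow> (real \<Rightarrow> complex) \<Rightarrow> real \<Rightarrow> complex" where
  "anticausal_conv k x t = (\<integral>s\<in>{t..}. of_real (k (t - s)) * x s \<partial>lborel)"

definition causal_conv :: "(real \<Rightarrow> real) \<Rightarrow> (real \<Rightarrow> complex) \<Rightarrow> real \<Rightarrow> complex" where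
  "causal_conv k x t = (\<integral>s\<in>{..t}. of_real (k (t - s)) * x s \<partial>lborel)"

text \<open>A kernel whose Laplace transform is in \<open>H\<^sup>2 \<inter> H\<^sup>\<infinity>\<close> need not be integrable,
  so its convolution with a merely bounded function need not converge.\<close>

definition causal_conv_exists :: "(real \<Rightarrow> real) \<Rightarrow> (real \<Rightarrow> complex) \<Rightarrow> bool" where
  "causal_conv_exists k x \<longleftrightarrow>
     (\<forall>t. set_integrable lborel {..t} (\<lambda>s. of_real (k (t - s)) * x s))"


definition X_L :: "real \<Rightarrow> (real \<Rightarrow> complex) set" where
  "X_L \<Omega> = {x \<in> Lspace 2.
     \<exists>X. has_L2_fourier x X \<and> (AE \<omega> in lborel. \<bar>\<omega>\<bar> > \<Omega> \<longrightarrow> X \<omega> = 0)}"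

definition X_H :: "real \<Rightarrow> (real \<Rightarrow> complex) set" where
  "X_H \<Omega> = {x \<in> Lspace 2.
     \<exists>X. has_L2_fourier x X \<and> (AE \<omega> in lborel. \<bar>\<omega>\<bar> < \<Omega> \<longrightarrow> X \<omega> = 0)}"


definition spectral_rep ::
  "(nat \<Rightarrow> complex) \<Rightarrow> (nat \<Rightarrow> real) \<Rightarrow> (real \<Rightarrow> complex) \<Rightarrow> (real \<Rightarrow> complex) \<Rightarrow> bool" where
  "spectral_rep c w Xc x \<longleftrightarrow>
     summable (\<lambda>k. norm (c k)) \<and> Xc \<in> Lspace 1 \<and>
     (\<forall>t. x t = 1 / (2 * of_real pi) * (\<Sum>k. c k * exp (\<i> * of_real (w k) * of_real t))
               + 1 / (2 * of_real pi) * (\<integral>\<omega>. exp (\<i> * of_real \<omega> * of_real t) * Xc \<omega> \<partial>lborel))"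

text \<open>The dual of the bounded continuous functions is rendered by the real-linear bounded
  operators into the complex numbers. The functional below is complex-linear, and its operator
  norm is the same whether it is regarded as a real-linear or as a complex-linear map. It does
  not depend on the representation chosen, although the data of a representation are not
  unique.\<close>

definition M_fourier :: "(real \<Rightarrow> complex) \<Rightarrow> (real \<Rightarrow>\<^sub>C complex) \<Rightarrow>\<^sub>L complex" where
  "M_fourier x = (THE X. \<exists>c w Xc. spectral_rep c w Xc x \<and>
     (\<forall>f. blinfun_apply X f =
        (\<Sum>k. c k * apply_bcontfun f (w k)) + (\<integral>\<omega>. apply_bcontfun f \<omega> * Xc \<omega> \<partial>lborel)))"

text \<open>An integrable function has support in a closed set iff it vanishes almost everywhere
  outside that set.\<close>

definition M_L :: "real \<Rightarrow> real \<Rightarrow> (real \<Rightarrow> complex) set" where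
  "M_L \<Omega> \<epsilon> = {x. \<exists>c w Xc. spectral_rep c w Xc x \<and>
     (\<forall>k. \<bar>w k\<bar> \<le> \<Omega> - \<epsilon>) \<and>
     (AE \<omega> in lborel. \<omega> \<notin> {- \<Omega> + \<epsilon>..\<Omega> - \<epsilon>} \<longrightarrow> Xc \<omega> = 0)}"

definition M_H :: "real \<Rightarrow> real \<Rightarrow> (real \<Rightarrow> complex) set" where
  "M_H \<Omega> \<epsilon> = {x. \<exists>c w Xc. spectral_rep c w Xc x \<and>
     (\<forall>k. \<bar>w k\<bar> \<ge> \<Omega> + \<epsilon>) \<and>
     (AE \<omega> in lborel. \<omega> \<notin> {..- \<Omega> - \<epsilon>} \<union> {\<Omega> + \<epsilon>..} \<longrightarrow> Xc \<omega> = 0)}"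

definition X_norm :: "(real \<Rightarrow> complex) \<Rightarrow> ennreal" where
  "X_norm x = Lnorm 2 (L2_fourier x)"

definition M_norm :: "(real \<Rightarrow> complex) \<Rightarrow> ennreal" where
  "M_norm x = ennreal (norm (M_fourier x))"

end

theory Submission
  imports Defs
    "HOL-Probability.Probability"
    "HOL-Real_Asymp.Real_Asymp"
    "HOL-Computational_Algebra.Fundamental_Theorem_Algebra"
begin

text \<open>
  Let \<open>K\<close> be the transfer function of \<open>k\<close>. For causal kernels with transfer functions \<open>K\<^sub>L\<close> and
  \<open>K\<^sub>H\<close> the prediction error is a sum of two convolutions, of \<open>x\<^sub>L\<close> with a kernel of transfer
  function \<open>K - K\<^sub>L\<close> and of \<open>x\<^sub>H\<close> with one of transfer function \<open>K - K\<^sub>H\<close>. A convolution sees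
  the transfer function only on the spectrum of the process. Therefore \<open>K\<^sub>L\<close> has to be close to
  \<open>K\<close> only for \<open>\<bar>\<omega>\<bar> \<le> \<Omega>\<close>, and \<open>K\<^sub>H\<close> only for \<open>\<bar>\<omega>\<bar> \<ge> \<Omega>\<close>. On either set alone
  this is possible although the poles of \<open>K\<close> lie on the wrong side of the imaginary axis: each set
  is a segment or, with infinity added, becomes one under \<open>z \<mapsto> 1 / z\<close>, and a segment does not
  surround anything. Concretely, \<open>K\<close> is approximated by a polynomial in \<open>z = \<i> * \<omega>\<close> on the low
  band (\<open>low_band_approx\<close>) and by a polynomial without constant term in \<open>1 / z\<close> on the high band
  (\<open>high_band_approx\<close>). A small change turns both into polynomials without constant term in
  \<open>1 / (\<mu> + z)\<close> with \<open>\<mu> > 0\<close> and real coefficients, which are the transfer functions of the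
  causal kernels \<open>exp_poly_kernel\<close>.

  The error is made at most \<open>e / sqrt (1 + \<omega>\<^sup>2)\<close> on the band. This bound is small, square
  integrable and bounded by \<open>e\<close>, so all the estimates follow from it: the uniform one for \<open>L\<^sub>2\<close>
  processes by the Cauchy-Schwarz inequality (\<open>norm_conv_in_band_le\<close>), the uniform one for
  processes with a spectral representation by pairing with the measure (\<open>norm_conv_spectral_le\<close>),
  and the two estimates in \<open>L\<^sub>2\<close> by the Plancherel inequality (\<open>sq_norm_conv_in_band_le\<close>), for
  \<open>q > 2\<close> combined with \<open>weighted_sq_norm_le_Lnorm\<close>.

  The Fourier analysis that this requires is derived from one regularised pairing,
  \<open>spectral_pairing\<close>, and its limit \<open>spectral_pairing_limit\<close>: the Plancherel inequality,
  Parseval's formula for convolutions, the uniqueness of the functional attached to a function in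
  \<open>\<M>\<^sub>\<infinity>\<close>, and the fact that \<open>k\<close>, which is given only through its transform, agrees almost
  everywhere with an integrable exponential polynomial on the negative half-line
  (\<open>anticausal_kernel_tame\<close>).
\<close>

section \<open>Gaussian regularisation of Fourier integrals\<close>

lemma cis_borel_measurable [measurable]: "cis \<in> borel_measurable borel"
  by (intro borel_measurable_continuous_onI continuous_intros)

lemma L1_fourier_cis: "L1_fourier x \<omega> = (\<integral>t. cis (- (\<omega> * t)) * x t \<partial>lborel)"
  unfolding L1_fourier_def cis_conv_exp by (simp add: mult.assoc)

lemma L1_fourier_measurable [measurable]:
  assumes [measurable]: "x \<in> borel_measurable lborel"
  shows "L1_fourier x \<in> borel_measurable borel"
  unfolding L1_fourier_cis[abs_def] by measurable

lemma integrable_cis_mult: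
  fixes m :: "'a \<Rightarrow> complex"
  assumes "integrable N m" and [measurable]: "W \<in> borel_measurable N"
  shows "integrable N (\<lambda>n. cis (W n) * m n)" "integrable N (\<lambda>n. m n * cis (W n))"
proof -
  have [measurable]: "m \<in> borel_measurable N" using assms by auto
  show "integrable N (\<lambda>n. cis (W n) * m n)"
    by (rule Bochner_Integration.integrable_bound[OF assms(1)]) (auto simp: norm_mult)
  then show "integrable N (\<lambda>n. m n * cis (W n))" by (simp add: mult.commute)
qed

lemma norm_L1_fourier_le:
  "norm (L1_fourier x \<omega>) \<le> (\<integral>t. norm (x t) \<partial>lborel)"
proof -
  have "norm (L1_fourier x \<omega>) \<le> (\<integral>t. norm (cis (- (\<omega> * t)) * x t) \<partial>lborel)"
    unfolding L1_fourier_cis by (rule integral_norm_bound)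
  then show ?thesis by (simp add: norm_mult)
qed

text \<open>The regularising factor for inverse Fourier integrals. Its own transform is
  \<open>2 \<pi>\<close> times the normal density with standard deviation \<open>\<rho>\<close>, so that letting
  \<open>\<rho> \<rightarrow> 0\<close> turns a regularised integral into evaluation at a point.\<close>

definition gauss :: "real \<Rightarrow> real \<Rightarrow> real" where
  "gauss \<rho> \<omega> = exp (- (\<rho> * \<omega>)\<^sup>2 / 2)"

lemma gauss_measurable [measurable]: "gauss \<rho> \<in> borel_measurable borel"
  unfolding gauss_def by measurable

lemma gauss_bounds: "0 \<le> gauss \<rho> \<omega>" "gauss \<rho> \<omega> \<le> 1"
  by (auto simp: gauss_def)

lemma gauss_integrable: assumes "\<rho> > 0" shows "integrable lborel (gauss \<rho>)"
proof -
  have "integrable lborel (\<lambda>\<omega>. std_normal_density (0 + \<rho> * \<omega>))"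
    using assms by (intro lborel_integrable_real_affine) auto
  then have "integrable lborel (\<lambda>\<omega>. sqrt (2*pi) * std_normal_density (0 + \<rho> * \<omega>))"
    by (rule integrable_mult_right)
  then show ?thesis by (simp add: std_normal_density_def gauss_def[abs_def])
qed

lemma gauss_tendsto_1: "(\<lambda>n. gauss (1 / real (Suc n)) t) \<longlonglongrightarrow> 1"
proof -
  have "(\<lambda>n. 1 / real (Suc n)) \<longlonglongrightarrow> 0" by real_asymp
  then have "(\<lambda>n. gauss (1 / Suc n) t) \<longlonglongrightarrow> exp (- (0 * t)\<^sup>2 / 2)"
    unfolding gauss_def by (intro tendsto_intros) auto
  then show ?thesis by simp
qed

text \<open>A change of scale in the characteristic function of the standard normal distribution.\<close>

lemma gauss_fourier:
  assumes \<rho>: "\<rho> > 0"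
  shows "(\<integral>\<omega>. cis (u * \<omega>) * of_real (gauss \<rho> \<omega>) \<partial>lborel) = of_real (2 * pi * normal_density 0 \<rho> u)"
proof -
  have "of_real (exp (- ((u/\<rho>)^2) / 2)) = char std_normal_distribution (u/\<rho>)"
    by (simp add: char_std_normal_distribution)
  also have "\<dots> = (\<integral>z. std_normal_density z *\<^sub>R cis (u / \<rho> * z) \<partial>lborel)"
    unfolding char_def by (subst integral_density) (auto simp: cis_conv_exp)
  also have "\<dots> = \<bar>\<rho>\<bar> *\<^sub>R (\<integral>z. std_normal_density (0 + \<rho> * z) *\<^sub>R cis (u / \<rho> * (0 + \<rho> * z)) \<partial>lborel)"
    using \<rho> by (intro lborel_integral_real_affine) auto
  also have "\<dots> = of_real \<rho> * (\<integral>z. of_real (1 / sqrt (2*pi)) * (cis (u * z) * of_real (gauss \<rho> z)) \<partial>lborel)"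
    using \<rho> by (simp add: std_normal_density_def gauss_def scaleR_conv_of_real mult_ac)
  also have "\<dots> = of_real (\<rho> / sqrt (2*pi)) * (\<integral>z. cis (u * z) * of_real (gauss \<rho> z) \<partial>lborel)"
    by (subst integral_mult_right_zero) simp
  finally have "(\<integral>z. cis (u * z) * of_real (gauss \<rho> z) \<partial>lborel)
     = of_real (sqrt (2*pi) / \<rho> * exp (- ((u/\<rho>)^2) / 2))"
    using \<rho> by (simp add: field_simps)
  also have "sqrt (2*pi) / \<rho> * exp (- ((u/\<rho>)^2) / 2) = 2 * pi * normal_density 0 \<rho> u"
  proof -
    have "sqrt (2 * pi) * sqrt (2 * pi) = 2 * pi" by simp
    then show ?thesis using \<rho>
      by (simp add: normal_density_def real_sqrt_mult power_divide field_simps)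
  qed
  finally show ?thesis .
qed

text \<open>An integral of oscillations \<open>m n * cis (W n * t)\<close> over an arbitrary measure space covers at once
  the Fourier transform of an integrable function, the series part and the integral part of a
  function in \<open>\<M>\<^sub>\<infinity>\<close>; hence the general measure space here and in the lemmas below. The formula
  is Fubini's theorem.\<close>

lemma multiplication_formula:
  fixes m :: "'a \<Rightarrow> complex" and \<psi> :: "real \<Rightarrow> complex"
  assumes N: "sigma_finite_measure N" and m: "integrable N m"
    and W[measurable]: "W \<in> borel_measurable N" and \<psi>: "integrable lborel \<psi>"
  shows "(\<integral>t. (\<integral>n. m n * cis (W n * t) \<partial>N) * \<psi> t \<partial>lborel)
       = (\<integral>n. m n * (\<integral>t. cis (W n * t) * \<psi> t \<partial>lborel) \<partial>N)"
proof -
  interpret N: sigma_finite_measure N by fact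
  interpret P: pair_sigma_finite N "lborel :: real measure" ..
  have [measurable]: "m \<in> borel_measurable N" "\<psi> \<in> borel_measurable borel" using m \<psi> by auto
  let ?f = "\<lambda>n t. m n * cis (W n * t) * \<psi> t"
  have int: "integrable (N \<Otimes>\<^sub>M lborel) (case_prod ?f)"
  proof (rule P.Fubini_integrable)
    show "integrable N (\<lambda>x. \<integral>y. norm (case (x, y) of (n, t) \<Rightarrow> ?f n t) \<partial>lborel)"
      using m by (simp add: norm_mult)
    show "AE x in N. integrable lborel (\<lambda>y. case (x, y) of (n, t) \<Rightarrow> ?f n t)"
      using integrable_cis_mult(1)[OF \<psi>] by (auto simp: mult.assoc)
  qed measurable
  have "(\<integral>t. (\<integral>n. m n * cis (W n * t) \<partial>N) * \<psi> t \<partial>lborel) = (\<integral>t. (\<integral>n. ?f n t \<partial>N) \<partial>lborel)"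
    by simp
  also have "\<dots> = (\<integral>n. (\<integral>t. ?f n t \<partial>lborel) \<partial>N)"
    using int by (rule P.Fubini_integral)
  also have "\<dots> = (\<integral>n. m n * (\<integral>t. cis (W n * t) * \<psi> t \<partial>lborel) \<partial>N)"
    by (simp add: mult.assoc)
  finally show ?thesis .
qed

text \<open>The multiplication formula, used once for \<open>N\<close> and once for \<open>f\<close>, moves both oscillations onto
  the Gaussian, whose transform is explicit.\<close>

lemma spectral_pairing:
  fixes m :: "'a \<Rightarrow> complex" and f :: "real \<Rightarrow> complex"
  assumes N: "sigma_finite_measure N" and m: "integrable N m"
    and W[measurable]: "W \<in> borel_measurable N" and f: "integrable lborel f" and \<rho>: "\<rho> > 0"
  shows "(\<integral>t. (\<integral>n. m n * cis (W n * t) \<partial>N) * (L1_fourier f t * of_real (gauss \<rho> t)) \<partial>lborel)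
       = 2 * pi * (\<integral>n. m n * (\<integral>v. f v * of_real (normal_density 0 \<rho> (W n - v)) \<partial>lborel) \<partial>N)"
proof -
  have [measurable]: "f \<in> borel_measurable borel" using f by auto
  have gi: "integrable lborel (\<lambda>t. complex_of_real (gauss \<rho> t))"
    using gauss_integrable[OF \<rho>] by simp
  have 1: "integrable lborel (\<lambda>t. L1_fourier f t * of_real (gauss \<rho> t))"
  proof (rule Bochner_Integration.integrable_bound)
    show "integrable lborel (\<lambda>t. (\<integral>t. norm (f t) \<partial>lborel) * gauss \<rho> t)"
      using gauss_integrable[OF \<rho>] by simp
    show "AE t in lborel. norm (L1_fourier f t * of_real (gauss \<rho> t))
        \<le> norm ((\<integral>t. norm (f t) \<partial>lborel) * gauss \<rho> t)"
      by (intro AE_I2) (auto simp: norm_mult gauss_bounds intro!: mult_mono norm_L1_fourier_le order_trans[OF norm_L1_fourier_le])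
  qed measurable
  have 2: "(\<integral>t. cis (w * t) * (L1_fourier f t * of_real (gauss \<rho> t)) \<partial>lborel)
     = 2 * pi * (\<integral>v. f v * of_real (normal_density 0 \<rho> (w - v)) \<partial>lborel)" for w
  proof -
    have "(\<integral>t. cis (w * t) * (L1_fourier f t * of_real (gauss \<rho> t)) \<partial>lborel)
      = (\<integral>t. (\<integral>v. f v * cis ((-v) * t) \<partial>lborel) * (cis (w * t) * of_real (gauss \<rho> t)) \<partial>lborel)"
      by (simp add: L1_fourier_cis mult_ac)
    also have "\<dots> = (\<integral>v. f v * (\<integral>t. cis ((-v) * t) * (cis (w * t) * of_real (gauss \<rho> t)) \<partial>lborel) \<partial>lborel)"
      using f integrable_cis_mult(1)[OF gi, of "\<lambda>t. w * t"]
      by (intro multiplication_formula lborel.sigma_finite_measure_axioms) auto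
    also have "\<dots> = (\<integral>v. f v * (\<integral>t. cis ((w - v) * t) * of_real (gauss \<rho> t) \<partial>lborel) \<partial>lborel)"
      by (simp add: mult.assoc[symmetric] cis_mult algebra_simps)
    also have "\<dots> = (\<integral>v. (2 * pi) * (f v * of_real (normal_density 0 \<rho> (w - v))) \<partial>lborel)"
      unfolding gauss_fourier[OF \<rho>] by (simp add: mult_ac del: integral_mult_right_zero integral_mult_left_zero)
    also have "\<dots> = 2 * pi * (\<integral>v. f v * of_real (normal_density 0 \<rho> (w - v)) \<partial>lborel)"
      by (rule integral_mult_right_zero)
    finally show ?thesis .
  qed
  have "(\<integral>t. (\<integral>n. m n * cis (W n * t) \<partial>N) * (L1_fourier f t * of_real (gauss \<rho> t)) \<partial>lborel)
     = (\<integral>n. (2 * pi) * (m n * (\<integral>v. f v * of_real (normal_density 0 \<rho> (W n - v)) \<partial>lborel)) \<partial>N)"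
    by (subst multiplication_formula[OF N m W 1]) (simp only: 2, simp only: mult.left_commute)
  also have "\<dots> = 2 * pi * (\<integral>n. m n * (\<integral>v. f v * of_real (normal_density 0 \<rho> (W n - v)) \<partial>lborel) \<partial>N)"
    by (rule integral_mult_right_zero)
  finally show ?thesis .
qed

lemma gauss_mean_rescale:
  fixes f :: "real \<Rightarrow> complex"
  assumes \<rho>: "\<rho> > 0"
  shows "(\<integral>v. f v * of_real (normal_density 0 \<rho> (w - v)) \<partial>lborel)
    = (\<integral>z. f (w - \<rho> * z) * of_real (std_normal_density z) \<partial>lborel)"
proof -
  have "(\<integral>v. f v * of_real (normal_density 0 \<rho> (w - v)) \<partial>lborel)
    = \<bar>-\<rho>\<bar> *\<^sub>R (\<integral>z. f (w + (-\<rho>) * z) * of_real (normal_density 0 \<rho> (w - (w + (-\<rho>) * z))) \<partial>lborel)"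
    using \<rho> by (intro lborel_integral_real_affine) auto
  also have "\<dots> = (\<integral>z. of_real \<rho> * (f (w - \<rho> * z) * of_real (normal_density 0 \<rho> (\<rho> * z))) \<partial>lborel)"
    using \<rho> by (simp add: scaleR_conv_of_real)
  also have "\<dots> = (\<integral>z. f (w - \<rho> * z) * of_real (std_normal_density z) \<partial>lborel)"
  proof (intro Bochner_Integration.integral_cong refl)
    fix z
    have "\<rho> * normal_density 0 \<rho> (\<rho> * z) = std_normal_density z"
      using \<rho> by (simp add: normal_density_def real_sqrt_mult field_simps)
    then show "of_real \<rho> * (f (w - \<rho> * z) * of_real (normal_density 0 \<rho> (\<rho> * z))) =
        f (w - \<rho> * z) * of_real (std_normal_density z)"
      by (simp add: mult_ac flip: of_real_mult)
  qed
  finally show ?thesis .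
qed

text \<open>The central tool of the Fourier analysis below: a Fourier inversion formula that needs no
  integrability of the transform of \<open>f\<close>. The Gaussian means of \<open>f\<close> converge to \<open>f\<close> at
  points of continuity and are bounded, so the limit passes through the integral over \<open>N\<close>. With
  \<open>m = x\<close> and \<open>W s = t - s\<close> it yields Parseval's formula for a convolution; with \<open>W\<close> listing
  frequencies it recovers the spectral functional of a function in \<open>\<M>\<^sub>\<infinity>\<close>.\<close>

lemma spectral_pairing_limit:
  fixes m :: "'a \<Rightarrow> complex" and f :: "real \<Rightarrow> complex"
  assumes N: "sigma_finite_measure N" and m: "integrable N m"
    and W[measurable]: "W \<in> borel_measurable N" and f: "integrable lborel f"
    and bd: "\<And>v. norm (f v) \<le> B" and cont: "AE n in N. isCont f (W n)"
  shows "(\<lambda>j. 1 / (2 * pi) * (\<integral>t. (\<integral>n. m n * cis (W n * t) \<partial>N) *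
            (L1_fourier f t * of_real (gauss (1 / Suc j) t)) \<partial>lborel))
       \<longlonglongrightarrow> (\<integral>n. m n * f (W n) \<partial>N)"
proof -
  let ?\<rho> = "\<lambda>j. 1 / real (Suc j)"
  have [measurable]: "m \<in> borel_measurable N" "f \<in> borel_measurable borel" using m f by auto
  interpret N: sigma_finite_measure N by fact
  have \<rho>0: "?\<rho> \<longlonglongrightarrow> 0" by real_asymp
  have B: "B \<ge> 0" using bd[of 0] norm_ge_zero order_trans by blast
  let ?A = "\<lambda>j n. (\<integral>z. f (W n - ?\<rho> j * z) * of_real (std_normal_density z) \<partial>lborel)"
  have Ai: "integrable lborel (\<lambda>z. B * std_normal_density z)" by simp
  have Ab: "norm (?A j n) \<le> B" for j n
  proof -
    have "norm (?A j n) \<le> (\<integral>z. B * std_normal_density z \<partial>lborel)"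
      by (rule Bochner_Integration.integral_norm_bound_integral[OF _ Ai])
         (auto intro!: Bochner_Integration.integrable_bound[OF Ai] AE_I2 mult_right_mono bd
               simp: norm_mult B abs_mult)
    then show ?thesis by simp
  qed
  have Al: "AE n in N. (\<lambda>j. ?A j n) \<longlonglongrightarrow> f (W n)"
    using cont
  proof eventually_elim
    case (elim n)
    have "(\<lambda>j. ?A j n) \<longlonglongrightarrow> (\<integral>z. f (W n) * of_real (std_normal_density z) \<partial>lborel)"
    proof (rule integral_dominated_convergence[OF _ _ Ai])
      show "AE z in lborel. (\<lambda>j. f (W n - ?\<rho> j * z) * of_real (std_normal_density z))
          \<longlonglongrightarrow> f (W n) * of_real (std_normal_density z)"
      proof (intro AE_I2 tendsto_intros)
        fix z
        have "(\<lambda>j. W n - ?\<rho> j * z) \<longlonglongrightarrow> W n - 0 * z" by (intro tendsto_intros \<rho>0)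
        then show "(\<lambda>j. f (W n - ?\<rho> j * z)) \<longlonglongrightarrow> f (W n)"
          using isCont_tendsto_compose[OF elim] by auto
      qed
    qed (auto intro!: mult_right_mono bd simp: norm_mult)
    moreover have "(\<integral>z. f (W n) * of_real (std_normal_density z) \<partial>lborel) = f (W n)"
      by (subst integral_mult_right_zero) (simp add: integral_complex_of_real)
    ultimately show ?case by simp
  qed
  have "(\<lambda>j. (\<integral>n. m n * ?A j n \<partial>N)) \<longlonglongrightarrow> (\<integral>n. m n * f (W n) \<partial>N)"
  proof (rule integral_dominated_convergence[where w="\<lambda>n. B * norm (m n)"])
    show "AE n in N. (\<lambda>j. m n * ?A j n) \<longlonglongrightarrow> m n * f (W n)"
      using Al by eventually_elim (intro tendsto_intros)
    show "AE n in N. norm (m n * ?A j n) \<le> B * norm (m n)" for j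
      using mult_left_mono[OF Ab norm_ge_zero] by (intro AE_I2) (auto simp: norm_mult mult.commute)
  qed (use m in auto)
  moreover have "(\<integral>n. m n * ?A j n \<partial>N) = 1 / (2 * pi) * (\<integral>t. (\<integral>n. m n * cis (W n * t) \<partial>N) *
            (L1_fourier f t * of_real (gauss (1 / Suc j) t)) \<partial>lborel)" for j
    by (subst spectral_pairing[OF N m W f]) (auto simp: gauss_mean_rescale)
  ultimately show ?thesis by simp
qed

section \<open>Square integrable functions and the Plancherel inequality\<close>

text \<open>The square of the \<open>L\<^sub>2\<close> norm as a nonnegative integral, which avoids square roots and keeps
  the value infinity available.\<close>

abbreviation sq_norm :: "(real \<Rightarrow> complex) \<Rightarrow> ennreal" where
  "sq_norm f \<equiv> (\<integral>\<^sup>+ t. (ennreal (norm (f t)))\<^sup>2 \<partial>lborel)"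

lemma cnj_borel_measurable [measurable]: "cnj \<in> borel_measurable borel"
  by (intro borel_measurable_continuous_onI continuous_intros)

lemma ennreal_norm_integral_le:
  fixes f :: "'a \<Rightarrow> complex"
  shows "ennreal (norm (\<integral>x. f x \<partial>M)) \<le> (\<integral>\<^sup>+x. ennreal (norm (f x)) \<partial>M)"
  by (cases "integrable M f") (auto simp: integral_norm_bound_ennreal not_integrable_integral_eq)

lemma ennreal_square_le_iff: "(a::ennreal)\<^sup>2 \<le> b\<^sup>2 \<longleftrightarrow> a \<le> b"
proof (cases a; cases b)
  fix r s assume "a = ennreal r" "b = ennreal s" "0 \<le> r" "0 \<le> s"
  then show ?thesis by (simp add: ennreal_power power2_le_iff_abs_le)
qed (auto simp: ennreal_power top_unique)

lemma ennreal_square_top_iff: "(a::ennreal)\<^sup>2 < top \<longleftrightarrow> a < top"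
  by (cases a) (auto simp: ennreal_power)

lemma ennreal_square_add_le: "((a::ennreal) + b)\<^sup>2 \<le> 2 * a\<^sup>2 + 2 * b\<^sup>2"
proof (cases a; cases b)
  fix r s assume ab: "a = ennreal r" "b = ennreal s" "0 \<le> r" "0 \<le> s"
  have "(r + s)\<^sup>2 \<le> 2 * r\<^sup>2 + 2 * s\<^sup>2"
    using zero_le_power2[of "r - s"] by (simp add: power2_eq_square algebra_simps)
  then have "ennreal ((r + s)\<^sup>2) \<le> ennreal (2 * r\<^sup>2 + 2 * s\<^sup>2)" by (rule ennreal_leI)
  moreover have "ennreal ((r + s)\<^sup>2) = (a + b)\<^sup>2"
    using ab by (simp add: ennreal_power flip: ennreal_plus)
  moreover have "ennreal (2 * r\<^sup>2 + 2 * s\<^sup>2) = 2 * a\<^sup>2 + 2 * b\<^sup>2"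
    using ab by (simp add: ennreal_power ennreal_plus ennreal_mult)
  ultimately show ?thesis by simp
qed (auto simp: ennreal_power top_unique ennreal_mult_top)

lemma ennreal_square_tendsto_0_iff:
  fixes f :: "'a \<Rightarrow> ennreal"
  shows "((\<lambda>n. (f n)\<^sup>2) \<longlongrightarrow> 0) F \<longleftrightarrow> (f \<longlongrightarrow> 0) F"
proof
  assume L: "((\<lambda>n. (f n)\<^sup>2) \<longlongrightarrow> 0) F"
  show "(f \<longlongrightarrow> 0) F"
  proof (rule order_tendstoI)
    fix a :: ennreal assume "0 < a"
    then have "0 < a\<^sup>2" by (simp add: zero_less_iff_neq_zero)
    from order_tendstoD(2)[OF L this] show "\<forall>\<^sub>F n in F. f n < a"
    proof eventually_elim
      case (elim n) then show ?case using ennreal_square_le_iff[of a "f n"] by (simp add: not_le[symmetric])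
    qed
  qed simp
next
  assume L: "(f \<longlongrightarrow> 0) F"
  show "((\<lambda>n. (f n)\<^sup>2) \<longlongrightarrow> 0) F"
  proof (rule order_tendstoI)
    fix a :: ennreal assume a: "0 < a"
    show "\<forall>\<^sub>F n in F. (f n)\<^sup>2 < a"
    proof (rule eventually_mono[OF order_tendstoD(2)[OF L, of "min a 1"]])
      fix n assume *: "f n < min a 1"
      then have "(f n)\<^sup>2 \<le> f n * 1" unfolding power2_eq_square by (intro mult_left_mono) auto
      then show "(f n)\<^sup>2 < a" using * by (metis mult.right_neutral le_less_trans min_less_iff_conj)
    qed (use a in auto)
  qed simp
qed

lemma Lnorm_2_square:
  assumes "f \<in> borel_measurable lborel"
  shows "(Lnorm 2 f)\<^sup>2 = sq_norm f"
proof -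
  have 2: "enn2real 2 = 2" using enn2real_numeral[of "num.Bit0 num.One"] by simp
  have I: "(\<integral>\<^sup>+ t. ennreal (norm (f t) powr enn2real 2) \<partial>lborel) = sq_norm f"
    by (simp add: 2 ennreal_power)
  show ?thesis
  proof (cases "sq_norm f")
    case (real r)
    have "(r powr (1/2))\<^sup>2 = r" using real by (simp add: powr_half_sqrt)
    then show ?thesis using assms real
      unfolding Lnorm_def I by (simp add: Let_def ennreal_power 2)
  next
    case top
    then have "Lnorm 2 f = top" using assms unfolding Lnorm_def I by (simp add: Let_def)
    then show ?thesis using top by (simp add: power2_eq_square)
  qed
qed

lemma Lspace_2_iff: "f \<in> Lspace 2 \<longleftrightarrow> f \<in> borel_measurable lborel \<and> sq_norm f < top"
  unfolding Lspace_def using Lnorm_2_square[of f] ennreal_square_top_iff[of "Lnorm 2 f"] by auto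

lemma Lspace_1_iff: "f \<in> Lspace 1 \<longleftrightarrow> integrable lborel f"
proof -
  have "enn2real 1 = 1" by simp
  then show ?thesis
    unfolding Lspace_def Lnorm_def integrable_iff_bounded
    by (auto simp: Let_def less_top[symmetric])
qed

lemma sq_norm_diff_le:
  assumes [measurable]: "f \<in> borel_measurable lborel" "g \<in> borel_measurable lborel"
  shows "sq_norm (\<lambda>t. f t - g t) \<le> 2 * sq_norm f + 2 * sq_norm g"
proof -
  have "sq_norm (\<lambda>t. f t - g t) \<le> (\<integral>\<^sup>+ t. 2 * (ennreal (norm (f t)))\<^sup>2 + 2 * (ennreal (norm (g t)))\<^sup>2 \<partial>lborel)"
  proof (intro nn_integral_mono)
    fix t
    have "ennreal (norm (f t - g t)) \<le> ennreal (norm (f t)) + ennreal (norm (g t))"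
      by (simp add: norm_triangle_ineq4 flip: ennreal_plus)
    then have "(ennreal (norm (f t - g t)))\<^sup>2 \<le> (ennreal (norm (f t)) + ennreal (norm (g t)))\<^sup>2"
      by (simp add: ennreal_square_le_iff)
    then show "(ennreal (norm (f t - g t)))\<^sup>2 \<le> 2 * (ennreal (norm (f t)))\<^sup>2 + 2 * (ennreal (norm (g t)))\<^sup>2"
      using ennreal_square_add_le order_trans by blast
  qed
  also have "\<dots> = 2 * sq_norm f + 2 * sq_norm g"
    by (simp add: nn_integral_add nn_integral_cmult)
  finally show ?thesis .
qed

lemma sq_norm_add_le:
  assumes [measurable]: "f \<in> borel_measurable lborel" "g \<in> borel_measurable lborel"
  shows "sq_norm (\<lambda>t. f t + g t) \<le> 2 * sq_norm f + 2 * sq_norm g"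
  using sq_norm_diff_le[of f "\<lambda>t. - g t"] by simp

lemma integrable_mult_of_sq_norm:
  assumes [measurable]: "f \<in> borel_measurable lborel" "g \<in> borel_measurable lborel"
    and "sq_norm f < top" "sq_norm g < top"
  shows "integrable lborel (\<lambda>t. f t * g t)"
proof (rule integrableI_bounded)
  have "((\<integral>\<^sup>+ t. ennreal (norm (f t * g t)) \<partial>lborel))\<^sup>2 \<le> sq_norm f * sq_norm g"
    using Cauchy_Schwarz_nn_integral[of "\<lambda>t. ennreal (norm (f t))" lborel "\<lambda>t. ennreal (norm (g t))"]
    by (simp add: norm_mult ennreal_mult')
  also have "\<dots> < top" using assms by (simp add: ennreal_mult_less_top)
  finally show "(\<integral>\<^sup>+ t. ennreal (norm (f t * g t)) \<partial>lborel) < \<infinity>"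
    by (simp add: ennreal_square_top_iff)
qed measurable

lemma norm_integral_mult_square_le:
  assumes [measurable]: "f \<in> borel_measurable lborel" "g \<in> borel_measurable lborel"
  shows "(ennreal (norm (\<integral>t. f t * g t \<partial>lborel)))\<^sup>2 \<le> sq_norm f * sq_norm g"
proof -
  have "(ennreal (norm (\<integral>t. f t * g t \<partial>lborel)))\<^sup>2 \<le> ((\<integral>\<^sup>+ t. ennreal (norm (f t * g t)) \<partial>lborel))\<^sup>2"
    by (simp add: ennreal_square_le_iff ennreal_norm_integral_le)
  also have "\<dots> \<le> sq_norm f * sq_norm g"
    using Cauchy_Schwarz_nn_integral[of "\<lambda>t. ennreal (norm (f t))" lborel "\<lambda>t. ennreal (norm (g t))"]
    by (simp add: norm_mult ennreal_mult')
  finally show ?thesis .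
qed

lemma nn_integral_normal_density:
  assumes "\<rho> > 0"
  shows "(\<integral>\<^sup>+ v. ennreal (normal_density 0 \<rho> (c - v)) \<partial>lborel) = 1"
proof -
  have "(\<integral>\<^sup>+ v. ennreal (normal_density 0 \<rho> (c - v)) \<partial>lborel) = (\<integral>\<^sup>+ v. ennreal (normal_density 0 \<rho> v) \<partial>lborel)"
    by (subst nn_integral_real_affine[of _ "-1" c]) auto
  also have "\<dots> = ennreal (\<integral>v. normal_density 0 \<rho> v \<partial>lborel)"
    using assms by (intro nn_integral_eq_integral) auto
  finally show ?thesis using assms by simp
qed

lemma sq_norm_reflect:
  assumes [measurable]: "f \<in> borel_measurable lborel"
  shows "sq_norm (\<lambda>t. f (c - t)) = sq_norm f"
  by (subst (2) nn_integral_real_affine[of _ "-1" c]) auto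

lemma integrable_reflect:
  fixes f :: "real \<Rightarrow> complex"
  assumes "integrable lborel f"
  shows "integrable lborel (\<lambda>t. f (c - t))"
  using lborel_integrable_real_affine[OF assms, of "-1" c] by simp

lemma integral_reflect_shift:
  fixes f :: "real \<Rightarrow> complex"
  shows "(\<integral>t. f (c - t) \<partial>lborel) = (\<integral>t. f t \<partial>lborel)"
  using lborel_integral_real_affine[of "-1" f c] by simp

text \<open>Pairing \<open>h\<close> with its reflected conjugate makes the left side of \<open>spectral_pairing\<close> the
  regularised integral of the squared modulus of the transform. The right side is a double integral of
  \<open>h s\<close>, \<open>cnj (h (- v))\<close> and a probability density, which the inequality between arithmetic
  and geometric mean bounds by the square norm of \<open>h\<close>. Fatou's lemma removes the Gaussian.\<close>

lemma sq_norm_L1_fourier_le: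
  assumes h: "integrable lborel h"
  shows "sq_norm (L1_fourier h) \<le> ennreal (2 * pi) * sq_norm h"
proof -
  have hm[measurable]: "h \<in> borel_measurable borel" using h by auto
  define f where "f v = cnj (h (0 - v))" for v
  have fm[measurable]: "f \<in> borel_measurable borel" unfolding f_def by measurable
  have fi: "integrable lborel f"
    unfolding f_def by (subst complex_integrable_cnj) (rule integrable_reflect[OF h])
  (* Reflection and conjugation together turn the transform of h into its conjugate. *)
  have f_hat: "L1_fourier f t = cnj (L1_fourier h t)" for t
  proof -
    have "L1_fourier f t = (\<integral>v. cnj (cis (t * v) * h (0 - v)) \<partial>lborel)"
      unfolding L1_fourier_cis f_def by (simp add: cis_cnj)
    also have "\<dots> = cnj (\<integral>v. cis (- (t * (0 - v))) * h (0 - v) \<partial>lborel)"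
      by (subst Bochner_Integration.integral_cnj) simp
    also have "\<dots> = cnj (L1_fourier h t)"
      unfolding L1_fourier_cis by (subst integral_reflect_shift[where f="\<lambda>v. cis (- (t * v)) * h v"]) simp
    finally show ?thesis .
  qed
  have step: "(\<integral>\<^sup>+ t. (ennreal (norm (L1_fourier h t)))\<^sup>2 * ennreal (gauss \<rho> t) \<partial>lborel)
      \<le> ennreal (2 * pi) * sq_norm h" if \<rho>: "\<rho> > 0" for \<rho>
  proof -
    let ?\<phi> = "normal_density 0 \<rho>"
    define C where "C = (\<integral>t. norm (h t) \<partial>lborel)"
    have Cb: "norm (L1_fourier h t) \<le> C" for t unfolding C_def by (rule norm_L1_fourier_le)
    have gi: "integrable lborel (\<lambda>t. (norm (L1_fourier h t))\<^sup>2 * gauss \<rho> t)"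
    proof (rule Bochner_Integration.integrable_bound)
      show "integrable lborel (\<lambda>t. C\<^sup>2 * gauss \<rho> t)" using gauss_integrable[OF \<rho>] by simp
      show "AE t in lborel. norm ((norm (L1_fourier h t))\<^sup>2 * gauss \<rho> t) \<le> norm (C\<^sup>2 * gauss \<rho> t)"
        by (intro AE_I2) (auto simp: abs_mult gauss_bounds intro!: mult_right_mono power_mono Cb)
    qed measurable
    have "(\<integral>\<^sup>+ t. (ennreal (norm (L1_fourier h t)))\<^sup>2 * ennreal (gauss \<rho> t) \<partial>lborel)
      = (\<integral>\<^sup>+ t. ennreal ((norm (L1_fourier h t))\<^sup>2 * gauss \<rho> t) \<partial>lborel)"
      by (simp add: ennreal_power ennreal_mult gauss_bounds)
    also have "\<dots> = ennreal (\<integral>t. (norm (L1_fourier h t))\<^sup>2 * gauss \<rho> t \<partial>lborel)"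
      by (rule nn_integral_eq_integral[OF gi]) (simp add: gauss_bounds)
    also have "\<dots> \<le> ennreal (norm (\<integral>t. complex_of_real ((norm (L1_fourier h t))\<^sup>2 * gauss \<rho> t) \<partial>lborel))"
      by (subst integral_complex_of_real) (auto simp: intro!: ennreal_leI)
    also have "(\<integral>t. complex_of_real ((norm (L1_fourier h t))\<^sup>2 * gauss \<rho> t) \<partial>lborel)
        = (\<integral>t. (\<integral>s. h s * cis ((- s) * t) \<partial>lborel) * (L1_fourier f t * of_real (gauss \<rho> t)) \<partial>lborel)"
    proof (intro Bochner_Integration.integral_cong refl)
      fix t
      have "(\<integral>s. h s * cis ((- s) * t) \<partial>lborel) = L1_fourier h t"
        unfolding L1_fourier_cis by (simp add: mult_ac)
      then show "complex_of_real ((norm (L1_fourier h t))\<^sup>2 * gauss \<rho> t) =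
        (\<integral>s. h s * cis ((- s) * t) \<partial>lborel) * (L1_fourier f t * of_real (gauss \<rho> t))"
        by (simp add: f_hat complex_norm_square[symmetric] mult.assoc[symmetric])
    qed
    also have "\<dots> = 2 * pi * (\<integral>s. h s * (\<integral>v. f v * of_real (?\<phi> (- s - v)) \<partial>lborel) \<partial>lborel)"
      by (rule spectral_pairing[OF lborel.sigma_finite_measure_axioms h _ fi \<rho>]) measurable
    also have "ennreal (norm \<dots>) \<le> ennreal (2 * pi) * sq_norm h"
    proof -
      have "ennreal (norm (\<integral>s. h s * (\<integral>v. f v * of_real (?\<phi> (- s - v)) \<partial>lborel) \<partial>lborel))
        \<le> (\<integral>\<^sup>+s. ennreal (norm (h s)) * ennreal (norm (\<integral>v. f v * of_real (?\<phi> (- s - v)) \<partial>lborel)) \<partial>lborel)"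
        by (rule order_trans[OF ennreal_norm_integral_le]) (simp add: norm_mult ennreal_mult)
      also have "\<dots> \<le> (\<integral>\<^sup>+s. ennreal (norm (h s)) * (\<integral>\<^sup>+v. ennreal (norm (f v)) * ennreal (?\<phi> (- s - v)) \<partial>lborel) \<partial>lborel)"
        by (intro nn_integral_mono mult_left_mono order_trans[OF ennreal_norm_integral_le])
           (auto simp: norm_mult ennreal_mult)
      also have "\<dots> = (\<integral>\<^sup>+s. \<integral>\<^sup>+v. ennreal (norm (h s)) * ennreal (norm (f v)) * ennreal (?\<phi> (- s - v)) \<partial>lborel \<partial>lborel)"
        by (simp add: nn_integral_cmult[symmetric] mult.assoc)
      also have "\<dots> \<le> (\<integral>\<^sup>+s. \<integral>\<^sup>+v. (ennreal (1/2) * (ennreal (norm (h s)))\<^sup>2) * ennreal (?\<phi> (- s - v))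
           + (ennreal (1/2) * (ennreal (norm (f v)))\<^sup>2) * ennreal (?\<phi> (- s - v)) \<partial>lborel \<partial>lborel)"
      proof (intro nn_integral_mono)
        fix s v
        have "norm (h s) * norm (f v) \<le> 1/2 * (norm (h s))\<^sup>2 + 1/2 * (norm (f v))\<^sup>2"
          using zero_le_power2[of "norm (h s) - norm (f v)"] by (simp add: power2_eq_square algebra_simps)
        then have "ennreal (norm (h s) * norm (f v)) \<le> ennreal (1/2 * (norm (h s))\<^sup>2 + 1/2 * (norm (f v))\<^sup>2)"
          by (rule ennreal_leI)
        then have "ennreal (norm (h s)) * ennreal (norm (f v))
          \<le> ennreal (1/2) * (ennreal (norm (h s)))\<^sup>2 + ennreal (1/2) * (ennreal (norm (f v)))\<^sup>2"
        proof -
          have e: "ennreal (1/2 * x\<^sup>2) = ennreal (1/2) * (ennreal x)\<^sup>2" if "0 \<le> x" for x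
            using that by (subst ennreal_mult') (auto simp: ennreal_power)
          assume "ennreal (norm (h s) * norm (f v)) \<le> ennreal (1/2 * (norm (h s))\<^sup>2 + 1/2 * (norm (f v))\<^sup>2)"
          also have "\<dots> = ennreal (1/2) * (ennreal (norm (h s)))\<^sup>2 + ennreal (1/2) * (ennreal (norm (f v)))\<^sup>2"
            unfolding e[OF norm_ge_zero, symmetric] by (rule ennreal_plus) auto
          finally show ?thesis by (simp add: ennreal_mult)
        qed
        then show "ennreal (norm (h s)) * ennreal (norm (f v)) * ennreal (?\<phi> (- s - v))
          \<le> (ennreal (1/2) * (ennreal (norm (h s)))\<^sup>2) * ennreal (?\<phi> (- s - v))
           + (ennreal (1/2) * (ennreal (norm (f v)))\<^sup>2) * ennreal (?\<phi> (- s - v))"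
          by (simp only: distrib_right[symmetric]) (rule mult_right_mono, auto)
      qed
      also have "\<dots> = (\<integral>\<^sup>+s. (\<integral>\<^sup>+v. (ennreal (1/2) * (ennreal (norm (h s)))\<^sup>2) * ennreal (?\<phi> (- s - v)) \<partial>lborel) \<partial>lborel)
         + (\<integral>\<^sup>+s. (\<integral>\<^sup>+v. (ennreal (1/2) * (ennreal (norm (f v)))\<^sup>2) * ennreal (?\<phi> (- s - v)) \<partial>lborel) \<partial>lborel)"
        by (simp add: nn_integral_add)
      also have "(\<integral>\<^sup>+s. (\<integral>\<^sup>+v. (ennreal (1/2) * (ennreal (norm (h s)))\<^sup>2) * ennreal (?\<phi> (- s - v)) \<partial>lborel) \<partial>lborel)
        = ennreal (1/2) * sq_norm h"
        by (simp add: nn_integral_cmult nn_integral_normal_density[OF \<rho>])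
      also have "(\<integral>\<^sup>+s. (\<integral>\<^sup>+v. (ennreal (1/2) * (ennreal (norm (f v)))\<^sup>2) * ennreal (?\<phi> (- s - v)) \<partial>lborel) \<partial>lborel)
        = (\<integral>\<^sup>+v. (\<integral>\<^sup>+s. (ennreal (1/2) * (ennreal (norm (f v)))\<^sup>2) * ennreal (?\<phi> (- s - v)) \<partial>lborel) \<partial>lborel)"
        by (rule lborel_pair.Fubini') measurable
      also have "\<dots> = ennreal (1/2) * sq_norm f"
        using nn_integral_normal_density[OF \<rho>]
        by (simp add: nn_integral_cmult minus_diff_commute)
      also have "sq_norm f = sq_norm h"
        using sq_norm_reflect[of h 0] by (simp add: f_def)
      also have "ennreal (1/2) * sq_norm h + ennreal (1/2) * sq_norm h = sq_norm h"
      proof -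
        have "ennreal (1/2) + ennreal (1/2) = 1" by (subst ennreal_plus[symmetric]) auto
        then show ?thesis by (simp only: distrib_right[symmetric] mult_1)
      qed
      finally show ?thesis
        by (simp add: norm_mult ennreal_mult mult_left_mono)
    qed
    finally show ?thesis .
  qed
  have "sq_norm (L1_fourier h) = (\<integral>\<^sup>+ t. liminf (\<lambda>n. (ennreal (norm (L1_fourier h t)))\<^sup>2 * ennreal (gauss (1 / Suc n) t)) \<partial>lborel)"
  proof (intro nn_integral_cong)
    fix t
    note gauss_tendsto_1[of t]
    then have "(\<lambda>n. ennreal ((norm (L1_fourier h t))\<^sup>2 * gauss (1 / Suc n) t)) \<longlonglongrightarrow> ennreal ((norm (L1_fourier h t))\<^sup>2 * 1)"
      by (intro tendsto_ennrealI tendsto_intros)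
    then have "(\<lambda>n. (ennreal (norm (L1_fourier h t)))\<^sup>2 * ennreal (gauss (1 / Suc n) t)) \<longlonglongrightarrow> (ennreal (norm (L1_fourier h t)))\<^sup>2"
      by (simp add: ennreal_power ennreal_mult gauss_bounds)
    then show "(ennreal (norm (L1_fourier h t)))\<^sup>2 = liminf (\<lambda>n. (ennreal (norm (L1_fourier h t)))\<^sup>2 * ennreal (gauss (1 / Suc n) t))"
      by (simp add: lim_imp_Liminf)
  qed
  also have "\<dots> \<le> liminf (\<lambda>n. (\<integral>\<^sup>+ t. (ennreal (norm (L1_fourier h t)))\<^sup>2 * ennreal (gauss (1 / Suc n) t) \<partial>lborel))"
    by (rule nn_integral_liminf) measurable
  also have "\<dots> \<le> ennreal (2 * pi) * sq_norm h"
    by (intro Liminf_le eventually_sequentiallyI[of 0] step) (auto simp: eventually_sequentially)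
  finally show ?thesis .
qed

section \<open>Convolution with tame kernels\<close>

text \<open>Wide enough for the kernels that occur: exponential polynomials cut off at \<open>0\<close> and indicators of
  intervals. Integrability makes the convolution with bounded functions converge, boundedness adds
  square integrability, and continuity off a finite set lets \<open>spectral_pairing_limit\<close> apply for
  almost every shift.\<close>

definition tame :: "(real \<Rightarrow> complex) \<Rightarrow> bool" where
  "tame g \<longleftrightarrow> integrable lborel g \<and> (\<exists>B. \<forall>t. norm (g t) \<le> B) \<and> finite {t. \<not> isCont g t}"

lemma tameI:
  assumes "integrable lborel g" "\<And>t. norm (g t) \<le> B" "finite D" "\<And>t. t \<notin> D \<Longrightarrow> isCont g t"
  shows "tame g"
  unfolding tame_def using assms by (auto intro: finite_subset[of _ D])

lemma tame_integrable: "tame g \<Longrightarrow> integrable lborel g"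
  by (simp add: tame_def)

lemma tame_measurable: "tame g \<Longrightarrow> g \<in> borel_measurable borel"
  using tame_integrable[of g] by auto

lemma tame_sq_norm: assumes "tame g" shows "sq_norm g < top"
proof -
  obtain B where B: "\<And>t. norm (g t) \<le> B" and gi: "integrable lborel g" using assms by (auto simp: tame_def)
  have [measurable]: "g \<in> borel_measurable borel" using gi by auto
  have B0: "B \<ge> 0" using B[of 0] norm_ge_zero order_trans by blast
  have "sq_norm g \<le> (\<integral>\<^sup>+ t. ennreal B * ennreal (norm (g t)) \<partial>lborel)"
    unfolding power2_eq_square by (intro nn_integral_mono mult_right_mono ennreal_leI B) auto
  also have "\<dots> = ennreal B * (\<integral>\<^sup>+ t. ennreal (norm (g t)) \<partial>lborel)"
    by (rule nn_integral_cmult) measurable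
  also have "\<dots> < top"
    using gi unfolding integrable_iff_bounded by (auto simp: ennreal_mult_less_top)
  finally show ?thesis .
qed

lemma tame_add: assumes "tame f" "tame g" shows "tame (\<lambda>t. f t + g t)"
proof -
  obtain B C where "\<And>t. norm (f t) \<le> B" "\<And>t. norm (g t) \<le> C" using assms by (auto simp: tame_def)
  then show ?thesis using assms
    by (intro tameI[of _ "B + C" "{t. \<not> isCont f t} \<union> {t. \<not> isCont g t}"])
       (auto simp: tame_def intro: norm_triangle_mono)
qed

lemma tame_cmult: assumes "tame g" shows "tame (\<lambda>t. c * g t)"
proof -
  obtain B where "\<And>t. norm (g t) \<le> B" using assms by (auto simp: tame_def)
  then show ?thesis using assms
    by (intro tameI[of _ "norm c * B" "{t. \<not> isCont g t}"])
       (auto simp: tame_def norm_mult intro: mult_left_mono)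
qed

lemma tame_diff: "tame f \<Longrightarrow> tame g \<Longrightarrow> tame (\<lambda>t. f t - g t)"
  using tame_add[of f "\<lambda>t. (-1) * g t"] tame_cmult[of g "-1"] by simp

lemma tame_zero: "tame (\<lambda>_. 0)"
  unfolding tame_def by auto

lemma tame_sum: "finite I \<Longrightarrow> (\<And>i. i \<in> I \<Longrightarrow> tame (f i)) \<Longrightarrow> tame (\<lambda>t. \<Sum>i\<in>I. f i t)"
  by (induction I rule: finite_induct) (auto simp: tame_zero intro: tame_add)

lemma tame_indicator: "tame (\<lambda>t. indicator {a..b} t)"
proof -
  have int: "integrable lborel (\<lambda>t. indicator {a..b} t :: complex)"
    by (subst of_real_indicator[symmetric], subst complex_of_real_integrable_eq)
       (intro integrable_real_indicator, auto simp: emeasure_lborel_Icc_eq)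
  have "frontier {a..b} \<subseteq> {a, b}" by (auto simp: frontier_def)
  then have "isCont (\<lambda>t. complex_of_real (indicator {a..b} t)) t" if "t \<notin> {a, b}" for t
    using that isCont_indicator[of t "{a..b}"] by (intro continuous_of_real) auto
  then have "isCont (\<lambda>t. indicator {a..b} t :: complex) t" if "t \<notin> {a, b}" for t
    using that by (simp only: of_real_indicator)
  then show ?thesis
    by (intro tameI[OF int, of 1 "{a, b}"]) (auto simp: indicator_def)
qed

lemma tame_AE_isCont:
  assumes "tame g" shows "AE s in lborel. isCont g (t - s)"
proof (rule AE_I')
  have "finite ((\<lambda>u. t - u) ` {u. \<not> isCont g u})" using assms by (auto simp: tame_def)
  then show "(\<lambda>u. t - u) ` {u. \<not> isCont g u} \<in> null_sets lborel" by (rule finite_imp_null_set_lborel)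
  show "{s \<in> space lborel. \<not> isCont g (t - s)} \<subseteq> (\<lambda>u. t - u) ` {u. \<not> isCont g u}"
    by (auto intro!: image_eqI[where x="t - _"])
qed

definition conv :: "(real \<Rightarrow> complex) \<Rightarrow> (real \<Rightarrow> complex) \<Rightarrow> real \<Rightarrow> complex" where
  "conv g x t = (\<integral>s. g (t - s) * x s \<partial>lborel)"

lemma sq_norm_L1_fourier_finite:
  assumes "integrable lborel h" "sq_norm h < top"
  shows "sq_norm (L1_fourier h) < top"
  by (rule order.strict_trans1[OF sq_norm_L1_fourier_le[OF assms(1)]])
     (use assms(2) in \<open>simp add: ennreal_mult_less_top\<close>)

text \<open>Parseval's formula. Two square integrable transforms have an integrable product, which dominates
  its Gaussian regularisation.\<close>

lemma conv_fourier_L1: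
  assumes g: "tame g" and x: "integrable lborel x" and xf: "sq_norm (L1_fourier x) < top"
  shows "conv g x t = 1 / (2 * pi) * (\<integral>\<omega>. cis (\<omega> * t) * (L1_fourier g \<omega> * L1_fourier x \<omega>) \<partial>lborel)"
proof -
  obtain B where B: "\<And>t. norm (g t) \<le> B" using g by (auto simp: tame_def)
  have gi: "integrable lborel g" by (rule tame_integrable[OF g])
  have [measurable]: "g \<in> borel_measurable borel" "x \<in> borel_measurable borel" using gi x by auto
  have prod: "integrable lborel (\<lambda>\<omega>. L1_fourier g \<omega> * L1_fourier x \<omega>)"
    by (intro integrable_mult_of_sq_norm sq_norm_L1_fourier_finite xf gi tame_sq_norm[OF g]) measurable
  have "(\<lambda>j. 1 / (2 * pi) * (\<integral>\<omega>. (\<integral>s. x s * cis ((t - s) * \<omega>) \<partial>lborel) *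
            (L1_fourier g \<omega> * of_real (gauss (1 / Suc j) \<omega>)) \<partial>lborel))
       \<longlonglongrightarrow> (\<integral>s. x s * g (t - s) \<partial>lborel)"
    by (rule spectral_pairing_limit[OF lborel.sigma_finite_measure_axioms x _ gi B tame_AE_isCont[OF g]]) measurable
  moreover have "(\<integral>s. x s * cis ((t - s) * \<omega>) \<partial>lborel) = cis (\<omega> * t) * L1_fourier x \<omega>" for \<omega>
  proof -
    have "cis ((t - s) * \<omega>) = cis (\<omega> * t) * cis (- (\<omega> * s))" for s
      by (simp add: cis_mult algebra_simps)
    then show ?thesis unfolding L1_fourier_cis
      by (simp add: integral_mult_right_zero[symmetric] mult_ac del: integral_mult_right_zero)
  qed
  ultimately have L: "(\<lambda>j. 1 / (2 * pi) * (\<integral>\<omega>. cis (\<omega> * t) * (L1_fourier g \<omega> * L1_fourier x \<omega>) *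
            of_real (gauss (1 / Suc j) \<omega>) \<partial>lborel)) \<longlonglongrightarrow> conv g x t"
    by (simp add: conv_def mult_ac)
  have "(\<lambda>j. (\<integral>\<omega>. cis (\<omega> * t) * (L1_fourier g \<omega> * L1_fourier x \<omega>) *
            of_real (gauss (1 / Suc j) \<omega>) \<partial>lborel))
     \<longlonglongrightarrow> (\<integral>\<omega>. cis (\<omega> * t) * (L1_fourier g \<omega> * L1_fourier x \<omega>) * of_real 1 \<partial>lborel)"
  proof (rule integral_dominated_convergence[where w="\<lambda>\<omega>. norm (L1_fourier g \<omega> * L1_fourier x \<omega>)"])
    show "AE \<omega> in lborel. (\<lambda>j. cis (\<omega> * t) * (L1_fourier g \<omega> * L1_fourier x \<omega>) * of_real (gauss (1 / Suc j) \<omega>))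
        \<longlonglongrightarrow> cis (\<omega> * t) * (L1_fourier g \<omega> * L1_fourier x \<omega>) * of_real 1"
      by (intro AE_I2 tendsto_intros gauss_tendsto_1)
    show "AE \<omega> in lborel. norm (cis (\<omega> * t) * (L1_fourier g \<omega> * L1_fourier x \<omega>) * of_real (gauss (1 / Suc j) \<omega>))
       \<le> norm (L1_fourier g \<omega> * L1_fourier x \<omega>)" for j
      by (intro AE_I2) (auto simp: norm_mult gauss_bounds intro!: mult_left_le)
  qed (use prod in auto)
  then have "(\<lambda>j. 1 / (2 * pi) * (\<integral>\<omega>. cis (\<omega> * t) * (L1_fourier g \<omega> * L1_fourier x \<omega>) *
            of_real (gauss (1 / Suc j) \<omega>) \<partial>lborel))
     \<longlonglongrightarrow> 1 / (2 * pi) * (\<integral>\<omega>. cis (\<omega> * t) * (L1_fourier g \<omega> * L1_fourier x \<omega>) * of_real 1 \<partial>lborel)"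
    by (rule tendsto_mult_left)
  from LIMSEQ_unique[OF L this] show ?thesis by simp
qed

abbreviation truncated :: "(real \<Rightarrow> complex) \<Rightarrow> nat \<Rightarrow> real \<Rightarrow> complex" where
  "truncated x n \<equiv> (\<lambda>t. indicator {- real n..real n} t * x t)"

lemma has_L2_fourierD:
  assumes "has_L2_fourier x X"
  shows "x \<in> borel_measurable borel" "sq_norm x < top" "X \<in> borel_measurable borel" "sq_norm X < top"
    and "\<And>n. integrable lborel (truncated x n)"
    and "(\<lambda>n. sq_norm (\<lambda>\<omega>. X \<omega> - L1_fourier (truncated x n) \<omega>)) \<longlonglongrightarrow> 0"
proof -
  show xm[measurable]: "x \<in> borel_measurable borel" and x2: "sq_norm x < top" and Xm[measurable]: "X \<in> borel_measurable borel" and "sq_norm X < top"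
    using assms by (auto simp: has_L2_fourier_def Lspace_2_iff)
  show "integrable lborel (truncated x n)" for n
    by (rule integrable_mult_of_sq_norm[OF _ _ tame_sq_norm[OF tame_indicator] x2]) measurable
  have "(\<lambda>n. (Lnorm 2 (\<lambda>\<omega>. X \<omega> - L1_fourier (truncated x n) \<omega>))\<^sup>2) \<longlonglongrightarrow> 0"
    using assms by (simp only: has_L2_fourier_def ennreal_square_tendsto_0_iff)
  moreover have "(Lnorm 2 (\<lambda>\<omega>. X \<omega> - L1_fourier (truncated x n) \<omega>))\<^sup>2
    = sq_norm (\<lambda>\<omega>. X \<omega> - L1_fourier (truncated x n) \<omega>)" for n
    by (rule Lnorm_2_square) measurable
  ultimately show "(\<lambda>n. sq_norm (\<lambda>\<omega>. X \<omega> - L1_fourier (truncated x n) \<omega>)) \<longlonglongrightarrow> 0"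
    by simp
qed

lemma AE_zero_of_sq_norm:
  assumes [measurable]: "f \<in> borel_measurable borel" and "sq_norm f = 0"
  shows "AE t in lborel. f t = 0"
proof -
  have "AE t in lborel. (ennreal (norm (f t)))\<^sup>2 = 0"
    using assms by (subst nn_integral_0_iff_AE[symmetric]) auto
  then show ?thesis by eventually_elim auto
qed

lemma has_L2_fourier_unique:
  assumes "has_L2_fourier x X" "has_L2_fourier x Y"
  shows "AE \<omega> in lborel. X \<omega> = Y \<omega>"
proof -
  note X = has_L2_fourierD[OF assms(1)] and Y = has_L2_fourierD[OF assms(2)]
  have [measurable]: "X \<in> borel_measurable borel" "Y \<in> borel_measurable borel" "x \<in> borel_measurable borel"
    using X Y by auto
  let ?T = "\<lambda>n. L1_fourier (truncated x n)"
  have "(\<lambda>n. 2 * sq_norm (\<lambda>\<omega>. X \<omega> - ?T n \<omega>) + 2 * sq_norm (\<lambda>\<omega>. Y \<omega> - ?T n \<omega>)) \<longlonglongrightarrow> 2 * 0 + 2 * 0"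
    by (intro tendsto_add ennreal_tendsto_cmult X Y) auto
  moreover have "sq_norm (\<lambda>\<omega>. X \<omega> - Y \<omega>) \<le> 2 * sq_norm (\<lambda>\<omega>. X \<omega> - ?T n \<omega>) + 2 * sq_norm (\<lambda>\<omega>. Y \<omega> - ?T n \<omega>)" for n
  proof -
    have "sq_norm (\<lambda>\<omega>. (X \<omega> - ?T n \<omega>) - (Y \<omega> - ?T n \<omega>)) \<le> 2 * sq_norm (\<lambda>\<omega>. X \<omega> - ?T n \<omega>) + 2 * sq_norm (\<lambda>\<omega>. Y \<omega> - ?T n \<omega>)"
      by (rule sq_norm_diff_le) measurable
    then show ?thesis by simp
  qed
  ultimately have "sq_norm (\<lambda>\<omega>. X \<omega> - Y \<omega>) \<le> 0"
    by (intro LIMSEQ_le_const) auto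
  then have "AE \<omega> in lborel. X \<omega> - Y \<omega> = 0"
    by (intro AE_zero_of_sq_norm) auto
  then show ?thesis by simp
qed

lemma conv_integrable:
  assumes g: "tame g" and [measurable]: "x \<in> borel_measurable borel" and "sq_norm x < top"
  shows "integrable lborel (\<lambda>s. g (t - s) * x s)"
proof -
  have [measurable]: "g \<in> borel_measurable borel" by (rule tame_measurable[OF g])
  show ?thesis
    using sq_norm_reflect[of g t] tame_sq_norm[OF g]
    by (intro integrable_mult_of_sq_norm assms) auto
qed

text \<open>Parseval's formula for the mean square Fourier transform: both sides are continuous along the
  truncations of \<open>x\<close> that define it, the left one by dominated convergence and the right one by
  the Cauchy-Schwarz inequality.\<close>

lemma conv_fourier_L2:
  assumes g: "tame g" and x: "has_L2_fourier x X"
  shows "conv g x t = 1 / (2 * pi) * (\<integral>\<omega>. cis (\<omega> * t) * (L1_fourier g \<omega> * X \<omega>) \<partial>lborel)"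
proof -
  note X = has_L2_fourierD[OF x]
  have [measurable]: "X \<in> borel_measurable borel" "x \<in> borel_measurable borel" "g \<in> borel_measurable borel"
    using X tame_measurable[OF g] by auto
  let ?x = "truncated x"
  let ?T = "\<lambda>n. L1_fourier (?x n)"
  let ?G = "\<lambda>\<omega>. cis (\<omega> * t) * L1_fourier g \<omega>"
  have G2: "sq_norm ?G < top"
    using sq_norm_L1_fourier_finite[OF tame_integrable[OF g] tame_sq_norm[OF g]] by (simp add: norm_mult)
  have xn2: "sq_norm (?x n) < top" for n
  proof -
    have "sq_norm (?x n) \<le> sq_norm x"
      by (intro nn_integral_mono power_mono ennreal_leI) (auto simp: indicator_def)
    then show ?thesis using X(2) by (rule order.strict_trans1)
  qed
  have T2: "sq_norm (?T n) < top" for n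
    by (intro sq_norm_L1_fourier_finite X(5) xn2)
  have 1: "conv g (?x n) t = 1 / (2 * pi) * (\<integral>\<omega>. ?G \<omega> * ?T n \<omega> \<partial>lborel)" for n
    by (subst conv_fourier_L1[OF g X(5) T2]) (simp add: mult.assoc)
  have 2: "(\<lambda>n. conv g (?x n) t) \<longlonglongrightarrow> conv g x t"
    unfolding conv_def
  proof (rule integral_dominated_convergence[where w="\<lambda>s. norm (g (t - s) * x s)"])
    show "AE s in lborel. (\<lambda>n. g (t - s) * ?x n s) \<longlonglongrightarrow> g (t - s) * x s"
    proof (intro AE_I2 tendsto_mult_left)
      fix s
      have "eventually (\<lambda>n. ?x n s = x s) sequentially"
      proof (rule eventually_sequentiallyI[of "nat \<lceil>\<bar>s\<bar>\<rceil>"])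
        fix n assume "nat \<lceil>\<bar>s\<bar>\<rceil> \<le> n"
        then have "\<bar>s\<bar> \<le> real n" by linarith
        then have "s \<in> {- real n..real n}" by auto
        then show "?x n s = x s" by simp
      qed
      then show "(\<lambda>n. ?x n s) \<longlonglongrightarrow> x s" by (rule tendsto_eventually)
    qed
    show "integrable lborel (\<lambda>s. norm (g (t - s) * x s))"
      by (intro integrable_norm conv_integrable g X) measurable
  qed (auto simp: norm_mult indicator_def)
  have "(\<lambda>n. sq_norm ?G * sq_norm (\<lambda>\<omega>. X \<omega> - ?T n \<omega>)) \<longlonglongrightarrow> sq_norm ?G * 0"
    using G2 X(6) by (intro ennreal_tendsto_cmult) auto
  then have lim0: "(\<lambda>n. sq_norm ?G * sq_norm (\<lambda>\<omega>. X \<omega> - ?T n \<omega>)) \<longlonglongrightarrow> 0" by simp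
  have "(ennreal (norm (\<integral>\<omega>. ?G \<omega> * (X \<omega> - ?T n \<omega>) \<partial>lborel)))\<^sup>2
      \<le> sq_norm ?G * sq_norm (\<lambda>\<omega>. X \<omega> - ?T n \<omega>)" for n
    by (rule norm_integral_mult_square_le) measurable
  then have "(\<lambda>n. (ennreal (norm (\<integral>\<omega>. ?G \<omega> * (X \<omega> - ?T n \<omega>) \<partial>lborel)))\<^sup>2) \<longlonglongrightarrow> 0"
    by (intro tendsto_sandwich[OF _ _ tendsto_const lim0] always_eventually allI) auto
  then have "(\<lambda>n. ennreal (norm (\<integral>\<omega>. ?G \<omega> * (X \<omega> - ?T n \<omega>) \<partial>lborel))) \<longlonglongrightarrow> ennreal 0"
    by (simp add: ennreal_square_tendsto_0_iff)
  then have "(\<lambda>n. norm (\<integral>\<omega>. ?G \<omega> * (X \<omega> - ?T n \<omega>) \<partial>lborel)) \<longlonglongrightarrow> 0"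
    by (subst (asm) tendsto_ennreal_iff) auto
  then have 3: "(\<lambda>n. \<integral>\<omega>. ?G \<omega> * (X \<omega> - ?T n \<omega>) \<partial>lborel) \<longlonglongrightarrow> 0"
    by (rule tendsto_norm_zero_cancel)
  have "(\<integral>\<omega>. ?G \<omega> * (X \<omega> - ?T n \<omega>) \<partial>lborel) = (\<integral>\<omega>. ?G \<omega> * X \<omega> \<partial>lborel) - (\<integral>\<omega>. ?G \<omega> * ?T n \<omega> \<partial>lborel)" for n
  proof -
    have "integrable lborel (\<lambda>\<omega>. ?G \<omega> * X \<omega>)" "integrable lborel (\<lambda>\<omega>. ?G \<omega> * ?T n \<omega>)"
      by (rule integrable_mult_of_sq_norm[OF _ _ G2 X(4)], measurable)
         (rule integrable_mult_of_sq_norm[OF _ _ G2 T2], measurable)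
    then show ?thesis by (simp add: right_diff_distrib)
  qed
  with 3 have "(\<lambda>n. (\<integral>\<omega>. ?G \<omega> * X \<omega> \<partial>lborel) - ((\<integral>\<omega>. ?G \<omega> * X \<omega> \<partial>lborel) - (\<integral>\<omega>. ?G \<omega> * ?T n \<omega> \<partial>lborel))) \<longlonglongrightarrow> (\<integral>\<omega>. ?G \<omega> * X \<omega> \<partial>lborel) - 0"
    by (intro tendsto_diff tendsto_const) simp
  then have "(\<lambda>n. 1 / (2 * pi) * (\<integral>\<omega>. ?G \<omega> * ?T n \<omega> \<partial>lborel)) \<longlonglongrightarrow> 1 / (2 * pi) * (\<integral>\<omega>. ?G \<omega> * X \<omega> \<partial>lborel)"
    by (intro tendsto_mult_left) simp
  from LIMSEQ_unique[OF 2[unfolded 1] this] show ?thesis by (simp add: mult.assoc)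
qed

lemma conv_measurable [measurable]:
  assumes [measurable]: "g \<in> borel_measurable borel" "x \<in> borel_measurable borel"
  shows "conv g x \<in> borel_measurable borel"
  unfolding conv_def[abs_def] by measurable

text \<open>By Parseval's formula the convolution is itself, up to reflection and scaling, the transform of the
  integrable function \<open>\<omega> \<mapsto> L1_fourier g \<omega> * X \<omega>\<close>, so the Plancherel inequality applies to it.
  The constant \<open>1 / (2 \<pi>)\<close> that results is estimated by \<open>1\<close>.\<close>

lemma sq_norm_conv_le:
  assumes g: "tame g" and x: "has_L2_fourier x X"
  shows "sq_norm (conv g x) \<le> sq_norm (\<lambda>\<omega>. L1_fourier g \<omega> * X \<omega>)"
proof -
  note X = has_L2_fourierD[OF x]
  have [measurable]: "X \<in> borel_measurable borel" "x \<in> borel_measurable borel" "g \<in> borel_measurable borel"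
    using X tame_measurable[OF g] by auto
  let ?h = "\<lambda>\<omega>. L1_fourier g \<omega> * X \<omega>"
  have hi: "integrable lborel ?h"
    by (intro integrable_mult_of_sq_norm X sq_norm_L1_fourier_finite tame_integrable[OF g] tame_sq_norm[OF g]) measurable
  have "norm (conv g x t) \<le> 1 / (2 * pi) * norm (L1_fourier ?h (0 - t))" for t
    by (simp add: conv_fourier_L2[OF g x] L1_fourier_cis mult_ac norm_divide norm_mult)
  then have "sq_norm (conv g x) \<le> (\<integral>\<^sup>+t. (ennreal (1 / (2 * pi)) * ennreal (norm (L1_fourier ?h (0 - t))))\<^sup>2 \<partial>lborel)"
    by (intro nn_integral_mono) (auto simp: ennreal_square_le_iff simp flip: ennreal_mult intro!: ennreal_leI)
  also have "\<dots> = (ennreal (1 / (2 * pi)))\<^sup>2 * sq_norm (\<lambda>t. L1_fourier ?h (0 - t))"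
    by (simp add: power_mult_distrib nn_integral_cmult)
  also have "sq_norm (\<lambda>t. L1_fourier ?h (0 - t)) = sq_norm (L1_fourier ?h)"
    by (rule sq_norm_reflect) measurable
  also have "(ennreal (1 / (2 * pi)))\<^sup>2 * sq_norm (L1_fourier ?h) \<le> (ennreal (1 / (2 * pi)))\<^sup>2 * (ennreal (2 * pi) * sq_norm ?h)"
    by (intro mult_left_mono sq_norm_L1_fourier_le hi) auto
  also have "\<dots> = ennreal (1 / (2 * pi)) * sq_norm ?h"
  proof -
    have "(ennreal (1 / (2 * pi)))\<^sup>2 * ennreal (2 * pi) = ennreal ((1 / (2 * pi))\<^sup>2 * (2 * pi))"
      by (subst ennreal_mult) (auto simp: ennreal_power)
    also have "(1 / (2 * pi))\<^sup>2 * (2 * pi) = 1 / (2 * pi)" by (simp add: power2_eq_square)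
    finally show ?thesis by (simp add: mult.assoc[symmetric])
  qed
  also have "\<dots> \<le> 1 * sq_norm ?h"
  proof (intro mult_right_mono)
    have "1 / (2 * pi) \<le> 1" using pi_gt3 by simp
    then show "ennreal (1 / (2 * pi)) \<le> 1" by (metis ennreal_1 ennreal_leI)
  qed auto
  finally show ?thesis by simp
qed

section \<open>Functions with a spectral representation\<close>

lemma continuous_L1_fourier:
  assumes g: "integrable lborel g"
  shows "continuous_on UNIV (L1_fourier g)"
proof (intro continuous_at_imp_continuous_on ballI)
  fix \<omega> :: real
  have [measurable]: "g \<in> borel_measurable borel" using g by auto
  show "isCont (L1_fourier g) \<omega>"
    unfolding continuous_at_sequentially
  proof (intro allI impI)
    fix X :: "nat \<Rightarrow> real" assume X: "X \<longlonglongrightarrow> \<omega>"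
    show "(L1_fourier g \<circ> X) \<longlonglongrightarrow> L1_fourier g \<omega>"
      unfolding L1_fourier_cis comp_def
    proof (rule integral_dominated_convergence[where w="\<lambda>t. norm (g t)"])
      show "AE t in lborel. (\<lambda>n. cis (- (X n * t)) * g t) \<longlonglongrightarrow> cis (- (\<omega> * t)) * g t"
        by (intro AE_I2 tendsto_intros isCont_tendsto_compose[of _ cis] X)
    qed (use g in \<open>auto simp: norm_mult\<close>)
  qed
qed

lemma norm_spectral_le:
  fixes m :: "'a \<Rightarrow> complex"
  shows "norm (\<integral>n. m n * cis (W n * t) \<partial>N) \<le> (\<integral>n. norm (m n) \<partial>N)"
  by (rule order_trans[OF integral_norm_bound]) (simp add: norm_mult)

lemma spectral_measurable:
  fixes m :: "'a \<Rightarrow> complex"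
  assumes N: "sigma_finite_measure N" and [measurable]: "m \<in> borel_measurable N" "W \<in> borel_measurable N"
  shows "(\<lambda>t. \<integral>n. m n * cis (W n * t) \<partial>N) \<in> borel_measurable borel"
proof -
  interpret sigma_finite_measure N by fact
  show ?thesis by measurable
qed

lemma integrable_mult_spectral:
  fixes m :: "'a \<Rightarrow> complex"
  assumes N: "sigma_finite_measure N" and m: "integrable N m" and W: "W \<in> borel_measurable N"
    and \<psi>: "integrable lborel \<psi>"
  shows "integrable lborel (\<lambda>t. (\<integral>n. m n * cis (W n * t) \<partial>N) * \<psi> t)"
proof (rule Bochner_Integration.integrable_bound)
  have [measurable]: "\<psi> \<in> borel_measurable borel" using \<psi> by auto
  have [measurable]: "(\<lambda>t. \<integral>n. m n * cis (W n * t) \<partial>N) \<in> borel_measurable borel"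
    using m W by (intro spectral_measurable N) auto
  show "(\<lambda>t. (\<integral>n. m n * cis (W n * t) \<partial>N) * \<psi> t) \<in> borel_measurable lborel" by measurable
  show "integrable lborel (\<lambda>t. (\<integral>n. norm (m n) \<partial>N) * norm (\<psi> t))" using \<psi> by auto
  show "AE t in lborel. norm ((\<integral>n. m n * cis (W n * t) \<partial>N) * \<psi> t) \<le> norm ((\<integral>n. norm (m n) \<partial>N) * norm (\<psi> t))"
    by (intro AE_I2) (auto simp: norm_mult intro!: mult_right_mono norm_spectral_le)
qed

text \<open>Convolution multiplies each oscillation by the value of the transfer function at its frequency.\<close>

lemma conv_spectral:
  fixes m :: "'a \<Rightarrow> complex"
  assumes N: "sigma_finite_measure N" and m: "integrable N m" and W[measurable]: "W \<in> borel_measurable N"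
    and g: "integrable lborel g"
  shows "conv g (\<lambda>s. \<integral>n. m n * cis (W n * s) \<partial>N) t = (\<integral>n. m n * (cis (W n * t) * L1_fourier g (W n)) \<partial>N)"
proof -
  have eq: "(\<integral>s. cis (w * s) * g (t - s) \<partial>lborel) = cis (w * t) * L1_fourier g w" for w
  proof -
    have "(\<integral>s. cis (w * s) * g (t - s) \<partial>lborel) = (\<integral>s. cis (w * (t - (t - s))) * g (t - s) \<partial>lborel)" by simp
    also have "\<dots> = (\<integral>u. cis (w * (t - u)) * g u \<partial>lborel)"
      by (rule integral_reflect_shift[where f="\<lambda>u. cis (w * (t - u)) * g u"])
    also have "\<dots> = (\<integral>u. cis (w * t) * (cis (- (w * u)) * g u) \<partial>lborel)"
      by (simp only: mult.assoc[symmetric] cis_mult right_diff_distrib add_uminus_conv_diff)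
    finally show ?thesis by (simp add: L1_fourier_cis)
  qed
  have "conv g (\<lambda>s. \<integral>n. m n * cis (W n * s) \<partial>N) t
      = (\<integral>s. (\<integral>n. m n * cis (W n * s) \<partial>N) * g (t - s) \<partial>lborel)"
    unfolding conv_def by (simp only: mult.commute)
  also have "\<dots> = (\<integral>n. m n * (\<integral>s. cis (W n * s) * g (t - s) \<partial>lborel) \<partial>N)"
    by (rule multiplication_formula[OF N m W integrable_reflect[OF g]])
  finally show ?thesis by (simp only: eq)
qed

text \<open>The pairing of \<open>f\<close> with the complex measure that a spectral representation describes.\<close>

definition spectral_functional ::
  "(nat \<Rightarrow> complex) \<Rightarrow> (nat \<Rightarrow> real) \<Rightarrow> (real \<Rightarrow> complex) \<Rightarrow> (real \<Rightarrow> complex) \<Rightarrow> complex" where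
  "spectral_functional c w Xc f = (\<Sum>k. c k * f (w k)) + (\<integral>\<omega>. f \<omega> * Xc \<omega> \<partial>lborel)"

lemma integrable_bounded_mult:
  fixes m :: "'a \<Rightarrow> complex"
  assumes m: "integrable N m" and f[measurable]: "f \<in> borel_measurable N" and bd: "\<And>v. norm (f v) \<le> B"
  shows "integrable N (\<lambda>n. m n * f n)"
proof (rule Bochner_Integration.integrable_bound)
  have [measurable]: "m \<in> borel_measurable N" using m by auto
  show "(\<lambda>n. m n * f n) \<in> borel_measurable N" by measurable
  show "integrable N (\<lambda>n. B * norm (m n))" using m by auto
  have "B \<ge> 0" using bd[of undefined] norm_ge_zero order_trans by blast
  then show "AE n in N. norm (m n * f n) \<le> norm (B * norm (m n))"
    by (intro AE_I2) (simp add: norm_mult, subst mult.commute, intro mult_right_mono bd norm_ge_zero)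
qed

lemma integrable_count_space_of_summable:
  fixes c :: "nat \<Rightarrow> complex"
  shows "summable (\<lambda>k. norm (c k)) \<Longrightarrow> integrable (count_space UNIV) c"
  by (simp add: integrable_count_space_nat_iff)

lemma spectral_functional_integral:
  assumes c: "summable (\<lambda>k. norm (c k))" and bd: "\<And>v. norm (f v) \<le> B"
  shows "spectral_functional c w Xc f
     = (\<integral>k. c k * f (w k) \<partial>count_space UNIV) + (\<integral>\<omega>. Xc \<omega> * f \<omega> \<partial>lborel)"
  unfolding spectral_functional_def
  using integrable_bounded_mult[OF integrable_count_space_of_summable[OF c], of "\<lambda>k. f (w k)" B] bd
  by (subst integral_count_space_nat) (auto simp: mult.commute)

lemma spectral_repD:
  assumes "spectral_rep c w Xc x"
  shows "summable (\<lambda>k. norm (c k))" "integrable (count_space UNIV) c" "integrable lborel Xc"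
    and "x = (\<lambda>t. 1 / (2 * pi) * ((\<integral>k. c k * cis (w k * t) \<partial>count_space UNIV) + (\<integral>\<omega>. Xc \<omega> * cis (\<omega> * t) \<partial>lborel)))"
proof -
  show c: "summable (\<lambda>k. norm (c k))" and "integrable lborel Xc"
    using assms by (auto simp: spectral_rep_def Lspace_1_iff)
  show ci: "integrable (count_space UNIV) c" by (rule integrable_count_space_of_summable[OF c])
  have 1: "(\<Sum>k. c k * cis (w k * t)) = (\<integral>k. c k * cis (w k * t) \<partial>count_space UNIV)" for t
    by (rule integral_count_space_nat[symmetric], rule integrable_bounded_mult[OF ci, of _ 1]) auto
  show "x = (\<lambda>t. 1 / (2 * pi) * ((\<integral>k. c k * cis (w k * t) \<partial>count_space UNIV) + (\<integral>\<omega>. Xc \<omega> * cis (\<omega> * t) \<partial>lborel)))"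
  proof
    fix t
    have "x t = 1 / (2 * of_real pi) * (\<Sum>k. c k * exp (\<i> * of_real (w k) * of_real t))
               + 1 / (2 * of_real pi) * (\<integral>\<omega>. exp (\<i> * of_real \<omega> * of_real t) * Xc \<omega> \<partial>lborel)"
      using assms unfolding spectral_rep_def by blast
    also have "(\<Sum>k. c k * exp (\<i> * of_real (w k) * of_real t)) = (\<integral>k. c k * cis (w k * t) \<partial>count_space UNIV)"
      unfolding 1[symmetric] by (simp add: cis_conv_exp mult.assoc)
    also have "(\<integral>\<omega>. exp (\<i> * of_real \<omega> * of_real t) * Xc \<omega> \<partial>lborel) = (\<integral>\<omega>. Xc \<omega> * cis (\<omega> * t) \<partial>lborel)"
      by (simp add: cis_conv_exp mult.commute mult.left_commute)
    finally show "x t = 1 / (2 * pi) * ((\<integral>k. c k * cis (w k * t) \<partial>count_space UNIV) + (\<integral>\<omega>. Xc \<omega> * cis (\<omega> * t) \<partial>lborel))"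
      by (simp add: add_divide_distrib)
  qed
qed

lemma sigma_finite_count_nat: "sigma_finite_measure (count_space (UNIV :: nat set))"
  by (rule sigma_finite_measure_count_space)

text \<open>The right side depends on a representation of \<open>x\<close>, the left side only on \<open>x\<close>. This is why
  the functional is determined by \<open>x\<close>.\<close>

lemma spectral_functional_limit:
  assumes x: "spectral_rep c w Xc x" and f: "integrable lborel f" and bd: "\<And>v. norm (f v) \<le> B"
    and cont: "\<And>v. isCont f v"
  shows "(\<lambda>j. \<integral>t. x t * (L1_fourier f t * of_real (gauss (1 / Suc j) t)) \<partial>lborel)
       \<longlonglongrightarrow> spectral_functional c w Xc f"
proof -
  note X = spectral_repD[OF x]
  have [measurable]: "f \<in> borel_measurable borel" using f by auto
  let ?S = "\<lambda>t. \<integral>k. c k * cis (w k * t) \<partial>count_space UNIV" and ?I = "\<lambda>t. \<integral>\<omega>. Xc \<omega> * cis (\<omega> * t) \<partial>lborel"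
  let ?\<psi> = "\<lambda>j t. L1_fourier f t * of_real (gauss (1 / Suc j) t)"
  have \<psi>: "integrable lborel (?\<psi> j)" for j
  proof -
    have "integrable lborel (\<lambda>t. of_real (gauss (1 / Suc j) t) * L1_fourier f t)"
      using gauss_integrable[of "1 / Suc j"] norm_L1_fourier_le[of f]
      by (intro integrable_bounded_mult[of _ _ _ "\<integral>t. norm (f t) \<partial>lborel"]) auto
    then show ?thesis by (simp add: mult.commute)
  qed
  have split: "1 / (2 * pi) * (\<integral>t. ?S t * ?\<psi> j t \<partial>lborel) + 1 / (2 * pi) * (\<integral>t. ?I t * ?\<psi> j t \<partial>lborel)
     = (\<integral>t. x t * ?\<psi> j t \<partial>lborel)" for j
  proof -
    have "integrable lborel (\<lambda>t. ?S t * ?\<psi> j t)" "integrable lborel (\<lambda>t. ?I t * ?\<psi> j t)"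
      by (intro integrable_mult_spectral sigma_finite_count_nat lborel.sigma_finite_measure_axioms X \<psi>; simp)+
    then have "(\<integral>t. 1 / (2 * pi) * (?S t * ?\<psi> j t) + 1 / (2 * pi) * (?I t * ?\<psi> j t) \<partial>lborel)
       = 1 / (2 * pi) * (\<integral>t. ?S t * ?\<psi> j t \<partial>lborel) + 1 / (2 * pi) * (\<integral>t. ?I t * ?\<psi> j t \<partial>lborel)"
      by (subst Bochner_Integration.integral_add) (auto simp del: of_real_mult)
    then show ?thesis by (subst X(4)) (simp add: algebra_simps add_divide_distrib)
  qed
  have "(\<lambda>j. 1 / (2 * pi) * (\<integral>t. ?S t * ?\<psi> j t \<partial>lborel) + 1 / (2 * pi) * (\<integral>t. ?I t * ?\<psi> j t \<partial>lborel))
      \<longlonglongrightarrow> (\<integral>k. c k * f (w k) \<partial>count_space UNIV) + (\<integral>\<omega>. Xc \<omega> * f \<omega> \<partial>lborel)"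
    by (intro tendsto_add spectral_pairing_limit[OF _ _ _ f bd] sigma_finite_count_nat
          lborel.sigma_finite_measure_axioms X) (auto simp: cont)
  then show ?thesis unfolding split spectral_functional_integral[OF X(1) bd] .
qed

text \<open>For integrable \<open>f\<close> this is the uniqueness of limits; damping a bounded \<open>f\<close> by Gaussians
  reduces the general case to it.\<close>

lemma spectral_functional_unique:
  assumes x: "spectral_rep c w Xc x" and x': "spectral_rep c' w' Xc' x"
    and bd: "\<And>v. norm (f v) \<le> B" and cont: "\<And>v. isCont f v"
  shows "spectral_functional c w Xc f = spectral_functional c' w' Xc' f"
proof -
  have [measurable]: "f \<in> borel_measurable borel"
    using cont by (intro borel_measurable_continuous_onI continuous_at_imp_continuous_on) auto
  (* Damped versions of f, integrable and convergent to f pointwise and boundedly. *)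
  define F where "F j v = of_real (gauss (1 / Suc j) v) * f v" for j :: nat and v
  have Fm[measurable]: "F j \<in> borel_measurable borel" for j unfolding F_def by measurable
  have Fb: "norm (F j v) \<le> B" for j v
  proof -
    have "norm (F j v) \<le> 1 * norm (f v)"
      unfolding F_def norm_mult by (intro mult_right_mono) (auto simp: gauss_bounds)
    then show ?thesis using bd[of v] by simp
  qed
  have Fi: "integrable lborel (F j)" for j
    unfolding F_def[abs_def] using gauss_integrable[of "1 / Suc j"] bd by (intro integrable_bounded_mult) auto
  have Fc: "isCont (F j) v" for j v
    unfolding F_def[abs_def] gauss_def by (intro continuous_intros cont) auto
  have Fl: "(\<lambda>j. F j v) \<longlonglongrightarrow> f v" for v
    unfolding F_def using tendsto_mult[OF tendsto_of_real[OF gauss_tendsto_1[of v], where 'a=complex] tendsto_const[of "f v"]] by simp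
  have eq: "spectral_functional c w Xc (F j) = spectral_functional c' w' Xc' (F j)" for j
    using LIMSEQ_unique spectral_functional_limit[OF x Fi Fb Fc] spectral_functional_limit[OF x' Fi Fb Fc] by blast
  have lim: "(\<lambda>j. spectral_functional a u Y (F j)) \<longlonglongrightarrow> spectral_functional a u Y f"
    if "spectral_rep a u Y x" for a u Y
  proof -
    note X = spectral_repD[OF that]
    have [measurable]: "Y \<in> borel_measurable borel" using X by auto
    have "(\<lambda>j. (\<integral>k. a k * F j (u k) \<partial>count_space UNIV)) \<longlonglongrightarrow> (\<integral>k. a k * f (u k) \<partial>count_space UNIV)"
      by (rule integral_dominated_convergence[where w="\<lambda>k. norm (a k) * B"])
         (use X in \<open>auto intro!: tendsto_intros Fl mult_left_mono Fb simp: norm_mult\<close>)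
    moreover have "(\<lambda>j. (\<integral>\<omega>. Y \<omega> * F j \<omega> \<partial>lborel)) \<longlonglongrightarrow> (\<integral>\<omega>. Y \<omega> * f \<omega> \<partial>lborel)"
      by (rule integral_dominated_convergence[where w="\<lambda>k. norm (Y k) * B"])
         (use X in \<open>auto intro!: AE_I2 tendsto_intros Fl mult_left_mono Fb simp: norm_mult\<close>)
    ultimately show ?thesis
      unfolding spectral_functional_integral[OF X(1) Fb] spectral_functional_integral[OF X(1) bd]
      by (rule tendsto_add)
  qed
  show ?thesis using lim[OF x] lim[OF x'] unfolding eq by (rule LIMSEQ_unique)
qed

text \<open>The definite description in \<open>M_fourier\<close> denotes: the functional of any representation is bounded
  and linear, and by \<open>spectral_functional_unique\<close> it is the only candidate.\<close>

lemma M_fourier_apply: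
  assumes x: "spectral_rep c w Xc x"
  shows "blinfun_apply (M_fourier x) f = spectral_functional c w Xc (apply_bcontfun f)"
proof -
  note X = spectral_repD[OF x]
  have fm[measurable]: "apply_bcontfun f \<in> borel_measurable borel" for f :: "real \<Rightarrow>\<^sub>C complex"
    by (intro borel_measurable_continuous_onI) auto
  have bd: "\<And>v. norm (apply_bcontfun f v) \<le> norm f" for f :: "real \<Rightarrow>\<^sub>C complex"
    by (rule norm_bounded)
  have i1: "integrable (count_space UNIV) (\<lambda>k. c k * apply_bcontfun f (w k))" for f
    by (rule integrable_bounded_mult[OF X(2) _ bd]) auto
  have i2: "integrable lborel (\<lambda>\<omega>. Xc \<omega> * apply_bcontfun f \<omega>)" for f
    by (rule integrable_bounded_mult[OF X(3) _ bd]) auto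
  define \<Lambda> where "\<Lambda> f = spectral_functional c w Xc (apply_bcontfun f)" for f
  have \<Lambda>: "\<Lambda> f = (\<integral>k. c k * apply_bcontfun f (w k) \<partial>count_space UNIV) + (\<integral>\<omega>. Xc \<omega> * apply_bcontfun f \<omega> \<partial>lborel)" for f
    unfolding \<Lambda>_def by (rule spectral_functional_integral[OF X(1) bd])
  have "bounded_linear \<Lambda>"
  proof (rule bounded_linear_intro)
    show "\<Lambda> (f + g) = \<Lambda> f + \<Lambda> g" for f g
      unfolding \<Lambda> by (simp add: distrib_left i1 i2)
    show "\<Lambda> (r *\<^sub>R f) = r *\<^sub>R \<Lambda> f" for r f
      unfolding \<Lambda> by (simp add: scaleR_add_right)
    show "norm (\<Lambda> f) \<le> norm f * ((\<integral>k. norm (c k) \<partial>count_space UNIV) + (\<integral>\<omega>. norm (Xc \<omega>) \<partial>lborel))" for f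
    proof -
      have "norm (\<integral>k. c k * apply_bcontfun f (w k) \<partial>count_space UNIV) \<le> (\<integral>k. norm (c k) * norm f \<partial>count_space UNIV)"
        by (intro order_trans[OF integral_norm_bound] integral_mono integrable_norm i1)
           (use X(2) bd in \<open>auto simp: norm_mult intro!: mult_left_mono\<close>)
      moreover have "norm (\<integral>k. Xc k * apply_bcontfun f k \<partial>lborel) \<le> (\<integral>k. norm (Xc k) * norm f \<partial>lborel)"
        by (intro order_trans[OF integral_norm_bound] integral_mono integrable_norm i2)
           (use X(3) bd in \<open>auto simp: norm_mult intro!: mult_left_mono\<close>)
      ultimately show ?thesis
        unfolding \<Lambda> by (intro order_trans[OF norm_triangle_ineq]) (auto simp: distrib_left mult.commute)
    qed
  qed
  then have ap: "blinfun_apply (Blinfun \<Lambda>) f = \<Lambda> f" for f by (simp add: bounded_linear_Blinfun_apply)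
  have "M_fourier x = Blinfun \<Lambda>"
    unfolding M_fourier_def
  proof (rule the_equality)
    show "\<exists>c w Xc. spectral_rep c w Xc x \<and> (\<forall>f. blinfun_apply (Blinfun \<Lambda>) f =
        (\<Sum>k. c k * apply_bcontfun f (w k)) + (\<integral>\<omega>. apply_bcontfun f \<omega> * Xc \<omega> \<partial>lborel))"
      using x ap unfolding \<Lambda>_def spectral_functional_def by blast
    fix Y assume "\<exists>c w Xc. spectral_rep c w Xc x \<and> (\<forall>f. blinfun_apply Y f =
        (\<Sum>k. c k * apply_bcontfun f (w k)) + (\<integral>\<omega>. apply_bcontfun f \<omega> * Xc \<omega> \<partial>lborel))"
    then obtain c' w' Xc' where x': "spectral_rep c' w' Xc' x"
      and Y: "\<And>f. blinfun_apply Y f = spectral_functional c' w' Xc' (apply_bcontfun f)"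
      unfolding spectral_functional_def by blast
    show "Y = Blinfun \<Lambda>"
    proof (rule blinfun_eqI)
      fix f :: "real \<Rightarrow>\<^sub>C complex"
      have "continuous_on UNIV (apply_bcontfun f)" by auto
      then have "isCont (apply_bcontfun f) v" for v
        by (simp only: continuous_on_eq_continuous_at[OF open_UNIV] UNIV_I)
      then show "blinfun_apply Y f = blinfun_apply (Blinfun \<Lambda>) f"
        unfolding Y ap \<Lambda>_def by (intro spectral_functional_unique[OF x' x bd])
    qed
  qed
  then show ?thesis by (simp add: ap \<Lambda>_def)
qed

lemma spectral_rep_measurable:
  assumes x: "spectral_rep c w Xc x" shows "x \<in> borel_measurable borel"
proof -
  note X = spectral_repD[OF x]
  have [measurable]: "(\<lambda>t. \<integral>k. c k * cis (w k * t) \<partial>count_space UNIV) \<in> borel_measurable borel"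
    using X by (intro spectral_measurable sigma_finite_count_nat) auto
  have [measurable]: "(\<lambda>t. \<integral>\<omega>. Xc \<omega> * cis (\<omega> * t) \<partial>lborel) \<in> borel_measurable borel"
    using X by (intro spectral_measurable lborel.sigma_finite_measure_axioms) auto
  show ?thesis by (subst X(4)) measurable
qed

lemma conv_integrable_spectral:
  assumes x: "spectral_rep c w Xc x" and g: "integrable lborel g"
  shows "integrable lborel (\<lambda>s. g (t - s) * x s)"
proof -
  note X = spectral_repD[OF x]
  have "integrable lborel (\<lambda>s. 1 / (2 * pi) * ((\<integral>k. c k * cis (w k * s) \<partial>count_space UNIV) * g (t - s)
      + (\<integral>\<omega>. Xc \<omega> * cis (\<omega> * s) \<partial>lborel) * g (t - s)))"
    by (intro integrable_mult_right Bochner_Integration.integrable_add integrable_mult_spectral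
        sigma_finite_count_nat lborel.sigma_finite_measure_axioms X integrable_reflect[OF g]; simp)
  then show ?thesis by (subst X(4)) (simp add: algebra_simps add_divide_distrib)
qed

lemma conv_spectral_rep:
  assumes x: "spectral_rep c w Xc x" and g: "integrable lborel g"
  shows "conv g x t = 1 / (2 * pi) * spectral_functional c w Xc (\<lambda>\<omega>. cis (\<omega> * t) * L1_fourier g \<omega>)"
proof -
  note X = spectral_repD[OF x]
  let ?S = "\<lambda>t. \<integral>k. c k * cis (w k * t) \<partial>count_space UNIV" and ?I = "\<lambda>t. \<integral>\<omega>. Xc \<omega> * cis (\<omega> * t) \<partial>lborel"
  have i: "integrable lborel (\<lambda>s. ?S s * g (t - s))" "integrable lborel (\<lambda>s. ?I s * g (t - s))"
    by (intro integrable_mult_spectral sigma_finite_count_nat lborel.sigma_finite_measure_axioms X integrable_reflect[OF g]; simp)+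
  have "conv g x t = (\<integral>s. 1 / (2 * pi) * (?S s * g (t - s) + ?I s * g (t - s)) \<partial>lborel)"
    unfolding conv_def by (subst X(4)) (simp add: algebra_simps add_divide_distrib)
  also have "\<dots> = 1 / (2 * pi) * (\<integral>s. ?S s * g (t - s) + ?I s * g (t - s) \<partial>lborel)"
    by (rule integral_mult_right_zero)
  also have "(\<integral>s. ?S s * g (t - s) + ?I s * g (t - s) \<partial>lborel) = conv g ?S t + conv g ?I t"
    unfolding conv_def using i by (simp add: mult.commute)
  also have "conv g ?S t = (\<integral>k. c k * (cis (w k * t) * L1_fourier g (w k)) \<partial>count_space UNIV)"
    using X by (intro conv_spectral sigma_finite_count_nat g) auto
  also have "conv g ?I t = (\<integral>\<omega>. Xc \<omega> * (cis (\<omega> * t) * L1_fourier g \<omega>) \<partial>lborel)"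
    using X by (intro conv_spectral lborel.sigma_finite_measure_axioms g) auto
  finally show ?thesis
    by (subst spectral_functional_integral[OF X(1), of _ "\<integral>t. norm (g t) \<partial>lborel"])
       (auto simp: norm_mult norm_L1_fourier_le)
qed

text \<open>The transfer function \<open>L1_fourier g\<close> is small only on \<open>S\<close>, while the norm of the functional
  is tested by functions on the whole line. Since the measure lives on \<open>S\<close>, the transfer function
  may be clipped to modulus at most \<open>e\<close> without changing its pairing with the measure.\<close>

lemma norm_conv_spectral_le:
  assumes x: "spectral_rep c w Xc x" and g: "integrable lborel g"
    and w: "\<And>k. w k \<in> S" and Xc: "AE \<omega> in lborel. \<omega> \<notin> S \<longrightarrow> Xc \<omega> = 0"
    and e: "e > 0" and small: "\<And>\<omega>. \<omega> \<in> S \<Longrightarrow> norm (L1_fourier g \<omega>) \<le> e"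
  shows "norm (conv g x t) \<le> e * norm (M_fourier x)"
proof -
  have [measurable]: "Xc \<in> borel_measurable borel" "g \<in> borel_measurable borel" using spectral_repD[OF x] g by auto
  define h where "h \<omega> = cis (\<omega> * t) * L1_fourier g \<omega>" for \<omega>
  (* The radial retraction of h onto the disc of radius e. *)
  define f where "f \<omega> = of_real (e / max e (norm (h \<omega>))) * h \<omega>" for \<omega>
  have hm[measurable]: "h \<in> borel_measurable borel" unfolding h_def by measurable
  have hc: "continuous_on UNIV h"
    unfolding h_def by (intro continuous_intros continuous_L1_fourier g)
  have fc: "continuous_on UNIV f"
    unfolding f_def using e by (intro continuous_intros hc) (auto simp: max_def)
  have [measurable]: "f \<in> borel_measurable borel" by (rule borel_measurable_continuous_onI[OF fc])
  have fb: "norm (f \<omega>) \<le> e" for \<omega>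
    using e by (auto simp: f_def norm_mult norm_divide max_def field_simps)
  have fh: "f \<omega> = h \<omega>" if "\<omega> \<in> S" for \<omega>
    using small[OF that] e by (auto simp: f_def h_def norm_mult max_def)
  have fB: "f \<in> bcontfun"
    unfolding bcontfun_def using fc fb by (auto simp: bounded_iff)
  have "spectral_functional c w Xc h = spectral_functional c w Xc f"
  proof -
    have "(\<integral>\<omega>. h \<omega> * Xc \<omega> \<partial>lborel) = (\<integral>\<omega>. f \<omega> * Xc \<omega> \<partial>lborel)"
      by (rule integral_cong_AE, measurable, use Xc in \<open>eventually_elim, auto simp: fh\<close>)
    then show ?thesis by (simp add: spectral_functional_def fh w)
  qed
  also have "\<dots> = blinfun_apply (M_fourier x) (Bcontfun f)"
    by (simp add: M_fourier_apply[OF x] Bcontfun_inverse[OF fB])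
  finally have "norm (spectral_functional c w Xc h) \<le> norm (M_fourier x) * norm (Bcontfun f)"
    by (simp add: norm_blinfun)
  also have "\<dots> \<le> norm (M_fourier x) * e"
    by (intro mult_left_mono norm_bound) (auto simp: Bcontfun_inverse[OF fB] fb)
  finally have *: "norm (spectral_functional c w Xc h) \<le> e * norm (M_fourier x)" by (simp add: mult.commute)
  have "norm (conv g x t) = 1 / (2 * pi) * norm (spectral_functional c w Xc h)"
    by (simp add: conv_spectral_rep[OF x g] h_def[abs_def] norm_mult norm_divide)
  also have "\<dots> \<le> 1 * norm (spectral_functional c w Xc h)"
    using pi_gt3 by (intro mult_right_mono) auto
  finally show ?thesis using * by simp
qed

section \<open>Exponential kernels and rational transfer functions\<close>

definition exp_kernel :: "nat \<Rightarrow> complex \<Rightarrow> real \<Rightarrow> complex" where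
  "exp_kernel n z t = (if t \<ge> 0 then of_real t ^ n * exp (- (z * of_real t)) else 0)"

lemma exp_kernel_measurable [measurable]: "exp_kernel n z \<in> borel_measurable borel"
  unfolding exp_kernel_def by measurable

lemma norm_exp_kernel:
  "norm (exp_kernel n z t) = t ^ n * exp (- (Re z * t)) * indicator {0..} t"
  by (auto simp: exp_kernel_def norm_mult norm_power)

lemma exp_kernel_integrable:
  assumes "Re z > 0" shows "integrable lborel (exp_kernel n z)"
proof -
  let ?a = "Re z"
  have "integrable lborel (\<lambda>x. x^n * exp (-x) * indicator {0 ..} x::real)"
    using has_bochner_integral_I0i_power_exp_m'[of n] by (simp add: has_bochner_integral_iff)
  from lborel_integrable_real_affine[OF this, of ?a 0]
  have "integrable lborel (\<lambda>t. (1 / ?a ^ n) * ((?a * t) ^ n * exp (- (?a * t)) * indicator {0..} (?a * t)))"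
    using assms by auto
  then have "integrable lborel (\<lambda>t. norm (exp_kernel n z t))"
    unfolding norm_exp_kernel
    by (rule Bochner_Integration.integrable_cong[THEN iffD1, rotated -1])
       (use assms in \<open>auto simp: power_mult_distrib indicator_def zero_le_mult_iff\<close>)
  then show ?thesis by (subst (asm) integrable_norm_iff) auto
qed

lemma power_exp_bound:
  fixes a t :: real assumes "a > 0" "t \<ge> 0"
  shows "t ^ n * exp (- (a * t)) \<le> fact n / a ^ n"
proof -
  have s: "summable (\<lambda>k. (a * t) ^ k / fact k)"
    using summable_exp[of "a * t"] by (simp add: field_simps)
  have "(\<Sum>k\<in>{n}. (a * t) ^ k / fact k) \<le> (\<Sum>k. (a * t) ^ k / fact k)"
    using assms by (intro sum_le_suminf s) auto
  also have "\<dots> = exp (a * t)" by (simp add: exp_def scaleR_conv_of_real divide_inverse mult.commute)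
  finally have "(a * t) ^ n \<le> fact n * exp (a * t)" by (simp add: field_simps)
  then show ?thesis using assms by (simp add: exp_minus power_mult_distrib field_simps)
qed

lemma isCont_exp_kernel_pos:
  assumes "t > 0" shows "isCont (exp_kernel n z) t"
proof -
  have "\<forall>\<^sub>F s in nhds t. exp_kernel n z s = of_real s ^ n * exp (- (z * of_real s))"
    using eventually_nhds_in_open[of "{0<..}" t] assms by (auto elim!: eventually_mono simp: exp_kernel_def)
  then have "isCont (exp_kernel n z) t = isCont (\<lambda>t. of_real t ^ n * exp (- (z * of_real t))) t"
    by (rule isCont_cong)
  moreover have "isCont (\<lambda>t. of_real t ^ n * exp (- (z * of_real t))) t" by (intro continuous_intros)
  ultimately show ?thesis by simp
qed

lemma exp_kernel_tame: assumes "Re z > 0" shows "tame (exp_kernel n z)"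
proof (rule tameI[OF exp_kernel_integrable[OF assms], of _ "fact n / Re z ^ n" "{0}"])
  show "norm (exp_kernel n z t) \<le> fact n / Re z ^ n" for t
    unfolding norm_exp_kernel using power_exp_bound[OF assms, of t n] assms by (auto simp: indicator_def)
  fix t :: real assume "t \<notin> {0}"
  then consider "t > 0" | "t < 0" by fastforce
  then show "isCont (exp_kernel n z) t"
  proof cases
    case 1
    then show ?thesis by (rule isCont_exp_kernel_pos)
  next
    case 2
    have "\<forall>\<^sub>F s in nhds t. exp_kernel n z s = 0"
      using eventually_nhds_in_open[of "{..<0}" t] 2 by (auto elim!: eventually_mono simp: exp_kernel_def)
    then show ?thesis using isCont_cong[of "exp_kernel n z" "\<lambda>_. 0" t] by auto
  qed
qed auto

lemma exp_kernel_has_derivative: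
  fixes z :: complex
  shows "((\<lambda>t. of_real t ^ Suc n * exp (- (z * of_real t))) has_vector_derivative
     (of_nat (Suc n) * of_real t ^ n * exp (- (z * of_real t)) - z * (of_real t ^ Suc n * exp (- (z * of_real t)))))
     (at t)"
proof -
  have "((\<lambda>w. w ^ Suc n * exp (- (z * w))) has_field_derivative
     (of_nat (Suc n) * of_real t ^ n * exp (- (z * of_real t)) - z * (of_real t ^ Suc n * exp (- (z * of_real t)))))
     (at (of_real t))"
  proof -
    have 1: "((\<lambda>w. w ^ Suc n) has_field_derivative of_nat (Suc n) * of_real t ^ n) (at (complex_of_real t))"
      using DERIV_power[OF DERIV_ident, where n="Suc n" and x="complex_of_real t" and s=UNIV] by simp
    have 2: "((\<lambda>w. exp (- (z * w))) has_field_derivative - (z * exp (- (z * of_real t)))) (at (complex_of_real t))"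
      by (auto intro!: derivative_eq_intros)
    show ?thesis using DERIV_mult[OF 1 2] by (simp add: algebra_simps)
  qed
  then show ?thesis by (rule has_vector_derivative_real_field)
qed

text \<open>The common part of the base case and the induction step in the evaluation of
  \<open>\<integral> exp_kernel n z\<close>: integration by parts.\<close>

lemma exp_kernel_integrals_by_antiderivative:
  assumes z: "Re z > 0"
    and F: "\<And>t. (F has_vector_derivative (a * exp_kernel n z t + b * exp_kernel m z t)) (at t) \<or> t \<le> 0"
    and F0: "isCont F 0" and Fi: "(F \<longlongrightarrow> 0) at_top"
  shows "a * (\<integral>t. exp_kernel n z t \<partial>lborel) + b * (\<integral>t. exp_kernel m z t \<partial>lborel) = - F 0"
proof -
  let ?f = "\<lambda>t. a * exp_kernel n z t + b * exp_kernel m z t"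
  have fi: "integrable lborel ?f" using exp_kernel_integrable[OF z] by auto
  have "(LBINT t=0..\<infinity>. ?f t) = 0 - F 0"
  proof (rule interval_integral_FTC_integrable)
    show "set_integrable lborel (einterval 0 \<infinity>) ?f"
      unfolding set_integrable_def by (rule integrable_mult_indicator[OF _ fi]) auto
    show "((F \<circ> real_of_ereal) \<longlongrightarrow> F 0) (at_right 0)"
      using F0 unfolding zero_ereal_def
      by (subst ereal_tendsto_simps) (auto simp: isCont_def intro: tendsto_within_subset)
    show "((F \<circ> real_of_ereal) \<longlongrightarrow> 0) (at_left \<infinity>)"
      using Fi by (simp add: ereal_tendsto_simps)
  next
    fix x assume "0 < ereal x" "ereal x < \<infinity>"
    then have "x > 0" by (simp add: zero_ereal_def)
    then show "(F has_vector_derivative ?f x) (at x)" "isCont ?f x" using F[of x] isCont_exp_kernel_pos by (auto intro!: continuous_intros)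
  qed simp
  moreover have "(LBINT t=0..\<infinity>. ?f t) = (LBINT t. ?f t)"
  proof -
    have "(LBINT t=0..\<infinity>. ?f t) = (LBINT t:{0<..}. ?f t)"
      using interval_integral_to_infinity_eq[of lborel 0 ?f] by (simp add: zero_ereal_def)
    also have "\<dots> = (LBINT t. ?f t)"
      unfolding set_lebesgue_integral_def
      by (rule integral_cong_AE, measurable, use AE_lborel_singleton[of 0] in eventually_elim)
         (auto simp: indicator_def exp_kernel_def)
    finally show ?thesis .
  qed
  ultimately show ?thesis using exp_kernel_integrable[OF z] by simp
qed

lemma power_exp_tendsto_0:
  assumes "Re z > 0"
  shows "((\<lambda>t. of_real t ^ n * exp (- (z * of_real t))) \<longlongrightarrow> 0) at_top"
proof (rule tendsto_norm_zero_cancel)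
  have "((\<lambda>t. t ^ n * exp (- (Re z * t))) \<longlongrightarrow> 0) at_top"
    using assms by real_asymp
  moreover have "\<forall>\<^sub>F t in at_top. t ^ n * exp (- (Re z * t)) = norm (of_real t ^ n * exp (- (z * of_real t)))"
    using eventually_ge_at_top[of 0] by eventually_elim (auto simp: norm_mult norm_power)
  ultimately show "((\<lambda>t. norm (of_real t ^ n * exp (- (z * of_real t)))) \<longlongrightarrow> 0) at_top"
    by (rule Lim_transform_eventually)
qed

lemma integral_exp_kernel:
  assumes z: "Re z > 0"
  shows "(\<integral>t. exp_kernel n z t \<partial>lborel) = fact n / z ^ Suc n"
proof (induction n)
  have z0: "z \<noteq> 0" using z by auto
  case 0
  have "(-z) * (\<integral>t. exp_kernel 0 z t \<partial>lborel) + 0 * (\<integral>t. exp_kernel 0 z t \<partial>lborel) = - exp (- (z * of_real 0))"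
  proof (rule exp_kernel_integrals_by_antiderivative[OF z])
    show "((\<lambda>t. exp (- (z * of_real t))) has_vector_derivative (-z) * exp_kernel 0 z t + 0 * exp_kernel 0 z t) (at t) \<or> t \<le> 0" for t
    proof (cases "t \<le> 0")
      case False
      have "((\<lambda>w. exp (- (z * w))) has_field_derivative (-z) * exp (- (z * of_real t))) (at (of_real t))"
        by (auto intro!: derivative_eq_intros)
      from has_vector_derivative_real_field[OF this]
      show ?thesis using False by (simp add: exp_kernel_def)
    qed auto
    show "((\<lambda>t. exp (- (z * of_real t))) \<longlongrightarrow> 0) at_top" using power_exp_tendsto_0[OF z, of 0] by simp
  qed (intro continuous_intros)
  then show ?case using z0 by (simp add: field_simps)
next
  have z0: "z \<noteq> 0" using z by auto
  case (Suc n)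
  have "of_nat (Suc n) * (\<integral>t. exp_kernel n z t \<partial>lborel) + (-z) * (\<integral>t. exp_kernel (Suc n) z t \<partial>lborel)
     = - (of_real 0 ^ Suc n * exp (- (z * of_real 0)))"
  proof (rule exp_kernel_integrals_by_antiderivative[OF z])
    show "((\<lambda>t. of_real t ^ Suc n * exp (- (z * of_real t))) has_vector_derivative of_nat (Suc n) * exp_kernel n z t + (-z) * exp_kernel (Suc n) z t) (at t) \<or> t \<le> 0" for t
      using exp_kernel_has_derivative[of n z t] by (auto simp: exp_kernel_def algebra_simps)
    show "((\<lambda>t. of_real t ^ Suc n * exp (- (z * of_real t))) \<longlongrightarrow> 0) at_top" by (rule power_exp_tendsto_0[OF z])
  qed (intro continuous_intros)
  then show ?case using z0 unfolding Suc.IH by (simp add: field_simps)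
qed

lemma exp_mult_exp_kernel: "exp (- (w * of_real t)) * exp_kernel n z t = exp_kernel n (z + w) t"
  by (auto simp: exp_kernel_def exp_add[symmetric] algebra_simps)

lemma L1_fourier_exp_kernel:
  assumes "Re z > 0"
  shows "L1_fourier (exp_kernel n z) \<omega> = fact n / (z + \<i> * of_real \<omega>) ^ Suc n"
proof -
  have "L1_fourier (exp_kernel n z) \<omega> = (\<integral>t. exp_kernel n (z + \<i> * of_real \<omega>) t \<partial>lborel)"
    unfolding L1_fourier_def by (simp add: exp_mult_exp_kernel)
  then show ?thesis using assms by (simp add: integral_exp_kernel)
qed

lemma L1_fourier_add:
  assumes "integrable lborel f" "integrable lborel g"
  shows "L1_fourier (\<lambda>t. f t + g t) \<omega> = L1_fourier f \<omega> + L1_fourier g \<omega>"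
  unfolding L1_fourier_cis using integrable_cis_mult(1)[OF assms(1)] integrable_cis_mult(1)[OF assms(2)]
  by (simp add: distrib_left)

lemma L1_fourier_cmult: "L1_fourier (\<lambda>t. c * f t) \<omega> = c * L1_fourier f \<omega>"
  unfolding L1_fourier_cis by (simp add: mult.left_commute)

lemma L1_fourier_diff:
  assumes "integrable lborel f" "integrable lborel g"
  shows "L1_fourier (\<lambda>t. f t - g t) \<omega> = L1_fourier f \<omega> - L1_fourier g \<omega>"
  unfolding L1_fourier_cis using integrable_cis_mult(1)[OF assms(1)] integrable_cis_mult(1)[OF assms(2)]
  by (simp add: right_diff_distrib)

lemma L1_fourier_sum:
  assumes "finite I" "\<And>i. i \<in> I \<Longrightarrow> integrable lborel (f i)"
  shows "L1_fourier (\<lambda>t. \<Sum>i\<in>I. f i t) \<omega> = (\<Sum>i\<in>I. L1_fourier (f i) \<omega>)"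
  using assms
proof (induction I rule: finite_induct)
  case (insert i I)
  then show ?case using L1_fourier_add[of "f i" "\<lambda>t. \<Sum>i\<in>I. f i t" \<omega>] by auto
qed (simp add: L1_fourier_def)

lemma tame_uminus: assumes "tame g" shows "tame (\<lambda>t. g (- t))"
proof -
  obtain B where "\<And>t. norm (g t) \<le> B" using assms by (auto simp: tame_def)
  moreover have "integrable lborel (\<lambda>t. g (- t))" using integrable_reflect[OF tame_integrable[OF assms], of 0] by simp
  moreover have "finite (uminus ` {t. \<not> isCont g t})" using assms by (auto simp: tame_def)
  moreover have "isCont (\<lambda>t. g (- t)) t" if "t \<notin> uminus ` {t. \<not> isCont g t}" for t
  proof -
    have "isCont g (- t)" using that by force
    then show ?thesis using isCont_o2[of t uminus g] by auto
  qed
  ultimately show ?thesis by (intro tameI) auto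
qed

lemma L1_fourier_uminus: "L1_fourier (\<lambda>t. g (- t)) \<omega> = L1_fourier g (- \<omega>)"
  unfolding L1_fourier_cis
  using integral_reflect_shift[where f="\<lambda>t. cis (- (- \<omega> * t)) * g t" and c=0] by simp

text \<open>Transfer functions of tame kernels. Only the values on the imaginary axis matter.\<close>

definition realizable :: "(complex \<Rightarrow> complex) \<Rightarrow> bool" where
  "realizable Q \<longleftrightarrow> (\<exists>f. tame f \<and> (\<forall>\<omega>. L1_fourier f \<omega> = Q (\<i> * of_real \<omega>)))"

lemma realizable_add:
  assumes "realizable P" "realizable Q" and "\<And>\<omega>. R (\<i> * of_real \<omega>) = P (\<i> * of_real \<omega>) + Q (\<i> * of_real \<omega>)"
  shows "realizable R"
proof -
  obtain f g where "tame f" "tame g" "\<And>\<omega>. L1_fourier f \<omega> = P (\<i> * of_real \<omega>)" "\<And>\<omega>. L1_fourier g \<omega> = Q (\<i> * of_real \<omega>)"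
    using assms unfolding realizable_def by blast
  then show ?thesis unfolding realizable_def
    by (intro exI[of _ "\<lambda>t. f t + g t"]) (auto simp: tame_add L1_fourier_add tame_integrable assms(3))
qed

text \<open>The pole lies in the right half-plane, so the kernel is supported on the negative half-line: a
  reflected exponential kernel.\<close>

lemma realizable_pole:
  assumes "Re a > 0"
  shows "realizable (\<lambda>p. c / (p - a) ^ Suc n)"
proof -
  let ?f = "\<lambda>t. (c * (-1) ^ Suc n / fact n) * exp_kernel n a (- t)"
  have "tame ?f" by (intro tame_cmult tame_uminus exp_kernel_tame assms)
  moreover have "L1_fourier ?f \<omega> = c / (\<i> * of_real \<omega> - a) ^ Suc n" for \<omega>
  proof -
    have "L1_fourier ?f \<omega> = (c * (-1) ^ Suc n / fact n) * (fact n / (a + \<i> * of_real (- \<omega>)) ^ Suc n)"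
      unfolding L1_fourier_cmult L1_fourier_uminus by (simp only: L1_fourier_exp_kernel[OF assms])
    also have "\<dots> = c * ((-1) ^ Suc n / (a + \<i> * of_real (- \<omega>)) ^ Suc n)" by simp
    also have "(-1) ^ Suc n / (a + \<i> * of_real (- \<omega>)) ^ Suc n = (- 1 / (a + \<i> * of_real (- \<omega>))) ^ Suc n"
      by (simp only: power_divide)
    also have "- 1 / (a + \<i> * of_real (- \<omega>)) = 1 / (\<i> * of_real \<omega> - a)"
      by (simp add: divide_simps add_eq_0_iff2)
    finally show ?thesis by (simp add: power_divide)
  qed
  ultimately show ?thesis unfolding realizable_def by blast
qed

text \<open>Partial fractions, one pole at a time. If \<open>\<delta> = (p - a) ^ Suc m * \<delta>1\<close> with \<open>poly \<delta>1 a \<noteq> 0\<close>,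
  then for \<open>c = poly d a / poly \<delta>1 a\<close> the numerator \<open>d - c * \<delta>1\<close> vanishes at \<open>a\<close>, and
  cancelling the factor \<open>p - a\<close> leaves \<open>c / (p - a) ^ Suc m\<close> plus a fraction whose denominator
  has smaller degree.\<close>

lemma realizable_rational:
  fixes d \<delta> :: "complex poly"
  assumes "degree d < degree \<delta>" and "\<And>p. poly \<delta> p = 0 \<Longrightarrow> Re p > 0"
  shows "realizable (\<lambda>p. poly d p / poly \<delta> p)"
  using assms
proof (induction "degree \<delta>" arbitrary: d \<delta>)
  case 0
  then show ?case by simp
next
  case (Suc n)
  have \<delta>0: "\<delta> \<noteq> 0" using Suc by auto
  have "\<not> constant (poly \<delta>)" using Suc by (simp add: constant_degree)
  then obtain a where a: "poly \<delta> a = 0" using fundamental_theorem_of_algebra by blast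
  have Rea: "Re a > 0" by (rule Suc.prems(2)[OF a])
  obtain \<delta>1 where \<delta>1: "\<delta> = [:- a, 1:] ^ order a \<delta> * \<delta>1" and nd: "\<not> [:- a, 1:] dvd \<delta>1"
    using order_decomp[OF \<delta>0] by blast
  have "order a \<delta> \<noteq> 0" using a \<delta>0 by (simp add: order_root)
  then obtain m where m: "order a \<delta> = Suc m" by (cases "order a \<delta>") auto
  define \<delta>' where "\<delta>' = [:- a, 1:] ^ m * \<delta>1"
  have \<delta>\<delta>': "\<delta> = [:- a, 1:] * \<delta>'" using \<delta>1[unfolded m] unfolding \<delta>'_def by (simp only: power_Suc mult.assoc)
  then have \<delta>'0: "\<delta>' \<noteq> 0" using \<delta>0 by auto
  have deg': "degree \<delta>' = n" using Suc.hyps(2) \<delta>'0 by (subst (asm) \<delta>\<delta>', subst (asm) degree_mult_eq) auto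
  have \<delta>10: "\<delta>1 \<noteq> 0" using \<delta>0 \<delta>1 by auto
  have "degree \<delta>' = m + degree \<delta>1"
    unfolding \<delta>'_def using \<delta>10 by (subst degree_mult_eq) (auto simp: degree_power_eq)
  then have deg1: "degree \<delta>1 \<le> n" using deg' by simp
  have \<delta>1a: "poly \<delta>1 a \<noteq> 0" using nd by (simp add: poly_eq_0_iff_dvd)
  define c where "c = poly d a / poly \<delta>1 a"
  have "poly (d - smult c \<delta>1) a = 0" using \<delta>1a by (simp add: c_def)
  then have "[:- a, 1:] dvd d - smult c \<delta>1" by (simp only: poly_eq_0_iff_dvd)
  then obtain d1 where d1: "d - smult c \<delta>1 = [:- a, 1:] * d1" by (rule dvdE)
  have ax: "poly \<delta> (\<i> * of_real \<omega>) \<noteq> 0" for \<omega> using Suc.prems(2)[of "\<i> * of_real \<omega>"] by auto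
  have eq: "poly d p / poly \<delta> p = c / (p - a) ^ Suc m + poly d1 p / poly \<delta>' p" if "poly \<delta> p \<noteq> 0" for p
  proof -
    have nz: "p - a \<noteq> 0" "poly \<delta>1 p \<noteq> 0" using that by (auto simp: \<delta>\<delta>' \<delta>'_def)
    have "poly d p = poly (d - smult c \<delta>1) p + c * poly \<delta>1 p" by simp
    also have "\<dots> = (p - a) * poly d1 p + c * poly \<delta>1 p" by (simp only: d1) (simp add: algebra_simps)
    finally have d: "poly d p = (p - a) * poly d1 p + c * poly \<delta>1 p" .
    have "poly \<delta> p = (p - a) ^ Suc m * poly \<delta>1 p" "poly \<delta>' p = (p - a) ^ m * poly \<delta>1 p"
      by (subst \<delta>\<delta>') (simp_all add: \<delta>'_def poly_power algebra_simps)
    moreover have "(u * x + c * y) / (u ^ Suc m * y) = c / u ^ Suc m + x / (u ^ m * y)"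
      if "u \<noteq> 0" "y \<noteq> 0" for u x y :: complex
      using that by (simp add: field_simps)
    ultimately show ?thesis using nz by (simp only: d)
  qed
  have 1: "realizable (\<lambda>p. poly d1 p / poly \<delta>' p)"
  proof (cases "d1 = 0")
    case True
    then show ?thesis unfolding realizable_def using tame_zero by (intro exI[of _ "\<lambda>_. 0"]) (auto simp: L1_fourier_def)
  next
    case False
    have "1 + degree d1 = degree (d - smult c \<delta>1)" unfolding d1 using False by (subst degree_mult_eq) auto
    also have "\<dots> \<le> n"
      using Suc.prems(1) Suc.hyps(2) deg1 by (intro degree_diff_le) (auto intro: order_trans[OF degree_smult_le])
    finally have "degree d1 < degree \<delta>'" using deg' by simp
    moreover have "Re p > 0" if "poly \<delta>' p = 0" for p using Suc.prems(2)[of p] that by (simp add: \<delta>\<delta>')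
    ultimately show ?thesis using Suc.hyps(1)[of \<delta>' d1] deg' by auto
  qed
  show ?case
    by (rule realizable_add[OF realizable_pole[OF Rea, of c m] 1]) (rule eq[OF ax])
qed

text \<open>By a Dynkin system argument all integrals over Borel subsets of a bounded interval vanish.\<close>

lemma AE_zero_of_interval_integrals:
  fixes h :: "real \<Rightarrow> complex"
  assumes int: "\<And>a b. integrable lborel (\<lambda>s. indicator {a..b} s * h s)"
    and zero: "\<And>a b. (\<integral>s. indicator {a..b} s * h s \<partial>lborel) = 0"
  shows "AE s in lborel. h s = 0"
proof -
  have sc: "indicator A s *\<^sub>R z = indicator A s * (z::complex)" for A and s :: real and z by (simp add: indicator_def)
  have "AE s in lborel. indicator {- real n..real n} s * h s = 0" for n :: nat
  proof (rule sigma_finite_measure.density_zero[OF lborel.sigma_finite_measure_axioms])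
    let ?h = "\<lambda>s. indicator {- real n..real n} s * h s"
    show hi: "integrable lborel ?h" by (rule int)
    have si: "set_integrable lborel A ?h" if "A \<in> sets borel" for A
      unfolding set_integrable_def by (rule integrable_mult_indicator[OF _ hi]) (use that in auto)
    fix A :: "real set" assume "A \<in> sets lborel"
    then have "A \<in> sigma_sets UNIV (range (\<lambda>(a,b). {a..b}))"
      by (simp add: borel_eq_atLeastAtMost)
    moreover have "Int_stable (range (\<lambda>(a,b). {a..b::real}))" by (auto simp: Int_stable_def)
    moreover have "range (\<lambda>(a,b). {a..b::real}) \<subseteq> Pow UNIV" by simp
    ultimately have "Int_stable (range (\<lambda>(a,b). {a..b::real}))"
      "range (\<lambda>(a,b). {a..b::real}) \<subseteq> Pow UNIV" "A \<in> sigma_sets UNIV (range (\<lambda>(a,b). {a..b}))" by auto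
    then show "set_lebesgue_integral lborel A ?h = 0"
    proof (induction rule: sigma_sets_induct_disjoint)
      case (basic A)
      then obtain a b where A: "A = {a..b}" by auto
      have "set_lebesgue_integral lborel A ?h = (\<integral>s. indicator {max a (- real n)..min b (real n)} s * h s \<partial>lborel)"
        unfolding set_lebesgue_integral_def A sc
        by (intro Bochner_Integration.integral_cong) (auto simp: indicator_def)
      then show ?case by (simp only: zero)
    next
      case empty then show ?case by (simp add: set_lebesgue_integral_def)
    next
      case (compl A)
      then have A: "A \<in> sets borel" by (auto simp: borel_eq_atLeastAtMost)
      have "set_lebesgue_integral lborel (A \<union> (UNIV - A)) ?h = set_lebesgue_integral lborel A ?h + set_lebesgue_integral lborel (UNIV - A) ?h"
        using A by (intro set_integral_Un si) auto
      moreover have "set_lebesgue_integral lborel (A \<union> (UNIV - A)) ?h = 0"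
        using zero by (simp add: set_lebesgue_integral_def)
      ultimately show ?case using compl by simp
    next
      case (union A)
      then have A: "A i \<in> sets borel" for i by (auto simp: borel_eq_atLeastAtMost)
      have "set_lebesgue_integral lborel (\<Union>i. A i) ?h = (\<Sum>i. set_lebesgue_integral lborel (A i) ?h)"
        using A union by (intro lebesgue_integral_countable_add si) (auto simp: disjoint_family_on_def)
      then show ?case using union by simp
    qed
  qed
  then have "AE s in lborel. \<forall>n::nat. indicator {- real n..real n} s * h s = 0" by (simp only: AE_all_countable, simp)
  then show ?thesis
  proof eventually_elim
    case (elim s)
    obtain n :: nat where "\<bar>s\<bar> \<le> real n" using real_arch_simple by blast
    then have "s \<in> {- real n..real n}" by auto
    then show ?case using elim[rule_format, of n] by simp
  qed
qed

text \<open>A kernel in \<open>anticausal_kernels\<close> is given only through its Fourier transform, in the sense of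
  \<open>L\<^sub>1\<close> or of \<open>L\<^sub>2\<close>. Partial fractions give a tame kernel with the same transform. By
  Parseval's formula the two have the same convolutions with indicators of intervals, hence the same
  integrals over intervals, hence they agree almost everywhere.\<close>

lemma anticausal_kernel_tame:
  assumes "k \<in> anticausal_kernels \<Omega>"
  obtains k0 d \<delta> where "tame k0" "AE t in lborel. of_real (k t) = k0 t" "degree d < degree \<delta>"
    "\<And>p. poly \<delta> p = 0 \<Longrightarrow> Re p > 0"
    "\<And>\<omega>. L1_fourier k0 \<omega> = poly d (\<i> * of_real \<omega>) / poly \<delta> (\<i> * of_real \<omega>)"
    "(\<lambda>t. complex_of_real (k t)) \<in> borel_measurable borel"
proof -
  obtain d \<delta> :: "complex poly" where deg: "degree d < degree \<delta>"
    and F: "has_fourier (\<lambda>t. of_real (k t)) (\<lambda>\<omega>. poly d (\<i> * of_real \<omega>) / poly \<delta> (\<i> * of_real \<omega>))"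
    and roots: "\<And>p. poly \<delta> p = 0 \<Longrightarrow> Re p > 0"
    using assms unfolding anticausal_kernels_def by blast
  obtain k0 where k0: "tame k0" and k0f: "\<And>\<omega>. L1_fourier k0 \<omega> = poly d (\<i> * of_real \<omega>) / poly \<delta> (\<i> * of_real \<omega>)"
    using realizable_rational[OF deg roots] unfolding realizable_def by blast
  let ?k = "\<lambda>t. complex_of_real (k t)"
  have F': "has_fourier ?k (L1_fourier k0)" using F by (simp add: k0f[abs_def, symmetric])
  have k02: "sq_norm (L1_fourier k0) < top"
    by (intro sq_norm_L1_fourier_finite tame_integrable[OF k0] tame_sq_norm[OF k0])
  have main: "?k \<in> borel_measurable borel \<and> (\<forall>a b. integrable lborel (\<lambda>s. indicator {a..b} s * ?k s)) \<and>
     (\<forall>g t. tame g \<longrightarrow> conv g ?k t = conv g k0 t)"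
  proof (cases "?k \<in> Lspace 1 \<and> (\<forall>\<omega>. L1_fourier k0 \<omega> = L1_fourier ?k \<omega>)")
    case True
    then have i: "integrable lborel ?k" and eq: "L1_fourier ?k = L1_fourier k0" by (auto simp: Lspace_1_iff)
    have "conv g ?k t = conv g k0 t" if "tame g" for g t
      using conv_fourier_L1[OF that i, of t] conv_fourier_L1[OF that tame_integrable[OF k0] k02, of t] k02
      by (simp add: eq)
    moreover have "integrable lborel (\<lambda>s. indicator {a..b} s * ?k s)" for a b
      using i by (subst mult.commute, intro integrable_bounded_mult[of _ _ _ 1]) (auto simp: indicator_def)
    ultimately show ?thesis using i by auto
  next
    case False
    then have L2: "has_L2_fourier ?k (L1_fourier k0)" using F' unfolding has_fourier_def by blast
    note D = has_L2_fourierD[OF L2]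
    have "conv g ?k t = conv g k0 t" if "tame g" for g t
      using conv_fourier_L2[OF that L2, of t] conv_fourier_L1[OF that tame_integrable[OF k0] k02, of t] by simp
    moreover have "integrable lborel (\<lambda>s. indicator {a..b} s * ?k s)" for a b
      by (rule integrable_mult_of_sq_norm[OF _ _ tame_sq_norm[OF tame_indicator] D(2)]) (use D(1) in auto)
    ultimately show ?thesis using D(1) by auto
  qed
  have k0i: "integrable lborel (\<lambda>s. indicator {a..b} s * k0 s)" for a b
    using tame_integrable[OF k0] by (subst mult.commute, intro integrable_bounded_mult[of _ _ _ 1]) (auto simp: indicator_def)
  have "AE s in lborel. ?k s - k0 s = 0"
  proof (rule AE_zero_of_interval_integrals)
    fix a b
    show "integrable lborel (\<lambda>s. indicator {a..b} s * (?k s - k0 s))"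
      using main k0i[of a b] by (simp add: right_diff_distrib)
    (* Convolution reflects the interval, so the indicator of [- b, - a] tests on [a, b]. *)
    have ind: "indicator {-b..-a} (0 - s) = (indicator {a..b} s :: complex)" for s by (auto simp: indicator_def)
    have "conv (\<lambda>t. indicator {-b..-a} t) ?k 0 = conv (\<lambda>t. indicator {-b..-a} t) k0 0"
      using main tame_indicator by blast
    then show "(\<integral>s. indicator {a..b} s * (?k s - k0 s) \<partial>lborel) = 0"
      using main k0i[of a b] unfolding conv_def ind by (simp add: right_diff_distrib)
  qed
  then have "AE t in lborel. ?k t = k0 t" by simp
  moreover have "?k \<in> borel_measurable borel" using main by blast
  ultimately show ?thesis by (intro that[OF k0 _ deg roots k0f])
qed

section \<open>Causal kernels with rational transfer functions\<close>

text \<open>Real coefficients, expressed through values. In this form the property passes to composite polynomials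
  without a coefficient computation.\<close>

definition real_poly :: "complex poly \<Rightarrow> bool" where
  "real_poly P \<longleftrightarrow> (\<forall>z. cnj (poly P z) = poly P (cnj z))"

lemma real_poly_coeff: assumes "real_poly P" shows "of_real (Re (coeff P j)) = coeff P j"
proof -
  have "poly (map_poly cnj P) z = poly P z" for z
    using assms poly_cnj[of P "cnj z"] by (simp add: real_poly_def)
  then have "poly (map_poly cnj P) = poly P" by (rule ext)
  then have "map_poly cnj P = P" by (simp only: poly_eq_poly_eq_iff)
  then have "cnj (coeff P j) = coeff P j" by (metis coeff_map_poly complex_cnj_zero)
  then show ?thesis by (simp add: complex_eq_iff)
qed

lemma poly_uniform:
  fixes P :: "complex poly"
  assumes "e > 0"
  obtains B \<delta> where "B > 0" "\<delta> > 0" "\<And>u. norm u \<le> r \<Longrightarrow> norm (poly P u) \<le> B"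
    "\<And>u v. norm u \<le> r \<Longrightarrow> norm v \<le> r \<Longrightarrow> norm (u - v) < \<delta> \<Longrightarrow> norm (poly P u - poly P v) < e"
proof -
  have c: "continuous_on (cball 0 r) (poly P)" by (intro continuous_intros)
  then have "bounded (poly P ` cball 0 r)" by (intro compact_imp_bounded compact_continuous_image) auto
  then obtain B where B: "B > 0" "\<And>u. norm u \<le> r \<Longrightarrow> norm (poly P u) \<le> B"
    unfolding bounded_pos by auto
  have "uniformly_continuous_on (cball 0 r) (poly P)"
    using c by (intro compact_uniformly_continuous) auto
  then obtain \<delta> where "\<delta> > 0" "\<And>u v. u \<in> cball 0 r \<Longrightarrow> v \<in> cball 0 r \<Longrightarrow> dist v u < \<delta> \<Longrightarrow> dist (poly P v) (poly P u) < e"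
    using assms unfolding uniformly_continuous_on_def by metis
  then show ?thesis using that[of B \<delta>] B by (auto simp: dist_norm)
qed

abbreviation exp_poly_transfer :: "complex poly \<Rightarrow> real \<Rightarrow> complex \<Rightarrow> complex" where
  "exp_poly_transfer R \<mu> p \<equiv> 1 / (of_real \<mu> + p) * poly R (1 / (of_real \<mu> + p))"

text \<open>The kernel whose transfer function is \<open>u * poly R u\<close> with \<open>u = 1 / (\<mu> + p)\<close>; the
  coefficients of \<open>R\<close> are divided by factorials because \<open>t ^ j * exp (- (\<mu> * t))\<close> on the positive
  half-line has Laplace transform \<open>fact j * u ^ Suc j\<close>.\<close>

definition exp_poly_kernel :: "complex poly \<Rightarrow> real \<Rightarrow> real \<Rightarrow> real" where
  "exp_poly_kernel R \<mu> t = (\<Sum>j\<le>degree R. Re (coeff R j) / fact j * (if t \<ge> 0 then t ^ j * exp (- (\<mu> * t)) else 0))"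

lemma of_real_exp_poly_kernel:
  assumes "real_poly R"
  shows "complex_of_real (exp_poly_kernel R \<mu> t) = (\<Sum>j\<le>degree R. coeff R j / fact j * exp_kernel j (of_real \<mu>) t)"
proof -
  have "complex_of_real (Re (coeff R j) / fact j * (if t \<ge> 0 then t ^ j * exp (- (\<mu> * t)) else 0))
      = coeff R j / fact j * exp_kernel j (of_real \<mu>) t" for j
    using real_poly_coeff[OF assms, of j]
    by (cases "t \<ge> 0") (simp_all add: exp_kernel_def flip: exp_of_real)
  then show ?thesis unfolding exp_poly_kernel_def of_real_sum by simp
qed

lemma exp_poly_kernel_tame:
  assumes "real_poly R" "\<mu> > 0"
  shows "tame (\<lambda>t. complex_of_real (exp_poly_kernel R \<mu> t))"
  unfolding of_real_exp_poly_kernel[OF assms(1)]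
  by (intro tame_sum tame_cmult exp_kernel_tame) (use assms in auto)

lemma L1_fourier_exp_poly_kernel:
  assumes "real_poly R" "\<mu> > 0"
  shows "L1_fourier (\<lambda>t. complex_of_real (exp_poly_kernel R \<mu> t)) \<omega>
    = exp_poly_transfer R \<mu> (\<i> * of_real \<omega>)"
proof -
  let ?u = "1 / (of_real \<mu> + \<i> * of_real \<omega>)"
  have z: "Re (of_real \<mu>) > 0" using assms by simp
  have "L1_fourier (\<lambda>t. complex_of_real (exp_poly_kernel R \<mu> t)) \<omega>
     = (\<Sum>j\<le>degree R. coeff R j / fact j * (fact j / (of_real \<mu> + \<i> * of_real \<omega>) ^ Suc j))"
    unfolding of_real_exp_poly_kernel[OF assms(1)]
    by (subst L1_fourier_sum)
       (auto intro: exp_kernel_integrable[OF z] simp only: L1_fourier_cmult L1_fourier_exp_kernel[OF z] intro!: integrable_mult_right)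
  also have "\<dots> = (\<Sum>j\<le>degree R. ?u * (coeff R j * ?u ^ j))"
    by (intro sum.cong refl) (simp add: power_divide)
  finally show ?thesis by (simp add: poly_altdef sum_distrib_left)
qed

lemma laplace_exp_poly_kernel:
  assumes "real_poly R" "\<mu> > 0" "Re p > 0"
  shows "laplace (\<lambda>t. of_real (exp_poly_kernel R \<mu> t)) p
    = exp_poly_transfer R \<mu> p"
proof -
  let ?u = "1 / (of_real \<mu> + p)"
  have z: "Re (of_real \<mu> + p) > 0" using assms by simp
  have "laplace (\<lambda>t. of_real (exp_poly_kernel R \<mu> t)) p
     = (\<integral>t. (\<Sum>j\<le>degree R. coeff R j / fact j * exp_kernel j (of_real \<mu> + p) t) \<partial>lborel)"
    unfolding laplace_def set_lebesgue_integral_def of_real_exp_poly_kernel[OF assms(1)]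
  proof (intro Bochner_Integration.integral_cong refl)
    fix t :: real
    show "indicator {0..} t *\<^sub>R (exp (- (p * of_real t)) * (\<Sum>j\<le>degree R. coeff R j / fact j * exp_kernel j (of_real \<mu>) t))
       = (\<Sum>j\<le>degree R. coeff R j / fact j * exp_kernel j (of_real \<mu> + p) t)"
    proof (cases "t \<ge> 0")
      case True
      then show ?thesis
        by (simp add: sum_distrib_left exp_mult_exp_kernel[symmetric] mult.left_commute[of "exp _"])
    qed (simp add: exp_kernel_def)
  qed
  also have "\<dots> = (\<Sum>j\<le>degree R. coeff R j / fact j * (fact j / (of_real \<mu> + p) ^ Suc j))"
    by (subst Bochner_Integration.integral_sum) (use exp_kernel_integrable[OF z] in \<open>auto simp: integral_exp_kernel[OF z]\<close>)
  also have "\<dots> = (\<Sum>j\<le>degree R. ?u * (coeff R j * ?u ^ j))"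
    by (intro sum.cong refl) (simp add: power_divide)
  finally show ?thesis by (simp add: poly_altdef sum_distrib_left)
qed

lemma nn_integral_inverse_square: "(\<integral>\<^sup>+ x. ennreal (1 / (1 + x\<^sup>2)) \<partial>lborel) = ennreal pi"
proof -
  have i: "integrable lborel (\<lambda>x::real. inverse (1 + x\<^sup>2))"
    using integrable_inverse_1_plus_square by (simp add: set_integrable_def)
  have "(\<integral>x. inverse (1 + x\<^sup>2) \<partial>lborel) = pi"
    using LBINT_inverse_1_plus_square by (simp add: interval_lebesgue_integral_def set_lebesgue_integral_def)
  then show ?thesis
    using nn_integral_eq_integral[OF i] by (simp add: inverse_eq_divide)
qed

text \<open>In the right half-plane \<open>\<bar>u\<bar> \<le> 1 / \<mu>\<close> keeps \<open>poly R u\<close> bounded, and the remaining factor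
  \<open>\<bar>u\<bar>\<^sup>2 \<le> 1 / (\<mu>\<^sup>2 + \<omega>\<^sup>2)\<close> gives a square integrable bound on vertical lines, independent of
  the line.\<close>

lemma exp_poly_kernel_in_causal_kernels:
  assumes R: "real_poly R" and \<mu>: "\<mu> > 0"
  shows "exp_poly_kernel R \<mu> \<in> causal_kernels"
proof -
  let ?k = "\<lambda>t. complex_of_real (exp_poly_kernel R \<mu> t)"
  let ?Q = "exp_poly_transfer R \<mu>"
  have lap: "laplace ?k p = ?Q p" if "Re p > 0" for p
    by (rule laplace_exp_poly_kernel[OF R \<mu> that])
  have nz: "of_real \<mu> + p \<noteq> 0" if "Re p > 0" for p
    using that \<mu> by (auto simp: complex_eq_iff)
  obtain B where B0: "B > 0" and B: "\<And>u. norm u \<le> 1 / \<mu> \<Longrightarrow> norm (poly R u) \<le> B"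
    using poly_uniform[OF zero_less_one] by metis
  have Qb: "norm (?Q (Complex s \<omega>)) \<le> B / \<mu>" "(norm (?Q (Complex s \<omega>)))\<^sup>2 \<le> B\<^sup>2 / min (\<mu>\<^sup>2) 1 * (1 / (1 + \<omega>\<^sup>2))"
    if s: "s > 0" for s \<omega>
  proof -
    have sq: "(norm (of_real \<mu> + Complex s \<omega>))\<^sup>2 = (\<mu> + s)\<^sup>2 + \<omega>\<^sup>2" by (simp add: cmod_power2)
    have "\<mu>\<^sup>2 \<le> (\<mu> + s)\<^sup>2" using s \<mu> by (intro power_mono) auto
    then have ge: "(norm (of_real \<mu> + Complex s \<omega>))\<^sup>2 \<ge> \<mu>\<^sup>2 + \<omega>\<^sup>2" using sq by simp
    then have "(norm (of_real \<mu> + Complex s \<omega>))\<^sup>2 \<ge> \<mu>\<^sup>2" using zero_le_power2[of \<omega>] by linarith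
    then have l: "norm (of_real \<mu> + Complex s \<omega>) \<ge> \<mu>" using \<mu> by (simp add: power2_le_iff_abs_le)
    then have ub: "norm (1 / (of_real \<mu> + Complex s \<omega>)) \<le> 1 / \<mu>"
      using \<mu> by (simp add: norm_divide frac_le)
    then have 1: "norm (?Q (Complex s \<omega>)) \<le> norm (1 / (of_real \<mu> + Complex s \<omega>)) * B"
      unfolding norm_mult by (intro mult_left_mono B) auto
    also have "\<dots> \<le> 1 / \<mu> * B" using ub B0 by (intro mult_right_mono) auto
    finally show "norm (?Q (Complex s \<omega>)) \<le> B / \<mu>" by simp
    let ?c = "min (\<mu>\<^sup>2) 1"
    have c: "?c > 0" using \<mu> by simp
    have "?c * (1 + \<omega>\<^sup>2) \<le> \<mu>\<^sup>2 + \<omega>\<^sup>2"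
    proof -
      have "?c * \<omega>\<^sup>2 \<le> 1 * \<omega>\<^sup>2" by (intro mult_right_mono) auto
      then show ?thesis by (simp add: distrib_left)
    qed
    then have n: "?c * (1 + \<omega>\<^sup>2) \<le> (norm (of_real \<mu> + Complex s \<omega>))\<^sup>2" using ge by simp
    have p: "?c * (1 + \<omega>\<^sup>2) > 0" using c by (intro mult_pos_pos) (auto intro: add_pos_nonneg)
    have "(norm (?Q (Complex s \<omega>)))\<^sup>2 \<le> (norm (1 / (of_real \<mu> + Complex s \<omega>)) * B)\<^sup>2"
      using 1 by (intro power_mono) auto
    also have "\<dots> = B\<^sup>2 / (norm (of_real \<mu> + Complex s \<omega>))\<^sup>2"
      by (simp add: norm_divide power_mult_distrib power_divide)
    also have "\<dots> \<le> B\<^sup>2 / (?c * (1 + \<omega>\<^sup>2))" using n p order.strict_trans2[OF p n] by (intro divide_left_mono mult_pos_pos[OF _ p]) auto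
    finally show "(norm (?Q (Complex s \<omega>)))\<^sup>2 \<le> B\<^sup>2 / ?c * (1 / (1 + \<omega>\<^sup>2))" by simp
  qed
  have Qm: "(\<lambda>\<omega>. ?Q (Complex s \<omega>)) \<in> borel_measurable borel" if "s > 0" for s
  proof -
    have c: "continuous_on UNIV (\<lambda>\<omega>. Complex s \<omega>)" unfolding Complex_eq by (intro continuous_intros)
    have "of_real \<mu> + Complex s \<omega> \<noteq> 0" for \<omega> using that by (intro nz) simp
    then show ?thesis by (intro borel_measurable_continuous_onI continuous_intros c) auto
  qed
  have hol: "laplace ?k holomorphic_on right_half_plane"
  proof (subst holomorphic_cong[OF refl])
    show "laplace ?k p = ?Q p" if "p \<in> right_half_plane" for p using lap that by (simp add: right_half_plane_def)
    have "(\<lambda>p. poly R (1 / (of_real \<mu> + p))) holomorphic_on right_half_plane"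
      using holomorphic_on_compose[of "\<lambda>p. 1 / (of_real \<mu> + p)" right_half_plane "poly R"] nz
      by (auto simp: comp_def right_half_plane_def intro!: holomorphic_intros)
    then show "?Q holomorphic_on right_half_plane"
      using nz by (intro holomorphic_intros) (auto simp: right_half_plane_def)
  qed
  have eq: "(\<lambda>\<omega>. laplace ?k (Complex s \<omega>)) = (\<lambda>\<omega>. ?Q (Complex s \<omega>))" if "s > 0" for s
    using that by (intro ext lap) simp
  have "Hardy_norm 2 (laplace ?k) < \<infinity>"
  proof -
    have "(Lnorm 2 (\<lambda>\<omega>. laplace ?k (Complex s \<omega>)))\<^sup>2 \<le> ennreal (B\<^sup>2 / min (\<mu>\<^sup>2) 1 * pi)" if s: "s > 0" for s
    proof -
      have c: "B\<^sup>2 / min (\<mu>\<^sup>2) 1 \<ge> 0" using \<mu> by simp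
      have "(Lnorm 2 (\<lambda>\<omega>. laplace ?k (Complex s \<omega>)))\<^sup>2 = sq_norm (\<lambda>\<omega>. ?Q (Complex s \<omega>))"
        unfolding eq[OF s] using Qm[OF s] by (intro Lnorm_2_square) simp
      also have "\<dots> \<le> (\<integral>\<^sup>+\<omega>. ennreal (B\<^sup>2 / min (\<mu>\<^sup>2) 1) * ennreal (1 / (1 + \<omega>\<^sup>2)) \<partial>lborel)"
        using Qb(2)[OF s] c by (intro nn_integral_mono) (simp add: ennreal_power flip: ennreal_mult')
      also have "\<dots> = ennreal (B\<^sup>2 / min (\<mu>\<^sup>2) 1) * ennreal pi"
        by (subst nn_integral_cmult) (auto simp: nn_integral_inverse_square)
      also have "\<dots> = ennreal (B\<^sup>2 / min (\<mu>\<^sup>2) 1 * pi)" using c by (intro ennreal_mult'[symmetric])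
      finally show ?thesis .
    qed
    then have "Lnorm 2 (\<lambda>\<omega>. laplace ?k (Complex s \<omega>)) \<le> ennreal (sqrt (B\<^sup>2 / min (\<mu>\<^sup>2) 1 * pi))" if "s > 0" for s
      using that \<mu> by (subst ennreal_square_le_iff[symmetric]) (simp add: ennreal_power)
    then have "Hardy_norm 2 (laplace ?k) \<le> ennreal (sqrt (B\<^sup>2 / min (\<mu>\<^sup>2) 1 * pi))"
      unfolding Hardy_norm_def by (intro SUP_least) auto
    then show ?thesis by (rule order.strict_trans1) simp
  qed
  moreover have "Hardy_norm \<infinity> (laplace ?k) < \<infinity>"
  proof -
    have "Lnorm \<infinity> (\<lambda>\<omega>. laplace ?k (Complex s \<omega>)) \<le> ennreal (B / \<mu>)" if s: "s > 0" for s
      unfolding eq[OF s] Lnorm_def using Qm[OF s] Qb(1)[OF s] by (auto intro!: esssup_I AE_I2 ennreal_leI)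
    then have "Hardy_norm \<infinity> (laplace ?k) \<le> ennreal (B / \<mu>)"
      unfolding Hardy_norm_def by (intro SUP_least) auto
    then show ?thesis by (rule order.strict_trans1) simp
  qed
  moreover have "?k \<in> Lspace 2"
    unfolding Lspace_2_iff using exp_poly_kernel_tame[OF R \<mu>] by (simp only: tame_sq_norm tame_measurable measurable_lborel2)
  ultimately show ?thesis
    unfolding causal_kernels_def Hardy_def using hol by (auto simp: exp_poly_kernel_def)
qed

section \<open>Approximation on the low and on the high band\<close>

text \<open>Weierstrass approximation of the real and imaginary parts gives a polynomial in \<open>\<i> * s\<close> with
  complex coefficients. Averaging it with its conjugate makes the coefficients real, and this costs
  nothing where \<open>f\<close> has the symmetry of a real kernel's transfer function. The symmetry is asked for
  pointwise since it may be unknown at the single point \<open>s = 0\<close>.\<close>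

lemma real_poly_approx:
  fixes f :: "real \<Rightarrow> complex"
  assumes f: "continuous_on {-S..S} f" and e: "e > 0"
  obtains P where "real_poly P"
    "\<And>s. s \<in> {-S..S} \<Longrightarrow> f (-s) = cnj (f s) \<Longrightarrow> norm (f s - poly P (\<i> * of_real s)) < e"
proof -
  have "continuous_on {-S..S} (\<lambda>s. Re (f s))" "continuous_on {-S..S} (\<lambda>s. Im (f s))"
    using f by (auto intro!: continuous_intros)
  moreover have e2: "e / 2 > 0" using e by simp
  ultimately obtain g h where g: "real_polynomial_function g" "\<And>s. s \<in> {-S..S} \<Longrightarrow> \<bar>Re (f s) - g s\<bar> < e / 2"
    and h: "real_polynomial_function h" "\<And>s. s \<in> {-S..S} \<Longrightarrow> \<bar>Im (f s) - h s\<bar> < e / 2"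
    using Stone_Weierstrass_real_polynomial_function[of "{-S..S}"] by (metis compact_Icc)
  obtain a n b m where a: "g = (\<lambda>x. \<Sum>i\<le>n. a i * x ^ i)" and b: "h = (\<lambda>x. \<Sum>i\<le>m. b i * x ^ i)"
    using g(1) h(1) by (auto simp: real_polynomial_function_iff_sum)
  define A where "A = (\<Sum>i\<le>n. monom (complex_of_real (a i)) i)"
  define B where "B = (\<Sum>i\<le>m. monom (complex_of_real (b i)) i)"
  (* The argument is multiplied by - i because the values wanted are those at i * s. *)
  define Q where "Q = pcompose (A + smult \<i> B) [:0, - \<i>:]"
  have Q: "poly Q (\<i> * of_real s) = Complex (g s) (h s)" for s
  proof -
    have "- (\<i> * complex_of_real s * \<i>) = of_real s" by (simp add: complex_eq_iff)
    then have "poly Q (\<i> * of_real s) = poly A (of_real s) + \<i> * poly B (of_real s)"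
      by (simp add: Q_def poly_pcompose)
    also have "poly A (of_real s) = of_real (g s)" by (simp add: A_def a poly_sum poly_monom)
    also have "poly B (of_real s) = of_real (h s)" by (simp add: B_def b poly_sum poly_monom)
    finally show ?thesis by (simp add: Complex_eq)
  qed
  have Qe: "norm (f s - poly Q (\<i> * of_real s)) < e" if "s \<in> {-S..S}" for s
  proof -
    have "norm (f s - poly Q (\<i> * of_real s)) \<le> \<bar>Re (f s) - g s\<bar> + \<bar>Im (f s) - h s\<bar>"
      unfolding Q by (rule order_trans[OF cmod_le]) simp
    then show ?thesis using g(2)[OF that] h(2)[OF that] by simp
  qed
  define P where "P = smult (1/2) (Q + map_poly cnj Q)"
  have mc: "poly (map_poly cnj Q) z = cnj (poly Q (cnj z))" for z
    using poly_cnj[of Q "cnj z"] by simp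
  have P: "poly P z = (poly Q z + cnj (poly Q (cnj z))) / 2" for z
    by (simp add: P_def mc)
  show ?thesis
  proof (rule that)
    show "real_poly P" by (simp add: real_poly_def P add.commute)
    fix s assume s: "s \<in> {-S..S}" and sym: "f (-s) = cnj (f s)"
    have s': "- s \<in> {-S..S}" using s by auto
    have "f s - poly P (\<i> * of_real s) = ((f s - poly Q (\<i> * of_real s)) + cnj (f (-s) - poly Q (\<i> * of_real (-s)))) / 2"
      unfolding P sym by (simp add: field_simps)
    also have "norm \<dots> \<le> (norm (f s - poly Q (\<i> * of_real s)) + norm (f (-s) - poly Q (\<i> * of_real (-s)))) / 2"
      by (simp only: norm_divide norm_numeral) (intro divide_right_mono order_trans[OF norm_triangle_ineq], auto simp: complex_mod_cnj simp del: complex_cnj_diff)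
    also have "\<dots> < e" using Qe[OF s] Qe[OF s'] by simp
    finally show "norm (f s - poly P (\<i> * of_real s)) < e" .
  qed
qed

text \<open>On a bounded set of frequencies polynomials in \<open>z = \<i> * \<omega>\<close> are dense. They become stable
  and strictly proper on replacing \<open>z\<close> by \<open>N * z / (N + z)\<close> and multiplying by \<open>N / (N + z)\<close>;
  for large \<open>N\<close> both changes are small uniformly on the band, and the result is a polynomial
  without constant term in \<open>u = 1 / (N + z)\<close>.\<close>

lemma low_band_approx:
  fixes f :: "real \<Rightarrow> complex"
  assumes f: "continuous_on {-S..S} f" and sym: "\<And>s. f (-s) = cnj (f s)" and e: "e > 0" and S: "S > 0"
  obtains R \<mu> where "real_poly R" "\<mu> > 0"
    "\<And>\<omega>. \<bar>\<omega>\<bar> \<le> S \<Longrightarrow> norm (f \<omega> - exp_poly_transfer R \<mu> (\<i> * of_real \<omega>)) \<le> e"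
proof -
  have e3: "e / 3 > 0" using e by simp
  obtain P where P: "real_poly P" "\<And>s. s \<in> {-S..S} \<Longrightarrow> norm (f s - poly P (\<i> * of_real s)) < e / 3"
    using real_poly_approx[OF f e3] sym by metis
  obtain B \<delta> where B: "B > 0" "\<delta> > 0" "\<And>u. norm u \<le> S \<Longrightarrow> norm (poly P u) \<le> B"
    "\<And>u v. norm u \<le> S \<Longrightarrow> norm v \<le> S \<Longrightarrow> norm (u - v) < \<delta> \<Longrightarrow> norm (poly P u - poly P v) < e / 3"
    using poly_uniform[OF e3] by metis
  (* Large enough to move N * z / (N + z) within the modulus of continuity of P around z, and to make the
     factor N / (N + z) - 1 small against the bound B of P. *)
  define N where "N = max (2 * S\<^sup>2 / \<delta>) (3 * S * B / e)"
  have "2 * S\<^sup>2 / \<delta> > 0" using S B by simp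
  then have N0: "N > 0" unfolding N_def by simp
  have N1: "S\<^sup>2 / N < \<delta>"
  proof -
    have "2 * S\<^sup>2 / \<delta> \<le> N" by (simp add: N_def)
    then have "2 * S\<^sup>2 \<le> N * \<delta>" using B by (simp add: field_simps)
    moreover have "S\<^sup>2 > 0" using S by simp
    ultimately have "S\<^sup>2 < N * \<delta>" by linarith
    then show ?thesis using N0 by (simp add: field_simps)
  qed
  have N2: "S / N * B \<le> e / 3"
  proof -
    have "3 * S * B / e \<le> N" by (simp add: N_def)
    then show ?thesis using N0 e by (simp add: field_simps)
  qed
  define R where "R = smult (of_real N) (pcompose P [:of_real N, - of_real (N\<^sup>2):])"
  have Rp: "poly R u = of_real N * poly P (of_real N - of_real (N\<^sup>2) * u)" for u
    by (simp add: R_def poly_pcompose mult.commute)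
  show ?thesis
  proof (rule that[of R N])
    show "real_poly R" using P(1) by (simp add: real_poly_def Rp)
    show "N > 0" by (rule N0)
    fix \<omega> assume \<omega>: "\<bar>\<omega>\<bar> \<le> S"
    let ?z = "\<i> * complex_of_real \<omega>"
    let ?u = "1 / (of_real N + ?z)" let ?m = "of_real N - of_real (N\<^sup>2) * ?u"
    have nz: "of_real N + ?z \<noteq> 0" using N0 by (auto simp: complex_eq_iff)
    have nN: "norm (of_real N + ?z) \<ge> N"
      using complex_Re_le_cmod[of "of_real N + ?z"] by simp
    have zS: "norm ?z \<le> S" using \<omega> by (simp add: norm_mult)
    have m: "?m = of_real N * ?z / (of_real N + ?z)" using nz by (simp add: field_simps power2_eq_square)
    have "norm ?m = N * norm ?z / norm (of_real N + ?z)"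
      unfolding m using N0 by (simp add: norm_mult norm_divide)
    also have "\<dots> \<le> N * norm ?z / N" using nN N0 by (intro divide_left_mono) (auto simp: norm_mult intro!: mult_pos_pos)
    finally have mS: "norm ?m \<le> S" using zS N0 by simp
    have "?m - ?z = - (?z\<^sup>2 / (of_real N + ?z))"
      unfolding m using nz by (simp add: field_simps power2_eq_square)
    then have "norm (?m - ?z) = (norm ?z)\<^sup>2 / norm (of_real N + ?z)"
      by (simp only: norm_minus_cancel norm_divide norm_power)
    also have "\<dots> \<le> S\<^sup>2 / N" using nN N0 zS S by (intro frac_le power_mono) auto
    also have "\<dots> < \<delta>" by (rule N1)
    finally have 2: "norm (poly P ?m - poly P ?z) < e / 3" by (intro B(4) mS zS)
    have "of_real N * ?u - 1 = - (?z / (of_real N + ?z))" using nz by (simp add: field_simps)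
    then have "norm (of_real N * ?u - 1) = norm ?z / norm (of_real N + ?z)"
      by (simp only: norm_minus_cancel norm_divide)
    also have "\<dots> \<le> S / N" using nN N0 zS S by (intro frac_le) auto
    finally have "norm ((of_real N * ?u - 1) * poly P ?m) \<le> S / N * B"
      unfolding norm_mult using S N0 by (intro mult_mono B(3) mS) auto
    then have 3: "norm ((of_real N * ?u - 1) * poly P ?m) \<le> e / 3" using N2 by linarith
    have 1: "norm (f \<omega> - poly P ?z) < e / 3" using P(2)[of \<omega>] \<omega> by (auto simp: abs_le_iff)
    have "f \<omega> - ?u * poly R ?u = (f \<omega> - poly P ?z) - (poly P ?m - poly P ?z) - (of_real N * ?u - 1) * poly P ?m"
      unfolding Rp by (simp add: algebra_simps)
    then have "norm (f \<omega> - ?u * poly R ?u) \<le> norm (f \<omega> - poly P ?z) + norm (poly P ?m - poly P ?z) + norm ((of_real N * ?u - 1) * poly P ?m)"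
      by (simp only:) (intro order_trans[OF norm_triangle_ineq4] add_right_mono norm_triangle_ineq4)
    then show "norm (f \<omega> - ?u * poly R ?u) \<le> e" using 1 2 3 by linarith
  qed
qed

text \<open>For frequencies bounded away from \<open>0\<close> the variable \<open>1 / z\<close> ranges over a segment, infinity
  included, and a strictly proper transfer function is \<open>1 / z\<close> times a continuous function \<open>f\<close> on
  that segment. A polynomial in \<open>1 / z\<close> has its pole at \<open>0\<close>; moving the pole to \<open>- \<mu>\<close> makes it
  stable and changes little for small \<open>\<mu>\<close>. Keeping the factor \<open>1 / z\<close> apart makes the error
  decay like \<open>1 / \<bar>\<omega>\<bar>\<close>, which the estimates in \<open>L\<^sub>2\<close> need on an unbounded band.\<close>

lemma high_band_approx:
  fixes f :: "real \<Rightarrow> complex"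
  assumes f: "continuous_on {-1/S..1/S} f" and sym: "\<And>s. s \<noteq> 0 \<Longrightarrow> f (-s) = cnj (f s)" and e: "e > 0" and S: "S > 0"
  obtains R \<mu> where "real_poly R" "\<mu> > 0"
    "\<And>\<omega>. \<bar>\<omega>\<bar> \<ge> S \<Longrightarrow> norm (f (- 1 / \<omega>) / (\<i> * of_real \<omega>) - exp_poly_transfer R \<mu> (\<i> * of_real \<omega>)) \<le> e / \<bar>\<omega>\<bar>"
proof -
  have e3: "e / 3 > 0" using e by simp
  have f': "continuous_on {- (1/S)..1/S} f" using f by simp
  obtain P where P: "real_poly P" "\<And>s. s \<in> {-(1/S)..1/S} \<Longrightarrow> s \<noteq> 0 \<Longrightarrow> norm (f s - poly P (\<i> * of_real s)) < e / 3"
    using real_poly_approx[OF f' e3] sym by metis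
  obtain B \<delta> where B: "B > 0" "\<delta> > 0" "\<And>u. norm u \<le> 1/S \<Longrightarrow> norm (poly P u) \<le> B"
    "\<And>u v. norm u \<le> 1/S \<Longrightarrow> norm v \<le> 1/S \<Longrightarrow> norm (u - v) < \<delta> \<Longrightarrow> norm (poly P u - poly P v) < e / 3"
    using poly_uniform[OF e3] by metis
  (* Small enough to keep the shifted point within the modulus of continuity of P around 1 / z, and
     the change of the outer factor 1 / z small against the bound B of P. *)
  define \<mu> where "\<mu> = min (\<delta> * S\<^sup>2 / 2) (e * S / (3 * B))"
  have \<mu>0: "\<mu> > 0" unfolding \<mu>_def using B S e by simp
  have \<mu>1: "\<mu> / S / S < \<delta>"
  proof -
    have "\<mu> \<le> \<delta> * S\<^sup>2 / 2" by (simp add: \<mu>_def)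
    moreover have "\<delta> * S\<^sup>2 > 0" using B S by simp
    ultimately have "\<mu> < \<delta> * S\<^sup>2" by linarith
    then show ?thesis using S by (simp add: field_simps power2_eq_square)
  qed
  have \<mu>2: "\<mu> / S * B \<le> e / 3"
  proof -
    have "\<mu> \<le> e * S / (3 * B)" by (simp add: \<mu>_def)
    then show ?thesis using S B by (simp add: field_simps)
  qed
  show ?thesis
  proof (rule that[of P \<mu>, OF P(1) \<mu>0])
    fix \<omega> assume \<omega>: "\<bar>\<omega>\<bar> \<ge> S"
    then have \<omega>0: "\<omega> \<noteq> 0" using S by auto
    let ?z = "\<i> * complex_of_real \<omega>"
    let ?v = "1 / ?z" and ?w = "1 / (of_real \<mu> + ?z)"
    have nz: "of_real \<mu> + ?z \<noteq> 0" using \<mu>0 by (auto simp: complex_eq_iff)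
    have nv: "norm ?v = 1 / \<bar>\<omega>\<bar>" by (simp add: norm_divide norm_mult)
    have vS: "norm ?v \<le> 1 / S" unfolding nv using \<omega> S by (intro divide_left_mono) auto
    have "\<bar>\<omega>\<bar> \<le> norm (of_real \<mu> + ?z)" using abs_Im_le_cmod[of "of_real \<mu> + ?z"] by simp
    then have wv: "norm ?w \<le> norm ?v" unfolding norm_divide using \<omega>0 nz by (auto simp: norm_mult intro!: divide_left_mono mult_pos_pos)
    have "?v - ?w = of_real \<mu> * ?v * ?w" using nz \<omega>0 by (simp add: field_simps)
    then have "norm (?v - ?w) = \<mu> * norm ?v * norm ?w" using \<mu>0 by (simp only: norm_mult norm_of_real)
    also have "\<dots> \<le> \<mu> * norm ?v * (1 / S)" using \<mu>0 wv vS by (intro mult_left_mono) auto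
    finally have vw: "norm (?v - ?w) \<le> norm ?v * (\<mu> / S)" by (simp add: mult_ac)
    also have "\<dots> \<le> 1 / S * (\<mu> / S)" using vS \<mu>0 S by (intro mult_right_mono) auto
    also have "\<dots> < \<delta>" using \<mu>1 by (simp add: mult_ac)
    finally have 2: "norm (poly P ?v - poly P ?w) < e / 3" using wv vS by (intro B(4)) auto
    have "norm ((?v - ?w) * poly P ?w) \<le> norm ?v * (\<mu> / S) * B"
      unfolding norm_mult[of "?v - ?w"] using vw wv vS \<mu>0 S by (intro mult_mono B(3)) auto
    also have "\<dots> \<le> norm ?v * (e / 3)" unfolding mult.assoc by (intro mult_left_mono \<mu>2) auto
    finally have 3: "norm ((?v - ?w) * poly P ?w) \<le> norm ?v * (e / 3)" .
    have v: "?v = \<i> * of_real (- 1 / \<omega>)" using \<omega>0 by (simp add: field_simps)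
    have "- 1 / \<omega> \<in> {- (1/S)..1/S}"
    proof -
      have "\<bar>- 1 / \<omega>\<bar> \<le> 1 / S" using vS unfolding nv by simp
      then have "- 1 / \<omega> \<le> 1 / S" "- (1 / S) \<le> - 1 / \<omega>" by (simp_all only: abs_le_iff minus_le_iff)
      then show ?thesis by simp
    qed
    then have 1: "norm (f (- 1 / \<omega>) - poly P ?v) < e / 3"
      unfolding v using \<omega>0 by (intro P(2)) auto
    have "f (- 1 / \<omega>) / ?z - ?w * poly P ?w
       = ?v * (f (- 1 / \<omega>) - poly P ?v) + ?v * (poly P ?v - poly P ?w) + (?v - ?w) * poly P ?w"
      by (simp add: algebra_simps)
    then have "norm (f (- 1 / \<omega>) / ?z - ?w * poly P ?w)
       \<le> norm (?v * (f (- 1 / \<omega>) - poly P ?v)) + norm (?v * (poly P ?v - poly P ?w)) + norm ((?v - ?w) * poly P ?w)"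
      by (simp only:) (intro order_trans[OF norm_triangle_ineq] add_right_mono norm_triangle_ineq)
    also have "\<dots> \<le> norm ?v * (e / 3) + norm ?v * (e / 3) + norm ?v * (e / 3)"
      using 1 2 3 unfolding norm_mult[of ?v] by (intro add_mono mult_left_mono) auto
    also have "\<dots> = e / \<bar>\<omega>\<bar>" unfolding nv by simp
    finally show "norm (f (- 1 / \<omega>) / ?z - ?w * poly P ?w) \<le> e / \<bar>\<omega>\<bar>" .
  qed
qed

section \<open>Prediction errors of processes in a band\<close>

text \<open>The decay is chosen so that one bound serves every norm in question: it is bounded by \<open>e\<^sup>2\<close>, and
  it is integrable with integral \<open>\<pi> * e\<^sup>2\<close>.\<close>

definition small_on :: "real set \<Rightarrow> real \<Rightarrow> (real \<Rightarrow> complex) \<Rightarrow> bool" where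
  "small_on S e g \<longleftrightarrow> (\<forall>\<omega>\<in>S. (norm (L1_fourier g \<omega>))\<^sup>2 \<le> e\<^sup>2 * (1 / (1 + \<omega>\<^sup>2)))"

text \<open>What remains of the square norm of \<open>L1_fourier g * X\<close> once \<open>g\<close> is small on the band of \<open>X\<close>.\<close>

abbreviation weighted_sq_norm :: "(real \<Rightarrow> complex) \<Rightarrow> ennreal" where
  "weighted_sq_norm X \<equiv> (\<integral>\<^sup>+ \<omega>. ennreal (1 / (1 + \<omega>\<^sup>2)) * (ennreal (norm (X \<omega>)))\<^sup>2 \<partial>lborel)"

lemma inverse_square_le_1: "1 / (1 + \<omega>\<^sup>2) \<le> (1::real)"
  by (simp add: add_pos_nonneg divide_le_eq)

lemma sum_of_squares_pos: "1 + \<omega>\<^sup>2 > (0::real)" by (simp add: add_pos_nonneg)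

lemma small_on_ennrealD:
  assumes "small_on S e g" "\<omega> \<in> S"
  shows "(ennreal (norm (L1_fourier g \<omega>)))\<^sup>2 \<le> ennreal (e\<^sup>2) * ennreal (1 / (1 + \<omega>\<^sup>2))"
proof -
  have "(norm (L1_fourier g \<omega>))\<^sup>2 \<le> e\<^sup>2 * (1 / (1 + \<omega>\<^sup>2))" using assms unfolding small_on_def by blast
  then have "ennreal ((norm (L1_fourier g \<omega>))\<^sup>2) \<le> ennreal (e\<^sup>2 * (1 / (1 + \<omega>\<^sup>2)))" by (rule ennreal_leI)
  also have "\<dots> = ennreal (e\<^sup>2) * ennreal (1 / (1 + \<omega>\<^sup>2))" by (rule ennreal_mult') simp
  finally show ?thesis by (simp add: ennreal_power)
qed

text \<open>In place of Hoelder's inequality, for finite \<open>q = r\<close> with \<open>N = Lnorm q X > 0\<close> the elementary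
  estimate \<open>x\<^sup>2 \<le> N\<^sup>2 + N powr (2 - r) * x powr r\<close> is integrated against the weight, whose mass is
  \<open>\<pi>\<close> and whose values are at most \<open>1\<close>. For this choice of \<open>N\<close> the second term integrates
  to at most \<open>N\<^sup>2\<close> as well.\<close>

lemma weighted_sq_norm_le_Lnorm:
  assumes [measurable]: "X \<in> borel_measurable borel" and q: "q > 2"
  shows "weighted_sq_norm X \<le> ennreal (pi + 1) * (Lnorm q X)\<^sup>2"
proof -
  have pi1: "ennreal pi \<le> ennreal (pi + 1)" by (intro ennreal_leI) simp
  show ?thesis
  proof (cases q)
    case top
    have "Lnorm q X = esssup lborel (\<lambda>t. ennreal (norm (X t)))" using top by (simp add: Lnorm_def)
    moreover have "AE \<omega> in lborel. ennreal (norm (X \<omega>)) \<le> esssup lborel (\<lambda>t. ennreal (norm (X t)))"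
      by (rule esssup_AE)
    ultimately have "weighted_sq_norm X
       \<le> (\<integral>\<^sup>+ \<omega>. ennreal (1 / (1 + \<omega>\<^sup>2)) * (Lnorm q X)\<^sup>2 \<partial>lborel)"
      by (intro nn_integral_mono_AE) (auto elim!: eventually_mono intro!: mult_left_mono power_mono)
    also have "\<dots> = ennreal pi * (Lnorm q X)\<^sup>2"
      by (subst nn_integral_multc) (auto simp: nn_integral_inverse_square)
    also have "\<dots> \<le> ennreal (pi + 1) * (Lnorm q X)\<^sup>2" by (intro mult_right_mono pi1) auto
    finally show ?thesis .
  next
    case (real r)
    have r2: "r > 2"
    proof -
      have "ennreal 2 < ennreal r" using q real by simp
      then show ?thesis using real by (subst (asm) ennreal_less_iff) auto
    qed
    define I where "I = (\<integral>\<^sup>+ t. ennreal (norm (X t) powr r) \<partial>lborel)"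
    have L: "Lnorm q X = (if I = \<infinity> then \<infinity> else ennreal (enn2real I powr (1 / r)))"
      using real by (simp add: Lnorm_def I_def Let_def)
    show ?thesis
    proof (cases I)
      case top
      then have "Lnorm q X = top" using L by simp
      moreover have "ennreal (pi + 1) \<noteq> 0" using pi_gt_zero by (simp add: ennreal_eq_0_iff)
      ultimately show ?thesis by (simp add: power2_eq_square ennreal_mult_top)
    next
      case (real J)
      show ?thesis
      proof (cases "J = 0")
        case True
        then have "I = 0" using real by simp
        then have "AE t in lborel. ennreal (norm (X t) powr r) = 0"
          unfolding I_def by (subst (asm) nn_integral_0_iff_AE) auto
        then have "AE t in lborel. X t = 0" by eventually_elim (auto simp: ennreal_eq_0_iff powr_def split: if_splits)
        then have "weighted_sq_norm X = 0"
          by (subst nn_integral_0_iff_AE) auto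
        then show ?thesis by simp
      next
        case False
        define N where "N = J powr (1 / r)"
        have J: "J > 0" using False real by simp
        have N: "N > 0" and LN: "Lnorm q X = ennreal N" using L real J by (auto simp: N_def)
        have NJ: "N powr r = J" using J r2 by (simp add: N_def powr_powr)
        have pt: "x\<^sup>2 \<le> N\<^sup>2 + N powr (2 - r) * x powr r" if "x \<ge> 0" for x :: real
        proof (cases "x \<le> N")
          case True
          then have "x\<^sup>2 \<le> N\<^sup>2" using that by (intro power_mono)
          then show ?thesis by (simp add: add_increasing2)
        next
          case False
          then have x: "x > 0" using N by simp
          have "x\<^sup>2 = x powr (2 - r) * x powr r"
            using x by (simp add: powr_add[symmetric] flip: powr_numeral)
          also have "\<dots> \<le> N powr (2 - r) * x powr r"
            using False N r2 by (intro mult_right_mono powr_mono2') auto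
          finally show ?thesis by (simp add: add_increasing)
        qed
        have "weighted_sq_norm X
           \<le> (\<integral>\<^sup>+ \<omega>. ennreal (N\<^sup>2) * ennreal (1 / (1 + \<omega>\<^sup>2)) + ennreal (N powr (2 - r)) * ennreal (norm (X \<omega>) powr r) \<partial>lborel)"
        proof (intro nn_integral_mono)
          fix \<omega> :: real
          let ?w = "1 / (1 + \<omega>\<^sup>2)"
          have w: "?w \<ge> 0" "?w \<le> 1" using inverse_square_le_1 by auto
          have "?w * (norm (X \<omega>))\<^sup>2 \<le> ?w * (N\<^sup>2 + N powr (2 - r) * norm (X \<omega>) powr r)"
            using w by (intro mult_left_mono pt) auto
          also have "\<dots> \<le> N\<^sup>2 * ?w + 1 * (N powr (2 - r) * norm (X \<omega>) powr r)"
            unfolding distrib_left using w by (intro add_mono mult_right_mono) auto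
          finally have "ennreal (?w * (norm (X \<omega>))\<^sup>2) \<le> ennreal (N\<^sup>2 * ?w + N powr (2 - r) * norm (X \<omega>) powr r)"
            by (intro ennreal_leI) simp
          also have "\<dots> = ennreal (N\<^sup>2) * ennreal ?w + ennreal (N powr (2 - r)) * ennreal (norm (X \<omega>) powr r)"
            using w by (subst ennreal_plus) (simp, simp, simp only: ennreal_mult'[OF zero_le_power2] ennreal_mult'[OF powr_ge_zero])
          also have "ennreal (?w * (norm (X \<omega>))\<^sup>2) = ennreal ?w * (ennreal (norm (X \<omega>)))\<^sup>2"
            using w by (subst ennreal_mult) (auto simp: ennreal_power)
          finally show "ennreal ?w * (ennreal (norm (X \<omega>)))\<^sup>2
            \<le> ennreal (N\<^sup>2) * ennreal ?w + ennreal (N powr (2 - r)) * ennreal (norm (X \<omega>) powr r)" .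
        qed
        also have "\<dots> = ennreal (N\<^sup>2) * ennreal pi + ennreal (N powr (2 - r)) * I"
          by (simp add: nn_integral_add nn_integral_cmult nn_integral_inverse_square[unfolded inverse_eq_divide] I_def)
        also have "\<dots> = ennreal (N\<^sup>2 * pi + N powr (2 - r) * J)"
          using real J by (subst ennreal_plus) (auto simp: ennreal_mult')
        also have "N powr (2 - r) * J = N\<^sup>2"
          unfolding NJ[symmetric] using N by (simp add: powr_add[symmetric] flip: powr_numeral)
        also have "ennreal (N\<^sup>2 * pi + N\<^sup>2) = ennreal (pi + 1) * (Lnorm q X)\<^sup>2"
          unfolding LN using N by (simp add: ennreal_power algebra_simps flip: ennreal_mult)
        finally show ?thesis .
      qed
    qed
  qed
qed

text \<open>Stated for the representative chosen by \<open>L2_fourier\<close>, to which the norms refer; by the uniqueness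
  of the mean square limit the choice is immaterial.\<close>

definition in_band :: "real set \<Rightarrow> (real \<Rightarrow> complex) \<Rightarrow> bool" where
  "in_band S x \<longleftrightarrow> has_L2_fourier x (L2_fourier x) \<and> (AE \<omega> in lborel. \<omega> \<notin> S \<longrightarrow> L2_fourier x \<omega> = 0)"

lemma in_bandI:
  assumes "has_L2_fourier x X" "AE \<omega> in lborel. \<omega> \<notin> S \<longrightarrow> X \<omega> = 0"
  shows "in_band S x"
proof -
  have 1: "has_L2_fourier x (L2_fourier x)" unfolding L2_fourier_def using assms(1) by (rule someI[of "has_L2_fourier x"])
  show ?thesis unfolding in_band_def
    using 1 has_L2_fourier_unique[OF assms(1) 1] assms(2) by (auto elim: AE_mp)
qed

lemma X_L_in_band: "x \<in> X_L \<Omega> \<Longrightarrow> in_band {\<omega>. \<bar>\<omega>\<bar> \<le> \<Omega>} x"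
  unfolding X_L_def by (auto intro!: in_bandI simp: not_le)

lemma X_H_in_band: "x \<in> X_H \<Omega> \<Longrightarrow> in_band {\<omega>. \<bar>\<omega>\<bar> \<ge> \<Omega>} x"
  unfolding X_H_def by (auto intro!: in_bandI simp: not_le)

lemma norm_conv_in_band_le:
  assumes x: "in_band S x" and g: "tame g" and S[measurable]: "S \<in> sets borel" and small: "small_on S e g" and e: "e \<ge> 0"
  shows "ennreal (norm (conv g x t)) \<le> ennreal e * X_norm x"
proof -
  define X where "X = L2_fourier x"
  have X: "has_L2_fourier x X" and XS: "AE \<omega> in lborel. \<omega> \<notin> S \<longrightarrow> X \<omega> = 0" using x by (auto simp: in_band_def X_def)
  note D = has_L2_fourierD[OF X]
  have [measurable]: "X \<in> borel_measurable borel" "g \<in> borel_measurable borel" using D tame_measurable[OF g] by auto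
  let ?G = "\<lambda>\<omega>. cis (\<omega> * t) * (indicator S \<omega> * L1_fourier g \<omega>)"
  have "conv g x t = 1 / (2 * pi) * (\<integral>\<omega>. ?G \<omega> * X \<omega> \<partial>lborel)"
    unfolding conv_fourier_L2[OF g X]
    by (intro arg_cong2[where f="(*)"] refl integral_cong_AE, measurable, use XS in eventually_elim) (auto simp: indicator_def)
  then have "ennreal (norm (conv g x t)) = ennreal (1 / (2 * pi)) * ennreal (norm (\<integral>\<omega>. ?G \<omega> * X \<omega> \<partial>lborel))"
    by (simp add: norm_mult norm_divide flip: ennreal_mult)
  then have "(ennreal (norm (conv g x t)))\<^sup>2 = (ennreal (1 / (2 * pi)))\<^sup>2 * (ennreal (norm (\<integral>\<omega>. ?G \<omega> * X \<omega> \<partial>lborel)))\<^sup>2"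
    by (simp only: power_mult_distrib)
  also have "\<dots> \<le> (ennreal (1 / (2 * pi)))\<^sup>2 * (sq_norm ?G * sq_norm X)"
    by (rule mult_left_mono[OF norm_integral_mult_square_le zero_le]) measurable
  also have "(ennreal (1 / (2 * pi)))\<^sup>2 * (sq_norm ?G * sq_norm X)
      \<le> (ennreal (1 / (2 * pi)))\<^sup>2 * ((\<integral>\<^sup>+\<omega>. ennreal (e\<^sup>2) * ennreal (1 / (1 + \<omega>\<^sup>2)) \<partial>lborel) * sq_norm X)"
  proof (intro mult_left_mono mult_right_mono nn_integral_mono)
    fix \<omega>
    show "(ennreal (norm (?G \<omega>)))\<^sup>2 \<le> ennreal (e\<^sup>2) * ennreal (1 / (1 + \<omega>\<^sup>2))"
    proof (cases "\<omega> \<in> S")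
      case True
      then show ?thesis using small_on_ennrealD[OF small True] by (simp add: norm_mult)
    qed simp
  qed auto
  also have "(\<integral>\<^sup>+\<omega>. ennreal (e\<^sup>2) * ennreal (1 / (1 + \<omega>\<^sup>2)) \<partial>lborel) = ennreal (e\<^sup>2) * ennreal pi"
    by (subst nn_integral_cmult) (auto simp: nn_integral_inverse_square)
  also have "(ennreal (1 / (2 * pi)))\<^sup>2 * (ennreal (e\<^sup>2) * ennreal pi * sq_norm X) = ennreal ((1 / (2 * pi))\<^sup>2 * pi * e\<^sup>2) * sq_norm X"
    by (simp add: ennreal_power ennreal_mult mult_ac)
  also have "\<dots> \<le> ennreal (1 * e\<^sup>2) * sq_norm X"
  proof -
    have "(1 / (2 * pi))\<^sup>2 * pi \<le> 1" using pi_gt3 by (simp add: power2_eq_square field_simps)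
    then have "(1 / (2 * pi))\<^sup>2 * pi * e\<^sup>2 \<le> 1 * e\<^sup>2" by (intro mult_right_mono) auto
    from mult_right_mono[OF ennreal_leI[OF this]] show ?thesis by simp
  qed
  also have "\<dots> = (ennreal e * X_norm x)\<^sup>2"
    using Lnorm_2_square[of X] e by (simp add: X_norm_def X_def[symmetric] power_mult_distrib ennreal_power)
  finally have "(ennreal (norm (conv g x t)))\<^sup>2 \<le> (ennreal e * X_norm x)\<^sup>2" .
  then show ?thesis by (simp only: ennreal_square_le_iff)
qed

lemma sq_norm_conv_in_band_le:
  assumes x: "in_band S x" and g: "tame g" and small: "small_on S e g" and e: "e \<ge> 0"
  shows "sq_norm (conv g x) \<le> ennreal (e\<^sup>2) * weighted_sq_norm (L2_fourier x)"
proof -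
  define X where "X = L2_fourier x"
  have X: "has_L2_fourier x X" and XS: "AE \<omega> in lborel. \<omega> \<notin> S \<longrightarrow> X \<omega> = 0" using x by (auto simp: in_band_def X_def)
  have [measurable]: "X \<in> borel_measurable borel" using has_L2_fourierD[OF X] by auto
  have "sq_norm (conv g x) \<le> sq_norm (\<lambda>\<omega>. L1_fourier g \<omega> * X \<omega>)" by (rule sq_norm_conv_le[OF g X])
  also have "\<dots> \<le> (\<integral>\<^sup>+ \<omega>. ennreal (e\<^sup>2) * (ennreal (1 / (1 + \<omega>\<^sup>2)) * (ennreal (norm (X \<omega>)))\<^sup>2) \<partial>lborel)"
  proof (rule nn_integral_mono_AE, use XS in eventually_elim)
    case (elim \<omega>)
    show ?case
    proof (cases "\<omega> \<in> S")
      case True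
      show ?thesis
        using mult_right_mono[OF small_on_ennrealD[OF small True], of "(ennreal (norm (X \<omega>)))\<^sup>2"]
        by (simp add: norm_mult ennreal_mult power_mult_distrib mult.assoc)
    qed (use elim in simp)
  qed
  also have "\<dots> = ennreal (e\<^sup>2) * weighted_sq_norm X"
    by (rule nn_integral_cmult) measurable
  finally show ?thesis unfolding X_def .
qed

lemma in_bandD:
  assumes "in_band S x"
  shows "x \<in> borel_measurable borel" "sq_norm x < top" "L2_fourier x \<in> borel_measurable borel" "sq_norm (L2_fourier x) < top"
  using has_L2_fourierD assms unfolding in_band_def by blast+

lemma weighted_sq_norm_le:
  "weighted_sq_norm X \<le> sq_norm X"
proof (intro nn_integral_mono)
  fix \<omega> :: real
  have "ennreal (1 / (1 + \<omega>\<^sup>2)) \<le> 1" using inverse_square_le_1[of \<omega>] by (metis ennreal_1 ennreal_leI)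
  then show "ennreal (1 / (1 + \<omega>\<^sup>2)) * (ennreal (norm (X \<omega>)))\<^sup>2 \<le> (ennreal (norm (X \<omega>)))\<^sup>2"
    using mult_right_mono[of "ennreal (1 / (1 + \<omega>\<^sup>2))" 1] by auto
qed

text \<open>The common property of \<open>L\<^sub>2\<close> functions and of functions with a spectral representation that
  makes convolution linear.\<close>

definition convolvable :: "(real \<Rightarrow> complex) \<Rightarrow> bool" where
  "convolvable x \<longleftrightarrow> x \<in> borel_measurable borel \<and> (\<forall>g t. tame g \<longrightarrow> integrable lborel (\<lambda>s. g (t - s) * x s))"

lemma in_band_convolvable: "in_band S x \<Longrightarrow> convolvable x"
  using in_bandD conv_integrable unfolding convolvable_def by blast

lemma spectral_rep_convolvable: "spectral_rep c w Xc x \<Longrightarrow> convolvable x"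
  using spectral_rep_measurable conv_integrable_spectral tame_integrable unfolding convolvable_def by blast

lemma conv_diff_kernel:
  assumes "convolvable x" "tame g" "tame h"
  shows "conv (\<lambda>t. g t - h t) x t = conv g x t - conv h x t"
  using assms unfolding convolvable_def conv_def by (simp add: left_diff_distrib)

lemma conv_add:
  assumes "convolvable x" "convolvable y" "tame g"
  shows "conv g (\<lambda>s. x s + y s) t = conv g x t + conv g y t"
  using assms unfolding convolvable_def conv_def by (simp add: distrib_left)

lemma causal_conv_eq:
  assumes "\<And>t. t < 0 \<Longrightarrow> \<kappa> t = 0"
  shows "causal_conv \<kappa> x t = conv (\<lambda>t. of_real (\<kappa> t)) x t"
    and "causal_conv_exists \<kappa> x \<longleftrightarrow> (\<forall>t. integrable lborel (\<lambda>s. of_real (\<kappa> (t - s)) * x s))"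
proof -
  have "(\<lambda>s. indicator {..t} s *\<^sub>R (of_real (\<kappa> (t - s)) * x s)) = (\<lambda>s. of_real (\<kappa> (t - s)) * x s)" for t
    by (auto simp: indicator_def assms fun_eq_iff)
  then show "causal_conv \<kappa> x t = conv (\<lambda>t. of_real (\<kappa> t)) x t"
    and "causal_conv_exists \<kappa> x \<longleftrightarrow> (\<forall>t. integrable lborel (\<lambda>s. of_real (\<kappa> (t - s)) * x s))"
    by (simp_all add: causal_conv_def causal_conv_exists_def conv_def set_lebesgue_integral_def set_integrable_def)
qed

text \<open>The integral over \<open>s \<ge> t\<close> is an integral over the whole line because the kernel vanishes on the
  positive half-line, and there a kernel matters only up to null sets.\<close>

lemma anticausal_conv_eq:
  assumes k: "\<And>t. t > 0 \<Longrightarrow> k t = 0" and [measurable]: "(\<lambda>t. complex_of_real (k t)) \<in> borel_measurable borel"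
    "k0 \<in> borel_measurable borel" "x \<in> borel_measurable borel"
    and eq: "AE t in lborel. of_real (k t) = k0 t"
  shows "anticausal_conv k x t = conv k0 x t"
proof -
  have "(\<lambda>s. indicator {t..} s *\<^sub>R (of_real (k (t - s)) * x s)) = (\<lambda>s. of_real (k (t - s)) * x s)"
    by (auto simp: indicator_def k fun_eq_iff)
  then have "anticausal_conv k x t = (\<integral>s. of_real (k (t - s)) * x s \<partial>lborel)"
    by (simp add: anticausal_conv_def set_lebesgue_integral_def)
  also have "\<dots> = (\<integral>s. k0 (t - s) * x s \<partial>lborel)"
  proof (rule integral_cong_AE)
    have [measurable]: "(\<lambda>s. complex_of_real (k (t - s))) \<in> borel_measurable borel"
      using measurable_compose[of "\<lambda>s. t - s" borel borel, OF _ assms(2)] by simp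
    show "(\<lambda>s. of_real (k (t - s)) * x s) \<in> borel_measurable lborel" by measurable
    have "Measurable.pred borel (\<lambda>t. complex_of_real (k t) = k0 t)" by measurable
    then have "AE s in lborel. of_real (k (t + (-1) * s)) = k0 (t + (-1) * s)"
      using eq by (intro AE_borel_affine) auto
    then show "AE s in lborel. of_real (k (t - s)) * x s = k0 (t - s) * x s" by (auto elim: eventually_mono)
  qed measurable
  finally show ?thesis unfolding conv_def .
qed

text \<open>Membership in \<open>causal_kernels\<close> alone does not make a kernel integrable; tameness is what lets it
  be convolved with a merely bounded process.\<close>

definition approximates :: "real set \<Rightarrow> real \<Rightarrow> (real \<Rightarrow> complex) \<Rightarrow> (real \<Rightarrow> real) \<Rightarrow> bool" where
  "approximates S e g \<kappa> \<longleftrightarrow> \<kappa> \<in> causal_kernels \<and> tame (\<lambda>t. of_real (\<kappa> t)) \<and>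
     small_on S e (\<lambda>t. g t - of_real (\<kappa> t))"

lemma approximatesD:
  assumes "approximates S e g \<kappa>"
  shows "\<kappa> \<in> causal_kernels" "tame (\<lambda>t. of_real (\<kappa> t))" "small_on S e (\<lambda>t. g t - of_real (\<kappa> t))"
  using assms by (auto simp: approximates_def)

lemma exp_poly_kernel_approximates:
  assumes k0: "tame k0" and R: "real_poly R" "\<mu> > 0" and e: "e > 0"
    and le: "\<And>\<omega>. \<omega> \<in> S \<Longrightarrow> norm (L1_fourier k0 \<omega> - exp_poly_transfer R \<mu> (\<i> * of_real \<omega>)) \<le> e / sqrt (1 + \<omega>\<^sup>2)"
  shows "approximates S e k0 (exp_poly_kernel R \<mu>)"
  unfolding approximates_def
proof (intro conjI)
  show t: "tame (\<lambda>t. of_real (exp_poly_kernel R \<mu> t))" by (rule exp_poly_kernel_tame[OF R])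
  show "exp_poly_kernel R \<mu> \<in> causal_kernels" by (rule exp_poly_kernel_in_causal_kernels[OF R])
  show "small_on S e (\<lambda>t. k0 t - of_real (exp_poly_kernel R \<mu> t))"
    unfolding small_on_def
  proof
    fix \<omega> assume "\<omega> \<in> S"
    from le[OF this] have "norm (L1_fourier (\<lambda>t. k0 t - of_real (exp_poly_kernel R \<mu> t)) \<omega>) \<le> e / sqrt (1 + \<omega>\<^sup>2)"
      by (simp add: L1_fourier_diff[OF tame_integrable[OF k0] tame_integrable[OF t]] L1_fourier_exp_poly_kernel[OF R])
    then have "(norm (L1_fourier (\<lambda>t. k0 t - of_real (exp_poly_kernel R \<mu> t)) \<omega>))\<^sup>2 \<le> (e / sqrt (1 + \<omega>\<^sup>2))\<^sup>2"
      by (intro power_mono) auto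
    also have "\<dots> = e\<^sup>2 * (1 / (1 + \<omega>\<^sup>2))" using sum_of_squares_pos[of \<omega>] by (simp add: power_divide)
    finally show "(norm (L1_fourier (\<lambda>t. k0 t - of_real (exp_poly_kernel R \<mu> t)) \<omega>))\<^sup>2 \<le> e\<^sup>2 * (1 / (1 + \<omega>\<^sup>2))" .
  qed
qed

lemma approximable_low:
  assumes k0: "tame k0" and sym: "\<And>\<omega>. L1_fourier k0 (- \<omega>) = cnj (L1_fourier k0 \<omega>)" and S: "S > 0" and e: "e > 0"
  shows "\<exists>\<kappa>. approximates {\<omega>. \<bar>\<omega>\<bar> \<le> S} e k0 \<kappa>"
proof -
  have s0: "sqrt (1 + S\<^sup>2) > 0" using sum_of_squares_pos[of S] by simp
  have e': "e / sqrt (1 + S\<^sup>2) > 0" using e s0 by simp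
  have "continuous_on {-S..S} (L1_fourier k0)"
    using continuous_L1_fourier[OF tame_integrable[OF k0]] by (rule continuous_on_subset) simp
  from low_band_approx[OF this sym e' S] obtain R \<mu> where R: "real_poly R" "\<mu> > 0"
    and le: "\<And>\<omega>. \<bar>\<omega>\<bar> \<le> S \<Longrightarrow> norm (L1_fourier k0 \<omega> - exp_poly_transfer R \<mu> (\<i> * of_real \<omega>)) \<le> e / sqrt (1 + S\<^sup>2)"
    by metis
  show ?thesis
  proof (rule exI, rule exp_poly_kernel_approximates[OF k0 R e])
    fix \<omega> assume "\<omega> \<in> {\<omega>. \<bar>\<omega>\<bar> \<le> S}"
    then have \<omega>: "\<bar>\<omega>\<bar> \<le> S" by simp
    then have "\<omega>\<^sup>2 \<le> S\<^sup>2" by (metis abs_ge_zero power2_abs power_mono)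
    then have "e / sqrt (1 + S\<^sup>2) \<le> e / sqrt (1 + \<omega>\<^sup>2)"
      using e sum_of_squares_pos[of \<omega>] s0 by (intro divide_left_mono mult_pos_pos) auto
    then show "norm (L1_fourier k0 \<omega> - exp_poly_transfer R \<mu> (\<i> * of_real \<omega>)) \<le> e / sqrt (1 + \<omega>\<^sup>2)"
      using le[OF \<omega>] by linarith
  qed
qed

text \<open>Reversing the polynomials \<open>d\<close> and \<open>\<delta>\<close> exhibits \<open>z * poly d z / poly \<delta> z\<close> as a
  rational function of \<open>v = 1 / z\<close> that is continuous also at \<open>v = 0\<close>, where the reversed
  denominator takes the leading coefficient of \<open>\<delta>\<close> as its value.\<close>

lemma approximable_high:
  fixes d \<delta> :: "complex poly"
  assumes k0: "tame k0" and sym: "\<And>\<omega>. L1_fourier k0 (- \<omega>) = cnj (L1_fourier k0 \<omega>)" and S: "S > 0"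
    and deg: "degree d < degree \<delta>" and roots: "\<And>p. poly \<delta> p = 0 \<Longrightarrow> Re p > 0"
    and k0f: "\<And>\<omega>. L1_fourier k0 \<omega> = poly d (\<i> * of_real \<omega>) / poly \<delta> (\<i> * of_real \<omega>)"
    and e: "e > 0"
  shows "\<exists>\<kappa>. approximates {\<omega>. \<bar>\<omega>\<bar> \<ge> S} e k0 \<kappa>"
proof -
  have \<delta>0: "\<delta> \<noteq> 0" using deg by auto
  (* The monomial compensates the difference of degrees, so that D v = v ^ (degree delta - 1) * d (1 / v). *)
  define D where "D = monom 1 (degree \<delta> - 1 - degree d) * reflect_poly d"
  define E where "E = reflect_poly \<delta>"
  define f where "f s = poly D (\<i> * of_real s) / poly E (\<i> * of_real s)" for s :: real
  have nz: "poly \<delta> (\<i> * of_real \<omega>) \<noteq> 0" for \<omega> using roots[of "\<i> * of_real \<omega>"] by auto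
  have inv: "inverse (\<i> * complex_of_real s) = \<i> * of_real (- 1 / s)" if "s \<noteq> 0" for s
    using that by (simp add: field_simps)
  have E: "poly E (\<i> * of_real s) \<noteq> 0" for s
  proof (cases "s = 0")
    case False
    then have "poly E (\<i> * of_real s) = (\<i> * of_real s) ^ degree \<delta> * poly \<delta> (\<i> * of_real (- 1 / s))"
      unfolding E_def inv[OF False, symmetric] by (intro poly_reflect_poly_nz) simp
    then show ?thesis using nz[of "-1/s"] False by simp
  qed (simp add: E_def \<delta>0)
  have fK: "f s = (\<i> * of_real (- 1 / s)) * L1_fourier k0 (- 1 / s)" if s: "s \<noteq> 0" for s
  proof -
    let ?v = "\<i> * complex_of_real s"
    have v: "?v \<noteq> 0" using s by simp
    have "poly D ?v = ?v ^ (degree \<delta> - 1 - degree d) * (?v ^ degree d * poly d (\<i> * of_real (- 1 / s)))"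
      unfolding D_def inv[OF s, symmetric] by (simp only: poly_mult poly_monom poly_reflect_poly_nz[OF v] mult_1)
    also have "\<dots> = ?v ^ (degree \<delta> - 1) * poly d (\<i> * of_real (- 1 / s))"
      using deg by (simp only: mult.assoc[symmetric] power_add[symmetric]) simp
    finally have D: "poly D ?v = ?v ^ (degree \<delta> - 1) * poly d (\<i> * of_real (- 1 / s))" .
    have "poly E ?v = ?v ^ degree \<delta> * poly \<delta> (\<i> * of_real (- 1 / s))"
      unfolding E_def inv[OF s, symmetric] by (rule poly_reflect_poly_nz[OF v])
    also have "?v ^ degree \<delta> = ?v ^ (degree \<delta> - 1) * ?v" using deg by (cases "degree \<delta>") auto
    finally have E': "poly E ?v = ?v ^ (degree \<delta> - 1) * (?v * poly \<delta> (\<i> * of_real (- 1 / s)))" by (simp only: mult.assoc)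
    have c: "(a * x) / (a * (b * y)) = inverse b * (x / y)" if "a \<noteq> 0" for a x b y :: complex
      using that by (simp add: field_simps)
    have "?v ^ (degree \<delta> - 1) \<noteq> 0" using v by simp
    then show ?thesis unfolding f_def D E' k0f inv[OF s, symmetric] by (rule c)
  qed
  have fsym: "f (- s) = cnj (f s)" if "s \<noteq> 0" for s
    using fK[OF that] fK[of "- s"] that sym[of "- 1 / s"] by simp
  have fc: "continuous_on {-1/S..1/S} f" unfolding f_def using E by (intro continuous_intros) auto
  (* The constant that converts the decay 1 / |omega| on the band into 1 / sqrt (1 + omega^2). *)
  define C where "C = sqrt (1 + 1 / S\<^sup>2)"
  have C: "C > 0" unfolding C_def using S by (simp add: add_pos_nonneg)
  have "e / C > 0" using e C by simp
  from high_band_approx[OF fc fsym this S] obtain R \<mu> where R: "real_poly R" "\<mu> > 0"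
    and le: "\<And>\<omega>. \<bar>\<omega>\<bar> \<ge> S \<Longrightarrow> norm (f (- 1 / \<omega>) / (\<i> * of_real \<omega>) - exp_poly_transfer R \<mu> (\<i> * of_real \<omega>)) \<le> e / C / \<bar>\<omega>\<bar>"
    by metis
  show ?thesis
  proof (rule exI, rule exp_poly_kernel_approximates[OF k0 R e])
    fix \<omega> assume "\<omega> \<in> {\<omega>. \<bar>\<omega>\<bar> \<ge> S}"
    then have \<omega>: "\<bar>\<omega>\<bar> \<ge> S" by simp
    then have \<omega>0: "\<omega> \<noteq> 0" using S by auto
    have "f (- 1 / \<omega>) / (\<i> * of_real \<omega>) = L1_fourier k0 \<omega>"
      using fK[of "- 1 / \<omega>"] \<omega>0 by simp
    then have "norm (L1_fourier k0 \<omega> - exp_poly_transfer R \<mu> (\<i> * of_real \<omega>)) \<le> e / C / \<bar>\<omega>\<bar>"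
      using le[OF \<omega>] by simp
    also have "\<dots> \<le> e / sqrt (1 + \<omega>\<^sup>2)"
    proof -
      have "S\<^sup>2 \<le> \<omega>\<^sup>2" using \<omega> S by (metis less_imp_le power2_abs power_mono)
      then have "1 \<le> \<omega>\<^sup>2 / S\<^sup>2" using S by simp
      then have "1 + \<omega>\<^sup>2 \<le> (1 + 1 / S\<^sup>2) * \<omega>\<^sup>2" by (simp add: distrib_right)
      then have "sqrt (1 + \<omega>\<^sup>2) \<le> C * \<bar>\<omega>\<bar>"
        unfolding C_def by (metis real_sqrt_abs real_sqrt_le_mono real_sqrt_mult)
      then have "e / (C * \<bar>\<omega>\<bar>) \<le> e / sqrt (1 + \<omega>\<^sup>2)"
        using e C \<omega>0 sum_of_squares_pos[of \<omega>] by (intro divide_left_mono mult_pos_pos) auto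
      then show ?thesis by simp
    qed
    finally show "norm (L1_fourier k0 \<omega> - exp_poly_transfer R \<mu> (\<i> * of_real \<omega>)) \<le> e / sqrt (1 + \<omega>\<^sup>2)" .
  qed
qed

text \<open>What the uniform estimate needs from a class of processes, whether it is measured by the \<open>L\<^sub>2\<close>
  norm or by the norm of the spectral functional.\<close>

definition controlled_on :: "real set \<Rightarrow> (real \<Rightarrow> complex) set \<Rightarrow> ((real \<Rightarrow> complex) \<Rightarrow> ennreal) \<Rightarrow> bool" where
  "controlled_on S A nrm \<longleftrightarrow> (\<forall>x\<in>A. convolvable x \<and>
     (\<forall>g e t. tame g \<longrightarrow> e > 0 \<longrightarrow> small_on S e g \<longrightarrow> ennreal (norm (conv g x t)) \<le> ennreal e * nrm x))"

lemma in_band_controlled: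
  assumes "S \<in> sets borel" "\<And>x. x \<in> A \<Longrightarrow> in_band S x"
  shows "controlled_on S A X_norm"
  unfolding controlled_on_def
proof (intro ballI conjI allI impI)
  fix x assume "x \<in> A"
  then have x: "in_band S x" by (rule assms)
  then show "convolvable x" by (rule in_band_convolvable)
  fix g e t assume "tame g" "e > 0" "small_on S e g"
  then show "ennreal (norm (conv g x t)) \<le> ennreal e * X_norm x"
    by (intro norm_conv_in_band_le[OF x _ assms(1)]) auto
qed

lemma spectral_controlled:
  assumes rep: "\<And>x. x \<in> A \<Longrightarrow> \<exists>c w Xc. spectral_rep c w Xc x \<and> (\<forall>k. w k \<in> T) \<and> (AE \<omega> in lborel. \<omega> \<notin> T \<longrightarrow> Xc \<omega> = 0)"
    and TS: "T \<subseteq> S"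
  shows "controlled_on S A M_norm"
  unfolding controlled_on_def
proof (intro ballI conjI allI impI)
  fix x assume "x \<in> A"
  then obtain c w Xc where x: "spectral_rep c w Xc x" "\<And>k. w k \<in> T" "AE \<omega> in lborel. \<omega> \<notin> T \<longrightarrow> Xc \<omega> = 0"
    using rep by blast
  show "convolvable x" by (rule spectral_rep_convolvable[OF x(1)])
  fix g e t assume g: "tame g" "e > 0" "small_on S e g"
  have "norm (L1_fourier g \<omega>) \<le> e" if "\<omega> \<in> T" for \<omega>
  proof -
    have "(norm (L1_fourier g \<omega>))\<^sup>2 \<le> e\<^sup>2 * (1 / (1 + \<omega>\<^sup>2))" using g that TS by (auto simp: small_on_def)
    also have "\<dots> \<le> e\<^sup>2 * 1" by (intro mult_left_mono inverse_square_le_1) auto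
    finally show ?thesis using g by (simp add: power2_le_iff_abs_le)
  qed
  then have "norm (conv g x t) \<le> e * norm (M_fourier x)"
    by (intro norm_conv_spectral_le[OF x(1) tame_integrable[OF g(1)] x(2,3) g(2)]) auto
  then have "ennreal (norm (conv g x t)) \<le> ennreal (e * norm (M_fourier x))" by (rule ennreal_leI)
  then show "ennreal (norm (conv g x t)) \<le> ennreal e * M_norm x"
    using g by (simp add: M_norm_def ennreal_mult)
qed

lemma M_L_controlled:
  assumes "\<epsilon> > 0" shows "controlled_on {\<omega>. \<bar>\<omega>\<bar> \<le> \<Omega>} (M_L \<Omega> \<epsilon>) M_norm"
proof (rule spectral_controlled[of _ "{- \<Omega> + \<epsilon>..\<Omega> - \<epsilon>}"])
  have "\<bar>u\<bar> \<le> \<Omega> - \<epsilon> \<longleftrightarrow> u \<in> {- \<Omega> + \<epsilon>..\<Omega> - \<epsilon>}" for u by auto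
  then show "\<exists>c w Xc. spectral_rep c w Xc x \<and> (\<forall>k. w k \<in> {- \<Omega> + \<epsilon>..\<Omega> - \<epsilon>}) \<and>
      (AE \<omega> in lborel. \<omega> \<notin> {- \<Omega> + \<epsilon>..\<Omega> - \<epsilon>} \<longrightarrow> Xc \<omega> = 0)" if "x \<in> M_L \<Omega> \<epsilon>" for x
    using that by (simp only: M_L_def mem_Collect_eq)
qed (use assms in auto)

lemma M_H_controlled:
  assumes "\<epsilon> > 0" "\<Omega> > 0" shows "controlled_on {\<omega>. \<bar>\<omega>\<bar> \<ge> \<Omega>} (M_H \<Omega> \<epsilon>) M_norm"
proof (rule spectral_controlled[of _ "{..- \<Omega> - \<epsilon>} \<union> {\<Omega> + \<epsilon>..}"])
  have "\<bar>u\<bar> \<ge> \<Omega> + \<epsilon> \<longleftrightarrow> u \<in> {..- \<Omega> - \<epsilon>} \<union> {\<Omega> + \<epsilon>..}" for u using assms by auto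
  then show "\<exists>c w Xc. spectral_rep c w Xc x \<and> (\<forall>k. w k \<in> {..- \<Omega> - \<epsilon>} \<union> {\<Omega> + \<epsilon>..}) \<and>
      (AE \<omega> in lborel. \<omega> \<notin> {..- \<Omega> - \<epsilon>} \<union> {\<Omega> + \<epsilon>..} \<longrightarrow> Xc \<omega> = 0)" if "x \<in> M_H \<Omega> \<epsilon>" for x
    using that by (simp only: M_H_def mem_Collect_eq)
qed (use assms in auto)

lemma causal_conv_existsI:
  assumes "approximates S e g \<kappa>" "convolvable x"
  shows "causal_conv_exists \<kappa> x"
proof -
  have 0: "\<kappa> t = 0" if "t < 0" for t using approximatesD(1)[OF assms(1)] that by (simp add: causal_kernels_def)
  show ?thesis
    using approximatesD(2)[OF assms(1)] assms(2) by (subst causal_conv_eq(2)) (auto simp: 0 convolvable_def)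
qed

theorem corollary1:
  fixes \<Omega> \<epsilon> :: real
    and k :: "real \<Rightarrow> real"
    and A B :: "(real \<Rightarrow> complex) set"
    and normA normB :: "(real \<Rightarrow> complex) \<Rightarrow> ennreal"
  assumes "\<Omega> > 0" and "\<epsilon> \<in> {0<..<\<Omega>}"
    and "(A, normA) \<in> {(X_L \<Omega>, X_norm), (M_L \<Omega> \<epsilon>, M_norm)}"
    and "(B, normB) \<in> {(X_H \<Omega>, X_norm), (M_H \<Omega> \<epsilon>, M_norm)}"
    and "k \<in> anticausal_kernels \<Omega>"
  shows
    "(\<forall>\<eta>>0. \<exists>kL\<in>causal_kernels. \<exists>kH\<in>causal_kernels. \<forall>xL\<in>A. \<forall>xH\<in>B.
        causal_conv_exists kL xL \<and> causal_conv_exists kH xH \<and>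
        Lnorm \<infinity> (\<lambda>t. anticausal_conv k (\<lambda>s. xL s + xH s) t
                       - (causal_conv kL xL t + causal_conv kH xH t))
          \<le> ennreal \<eta> * (normA xL + normB xH))
     \<and>
     (\<exists>kL kH :: nat \<Rightarrow> real \<Rightarrow> real.
        (\<forall>m. kL m \<in> causal_kernels \<and> kH m \<in> causal_kernels) \<and>
        (\<forall>xL\<in>X_L \<Omega>. \<forall>xH\<in>X_H \<Omega>.
           (\<lambda>m. Lnorm 2 (\<lambda>t. anticausal_conv k (\<lambda>s. xL s + xH s) t
                       - (causal_conv (kL m) xL t + causal_conv (kH m) xH t)))
             \<longlonglongrightarrow> 0))
     \<and>
     (\<forall>q::ennreal. q > 2 \<longrightarrow> (\<forall>\<eta>>0. \<exists>kL\<in>causal_kernels. \<exists>kH\<in>causal_kernels.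
        \<forall>xL\<in>X_L \<Omega>. \<forall>xH\<in>X_H \<Omega>.
          Lnorm 2 (\<lambda>t. anticausal_conv k (\<lambda>s. xL s + xH s) t
                       - (causal_conv kL xL t + causal_conv kH xH t))
            \<le> ennreal \<eta> * (Lnorm q (L2_fourier xL) + Lnorm q (L2_fourier xH))))"
proof -
  let ?L = "{\<omega>. \<bar>\<omega>\<bar> \<le> \<Omega>}" and ?H = "{\<omega>. \<bar>\<omega>\<bar> \<ge> \<Omega>}"
  let ?err = "\<lambda>kL kH xL xH t. anticausal_conv k (\<lambda>s. xL s + xH s) t - (causal_conv kL xL t + causal_conv kH xH t)"
  obtain k0 d \<delta> where k0: "tame k0" and kk0: "AE t in lborel. of_real (k t) = k0 t" and deg: "degree d < degree \<delta>"
    and roots: "\<And>p. poly \<delta> p = 0 \<Longrightarrow> Re p > 0"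
    and k0f: "\<And>\<omega>. L1_fourier k0 \<omega> = poly d (\<i> * of_real \<omega>) / poly \<delta> (\<i> * of_real \<omega>)"
    and km: "(\<lambda>t. complex_of_real (k t)) \<in> borel_measurable borel"
    using anticausal_kernel_tame[OF assms(5)] by metis
  have k_pos: "k t = 0" if "t > 0" for t using assms(5) that by (simp add: anticausal_kernels_def)
  have k0m[measurable]: "k0 \<in> borel_measurable borel" by (rule tame_measurable[OF k0])
  (* Since k is real. This is what allows approximating kernels to be real. *)
  have sym: "L1_fourier k0 (- \<omega>) = cnj (L1_fourier k0 \<omega>)" for \<omega>
  proof -
    have "cnj (L1_fourier k0 \<omega>) = (\<integral>t. cnj (cis (- (\<omega> * t)) * k0 t) \<partial>lborel)"
      unfolding L1_fourier_cis by (rule Bochner_Integration.integral_cnj[symmetric])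
    also have "\<dots> = L1_fourier k0 (- \<omega>)"
      unfolding L1_fourier_cis
    proof (rule integral_cong_AE)
      show "AE t in lborel. cnj (cis (- (\<omega> * t)) * k0 t) = cis (- (- \<omega> * t)) * k0 t"
        using kk0
      proof eventually_elim
        case (elim t)
        show ?case unfolding elim[symmetric] by (simp add: cis_cnj)
      qed
    qed measurable
    finally show ?thesis by simp
  qed
  have ex: "\<exists>kL kH. approximates ?L e k0 kL \<and> approximates ?H e k0 kH" if "e > 0" for e
    using approximable_low[OF k0 sym assms(1) that] approximable_high[OF k0 sym assms(1) deg roots k0f that] by blast
  (* The splitting of the error into one convolution per band. *)
  have err: "?err kL kH xL xH = (\<lambda>t. conv (\<lambda>t. k0 t - of_real (kL t)) xL t + conv (\<lambda>t. k0 t - of_real (kH t)) xH t)"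
    if "approximates ?L e k0 kL" "approximates ?H e k0 kH" "convolvable xL" "convolvable xH" for e kL kH xL xH
  proof
    fix t
    note kL = approximatesD[OF that(1)] and kH = approximatesD[OF that(2)]
    have xm: "(\<lambda>s. xL s + xH s) \<in> borel_measurable borel" using that by (auto simp: convolvable_def)
    have L0: "kL t = 0" and H0: "kH t = 0" if "t < 0" for t
      using that kL(1) kH(1) by (auto simp: causal_kernels_def)
    have 1: "causal_conv kL xL t = conv (\<lambda>t. of_real (kL t)) xL t" by (rule causal_conv_eq(1)) (rule L0)
    have 2: "causal_conv kH xH t = conv (\<lambda>t. of_real (kH t)) xH t" by (rule causal_conv_eq(1)) (rule H0)
    have 3: "anticausal_conv k (\<lambda>s. xL s + xH s) t = conv k0 (\<lambda>s. xL s + xH s) t"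
      by (rule anticausal_conv_eq[OF _ km k0m xm kk0]) (rule k_pos)
    show "?err kL kH xL xH t = conv (\<lambda>t. k0 t - of_real (kL t)) xL t + conv (\<lambda>t. k0 t - of_real (kH t)) xH t"
      unfolding 1 2 3 conv_diff_kernel[OF that(3) k0 kL(2)] conv_diff_kernel[OF that(4) k0 kH(2)] conv_add[OF that(3,4) k0]
      by simp
  qed
  have meas: "conv (\<lambda>t. k0 t - of_real (\<kappa> t)) x \<in> borel_measurable borel"
    if "approximates S e k0 \<kappa>" "convolvable x" for S e \<kappa> x
    using tame_measurable[OF tame_diff[OF k0 approximatesD(2)[OF that(1)]]] that(2)
    by (intro conv_measurable) (auto simp: convolvable_def)
  have Lb[measurable]: "?L \<in> sets borel" and Hb[measurable]: "?H \<in> sets borel" by measurable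
  have cA: "controlled_on ?L A normA"
    using assms(2,3) in_band_controlled[OF Lb X_L_in_band] M_L_controlled[of \<epsilon> \<Omega>] by auto
  have cB: "controlled_on ?H B normB"
    using assms(1,2,4) in_band_controlled[OF Hb X_H_in_band] M_H_controlled[of \<epsilon> \<Omega>] by auto
  have sq: "(Lnorm 2 (?err kL kH xL xH))\<^sup>2
      \<le> ennreal (2 * e\<^sup>2) * (weighted_sq_norm (L2_fourier xL) + weighted_sq_norm (L2_fourier xH))"
    if aL: "approximates ?L e k0 kL" and aH: "approximates ?H e k0 kH"
      and e: "e > 0" and xL: "xL \<in> X_L \<Omega>" and xH: "xH \<in> X_H \<Omega>" for kL kH xL xH e
  proof -
    note kL = approximatesD[OF aL] and kH = approximatesD[OF aH]
    note bL = X_L_in_band[OF xL] and bH = X_H_in_band[OF xH]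
    note cL = in_band_convolvable[OF bL] and cH = in_band_convolvable[OF bH]
    let ?gL = "conv (\<lambda>t. k0 t - of_real (kL t)) xL" and ?gH = "conv (\<lambda>t. k0 t - of_real (kH t)) xH"
    have m: "?gL \<in> borel_measurable borel" "?gH \<in> borel_measurable borel"
      by (rule meas[OF aL cL], rule meas[OF aH cH])
    have "(Lnorm 2 (?err kL kH xL xH))\<^sup>2 = sq_norm (\<lambda>t. ?gL t + ?gH t)"
      unfolding err[OF aL aH cL cH] using m by (intro Lnorm_2_square) auto
    also have "\<dots> \<le> 2 * sq_norm ?gL + 2 * sq_norm ?gH" using m by (intro sq_norm_add_le) auto
    also have "\<dots> \<le> 2 * (ennreal (e\<^sup>2) * weighted_sq_norm (L2_fourier xL)) + 2 * (ennreal (e\<^sup>2) * weighted_sq_norm (L2_fourier xH))"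
      using e by (intro add_mono mult_left_mono sq_norm_conv_in_band_le[OF bL tame_diff[OF k0 kL(2)] kL(3)]
          sq_norm_conv_in_band_le[OF bH tame_diff[OF k0 kH(2)] kH(3)]) auto
    also have "\<dots> = ennreal (2 * e\<^sup>2) * (weighted_sq_norm (L2_fourier xL) + weighted_sq_norm (L2_fourier xH))"
      by (simp add: ennreal_mult distrib_left mult.assoc)
    finally show ?thesis .
  qed
  show ?thesis
  proof (intro conjI allI impI)
    fix \<eta> :: real assume \<eta>: "\<eta> > 0"
    obtain kL kH where aL: "approximates ?L \<eta> k0 kL" and aH: "approximates ?H \<eta> k0 kH"
      using ex[OF \<eta>] by blast
    note kL = approximatesD[OF aL] and kH = approximatesD[OF aH]
    show "\<exists>kL\<in>causal_kernels. \<exists>kH\<in>causal_kernels. \<forall>xL\<in>A. \<forall>xH\<in>B.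
      causal_conv_exists kL xL \<and> causal_conv_exists kH xH \<and>
      Lnorm \<infinity> (?err kL kH xL xH) \<le> ennreal \<eta> * (normA xL + normB xH)"
    proof (rule bexI[OF _ kL(1)], rule bexI[OF _ kH(1)], intro ballI conjI)
      fix xL xH assume xL: "xL \<in> A" and xH: "xH \<in> B"
      have cL: "convolvable xL" and cH: "convolvable xH" using cA cB xL xH by (auto simp: controlled_on_def)
      show "causal_conv_exists kL xL" "causal_conv_exists kH xH"
        by (rule causal_conv_existsI[OF aL cL], rule causal_conv_existsI[OF aH cH])
      let ?gL = "conv (\<lambda>t. k0 t - of_real (kL t)) xL" and ?gH = "conv (\<lambda>t. k0 t - of_real (kH t)) xH"
      have Dm: "(\<lambda>t. ?gL t + ?gH t) \<in> borel_measurable borel"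
        using meas[OF aL cL] meas[OF aH cH] by auto
      have "ennreal (norm (?gL t + ?gH t)) \<le> ennreal \<eta> * (normA xL + normB xH)" for t
      proof -
        have "ennreal (norm (?gL t + ?gH t)) \<le> ennreal (norm (?gL t)) + ennreal (norm (?gH t))"
          by (simp add: norm_triangle_ineq flip: ennreal_plus)
        also have "\<dots> \<le> ennreal \<eta> * normA xL + ennreal \<eta> * normB xH"
        proof (rule add_mono)
          show "ennreal (norm (?gL t)) \<le> ennreal \<eta> * normA xL"
            using cA xL tame_diff[OF k0 kL(2)] \<eta> kL(3) unfolding controlled_on_def by blast
          show "ennreal (norm (?gH t)) \<le> ennreal \<eta> * normB xH"
            using cB xH tame_diff[OF k0 kH(2)] \<eta> kH(3) unfolding controlled_on_def by blast
        qed
        finally show ?thesis by (simp add: distrib_left)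
      qed
      then have "esssup lborel (\<lambda>t. ennreal (norm (?gL t + ?gH t))) \<le> ennreal \<eta> * (normA xL + normB xH)"
        using Dm by (intro esssup_I AE_I2) auto
      then show "Lnorm \<infinity> (?err kL kH xL xH) \<le> ennreal \<eta> * (normA xL + normB xH)"
        unfolding err[OF aL aH cL cH] Lnorm_def using Dm by simp
    qed
  next
    have "\<forall>m::nat. \<exists>kL kH. approximates ?L (1 / Suc m) k0 kL \<and> approximates ?H (1 / Suc m) k0 kH"
      by (intro allI ex) simp
    from choice[OF this] obtain kL where
      "\<forall>m::nat. \<exists>kH. approximates ?L (1 / Suc m) k0 (kL m) \<and> approximates ?H (1 / Suc m) k0 kH" ..
    from choice[OF this] obtain kH where
      K: "\<forall>m::nat. approximates ?L (1 / Suc m) k0 (kL m) \<and> approximates ?H (1 / Suc m) k0 (kH m)" ..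
    show "\<exists>kL kH :: nat \<Rightarrow> real \<Rightarrow> real.
        (\<forall>m. kL m \<in> causal_kernels \<and> kH m \<in> causal_kernels) \<and>
        (\<forall>xL\<in>X_L \<Omega>. \<forall>xH\<in>X_H \<Omega>. (\<lambda>m. Lnorm 2 (?err (kL m) (kH m) xL xH)) \<longlonglongrightarrow> 0)"
    proof (rule exI[of _ kL], rule exI[of _ kH], intro conjI allI ballI)
      show "kL m \<in> causal_kernels" "kH m \<in> causal_kernels" for m using K approximatesD(1) by blast+
      fix xL xH assume xL: "xL \<in> X_L \<Omega>" and xH: "xH \<in> X_H \<Omega>"
      let ?W = "weighted_sq_norm (L2_fourier xL) + weighted_sq_norm (L2_fourier xH)"
      have "weighted_sq_norm (L2_fourier xL) < top" "weighted_sq_norm (L2_fourier xH) < top"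
        using order.strict_trans1[OF weighted_sq_norm_le in_bandD(4)[OF X_L_in_band[OF xL]]]
          order.strict_trans1[OF weighted_sq_norm_le in_bandD(4)[OF X_H_in_band[OF xH]]] by auto
      then have fin: "?W < top" by simp
      have "(\<lambda>m. 2 * (1 / real (Suc m))\<^sup>2) \<longlonglongrightarrow> 0" by real_asymp
      then have "(\<lambda>m. ennreal (2 * (1 / real (Suc m))\<^sup>2)) \<longlonglongrightarrow> ennreal 0" by (rule tendsto_ennrealI)
      then have "(\<lambda>m. ?W * ennreal (2 * (1 / real (Suc m))\<^sup>2)) \<longlonglongrightarrow> ?W * ennreal 0"
        using fin by (intro ennreal_tendsto_cmult)
      then have lim: "(\<lambda>m. ennreal (2 * (1 / real (Suc m))\<^sup>2) * ?W) \<longlonglongrightarrow> 0"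
        by (simp add: mult.commute)
      have "(\<lambda>m. (Lnorm 2 (?err (kL m) (kH m) xL xH))\<^sup>2) \<longlonglongrightarrow> 0"
      proof (rule tendsto_sandwich[OF _ _ tendsto_const lim])
        show "\<forall>\<^sub>F m in sequentially. (Lnorm 2 (?err (kL m) (kH m) xL xH))\<^sup>2 \<le> ennreal (2 * (1 / real (Suc m))\<^sup>2) * ?W"
          using K by (intro always_eventually allI sq xL xH) auto
      qed simp
      then show "(\<lambda>m. Lnorm 2 (?err (kL m) (kH m) xL xH)) \<longlonglongrightarrow> 0"
        by (simp only: ennreal_square_tendsto_0_iff)
    qed
  next
    fix q :: ennreal and \<eta> :: real assume q: "q > 2" and \<eta>: "\<eta> > 0"
    (* The factor 4 absorbs the constant sqrt (2 * (pi + 1)) lost below. *)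
    have e: "\<eta> / 4 > 0" using \<eta> by simp
    obtain kL kH where aL: "approximates ?L (\<eta> / 4) k0 kL" and aH: "approximates ?H (\<eta> / 4) k0 kH"
      using ex[OF e] by blast
    note kL = approximatesD[OF aL] and kH = approximatesD[OF aH]
    show "\<exists>kL\<in>causal_kernels. \<exists>kH\<in>causal_kernels. \<forall>xL\<in>X_L \<Omega>. \<forall>xH\<in>X_H \<Omega>.
      Lnorm 2 (?err kL kH xL xH) \<le> ennreal \<eta> * (Lnorm q (L2_fourier xL) + Lnorm q (L2_fourier xH))"
    proof (rule bexI[OF _ kL(1)], rule bexI[OF _ kH(1)], intro ballI)
      fix xL xH assume xL: "xL \<in> X_L \<Omega>" and xH: "xH \<in> X_H \<Omega>"
      let ?NL = "Lnorm q (L2_fourier xL)" and ?NH = "Lnorm q (L2_fourier xH)"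
      have "(Lnorm 2 (?err kL kH xL xH))\<^sup>2
        \<le> ennreal (2 * (\<eta> / 4)\<^sup>2) * (ennreal (pi + 1) * ?NL\<^sup>2 + ennreal (pi + 1) * ?NH\<^sup>2)"
        using in_bandD(3)[OF X_L_in_band[OF xL]] in_bandD(3)[OF X_H_in_band[OF xH]]
        by (intro order_trans[OF sq[OF aL aH e xL xH]] mult_left_mono add_mono weighted_sq_norm_le_Lnorm q) auto
      also have "\<dots> = ennreal (2 * (\<eta> / 4)\<^sup>2 * (pi + 1)) * (?NL\<^sup>2 + ?NH\<^sup>2)"
        by (subst ennreal_mult) (simp_all only: distrib_left[symmetric] mult.assoc, auto)
      also have "\<dots> \<le> ennreal (\<eta>\<^sup>2) * (?NL + ?NH)\<^sup>2"
      proof (rule mult_mono)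
        have "2 * (\<eta> / 4)\<^sup>2 * (pi + 1) = \<eta>\<^sup>2 * ((pi + 1) / 8)" by (simp add: power2_eq_square)
        also have "\<dots> \<le> \<eta>\<^sup>2 * 1" using pi_less_4 by (intro mult_left_mono) auto
        finally show "ennreal (2 * (\<eta> / 4)\<^sup>2 * (pi + 1)) \<le> ennreal (\<eta>\<^sup>2)" by (intro ennreal_leI) simp
        have "(?NL + ?NH)\<^sup>2 = (?NL\<^sup>2 + ?NH\<^sup>2) + (?NL * ?NH + ?NH * ?NL)"
          by (simp only: power2_eq_square distrib_left distrib_right add_ac)
        then show "?NL\<^sup>2 + ?NH\<^sup>2 \<le> (?NL + ?NH)\<^sup>2" by simp
      qed auto
      also have "\<dots> = (ennreal \<eta> * (?NL + ?NH))\<^sup>2" using \<eta> by (simp add: power_mult_distrib ennreal_power)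
      finally show "Lnorm 2 (?err kL kH xL xH) \<le> ennreal \<eta> * (?NL + ?NH)"
        by (simp only: ennreal_square_le_iff)
    qed
  qed
qed

end
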